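(* Let $(\Omega,\mathcal{F},Q)$ be a probability space. Let $u:[0,\infty)\to\mathbb{R}$ be continuous, bounded from below, strictly increasing, strictly concave, continuously differentiable on $(0,\infty)$, satisfying the Inada conditions $\lim_{z\downarrow0}u'(z)=\infty$, $\lim_{z\to\infty}u'(z)=0$, and the asymptotic elasticity condition $\limsup_{z\to\infty}\frac{zu'(z)}{u(z)}<1$. Let $\mathcal{X}\subset L^0(Q)$ be convex and closed in $L^0(Q)$ and such that for every $\lambda\in\mathbb{R}$ the set $\{x\in\mathcal{X}:x\ge\lambda\}$ is bounded in $Q$-probability. Let $e_a\in L^\infty(Q)$ with $e_a\ge0$, let $e_p\in L^1(Q)$, let $v:\mathbb{R}\to\mathbb{R}$ be concave and nondecreasing, and let $P'$ be a probability measure equivalent to $Q$ with bounded density $dP'/dQ$. Assume $$\sup_{x\in\mathcal{X}(\|e_a\|_\infty)}E_Q[u(x)]<\infty ,$$ and let $\mathcal{Q}$ be a non-empty set of probability measures equivalent to $Q$ whose set of densities $\{dP/dQ:P\in\mathcal{Q}\}$ is a norm-compact subset of $L^\infty(Q)$. Let $\mathbb{K}$ be a non-empty set of regular Borel probability measures on $\mathcal{Q}$ and $\alpha:\mathbb{K}\to\mathbb{R}$ a convex penalty function. Suppose that an individually rational contract exists, i.e. there is $x^*\in\mathcal{X}(e_a)$ with $E_P[u(x^* )]\ge E_P[u(e_a)]$ for all $P\in\mathcal{Q}$ (this is the case if, for instance, $0\in\mathcal{X}$). Then the problem of finding a mechanism $x:\mathcal{Q}\to\mathcal{X}(e_a)$,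 $P\mapsto x_P$, that maximizes $$\inf_{\kappa\in\mathbb{K}}\left\{\int_{\mathcal{Q}}E_{P'}\big[v(e_p+e_a-x_P)\big]\,d\kappa(P)+\alpha(\kappa)\right\}$$ subject to (i) $P\mapsto E_{P'}[v(e_p+e_a-x_P)]$ is measurable, (ii) $E_P[u(x_P)-u(e_a)]\ge0$ for all $P\in\mathcal{Q}$, (iii) $E_P[u(x_P)-u(x_{\hat P})]\ge0$ for all $P,\hat P\in\mathcal{Q}$, has a solution.
   Context: $L^0(Q)$ is the space of ($Q$-a.s. equivalence classes of) a.s. finite random variables with the topology of convergence in $Q$-probability. A set $X\subset L^0(Q)$ is bounded in $Q$-probability if $\lim_{R\to\infty}\sup_{x\in X}Q(|x|\ge R)=0$. For $e\in L^\infty(Q)$ (constants included), $$\mathcal{X}(e):=\{x\in L^0(Q):0\le x\le e+\bar x\ \text{for some }\bar x\in\mathcal{X}\}.$$ The constant $\|e_a\|_\infty$ is regarded as a constant random variable. $\mathcal{Q}$ is identified with its set of densities in $L^\infty(Q)$ and carries the $L^\infty(Q)$-norm topology and its Borel $\sigma$-algebra. Expectations and integrals of functions whose positive part is integrable are taken with values in $[-\infty,\infty)$. *)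

theory Defs
  imports "HOL-Probability.Probability"
begin

text \<open>
  Elements of $L^0(Q)$ and $L^\infty(Q)$ are represented by measurable functions. The topologies
  below are those of the corresponding pseudometrics, so that open and closed sets are saturated
  under $Q$-a.s. equality (see \<open>closedin_L0_AE_cong\<close>), and all order relations are required only
  almost surely.
\<close>

text \<open>
  The sets of all \<open>y\<close> with \<open>Q (\<bar>x - y\<bar> \<ge> \<epsilon>) < \<epsilon>\<close> form a neighbourhood base at \<open>x\<close> of the topology
  of convergence in \<open>Q\<close>-probability.
\<close>

definition L0_topology :: "'a measure \<Rightarrow> ('a \<Rightarrow> real) topology" where
  "L0_topology Q = topology (\<lambda>U. U \<subseteq> borel_measurable Q \<and>
     (\<forall>x\<in>U. \<exists>\<epsilon>>0. \<forall>y\<in>borel_measurable Q.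
        measure Q {\<omega>\<in>space Q. \<bar>x \<omega> - y \<omega>\<bar> \<ge> \<epsilon>} < \<epsilon> \<longrightarrow> y \<in> U))"

definition L0_convex :: "('a \<Rightarrow> real) set \<Rightarrow> bool" where
  "L0_convex X \<longleftrightarrow>
     (\<forall>x\<in>X. \<forall>y\<in>X. \<forall>t\<in>{0..1::real}. (\<lambda>\<omega>. (1 - t) * x \<omega> + t * y \<omega>) \<in> X)"

definition bounded_in_prob :: "'a measure \<Rightarrow> ('a \<Rightarrow> real) set \<Rightarrow> bool" where
  "bounded_in_prob Q X \<longleftrightarrow>
     ((\<lambda>R::real. SUP x\<in>X. emeasure Q {\<omega>\<in>space Q. \<bar>x \<omega>\<bar> \<ge> R}) \<longlongrightarrow> 0) at_top"

definition Linf_norm :: "'a measure \<Rightarrow> ('a \<Rightarrow> real) \<Rightarrow> ereal" where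
  "Linf_norm Q f = esssup Q (\<lambda>\<omega>. ereal \<bar>f \<omega>\<bar>)"

definition Linf_space :: "'a measure \<Rightarrow> ('a \<Rightarrow> real) set" where
  "Linf_space Q = {f \<in> borel_measurable Q. Linf_norm Q f < \<infinity>}"

definition Linf_topology :: "'a measure \<Rightarrow> ('a \<Rightarrow> real) topology" where
  "Linf_topology Q = topology (\<lambda>U. U \<subseteq> Linf_space Q \<and>
     (\<forall>f\<in>U. \<exists>\<epsilon>>0. \<forall>g\<in>Linf_space Q. Linf_norm Q (\<lambda>\<omega>. f \<omega> - g \<omega>) < ereal \<epsilon> \<longrightarrow> g \<in> U))"

definition equivalent_prob :: "'a measure \<Rightarrow> 'a measure \<Rightarrow> bool" where
  "equivalent_prob Q P \<longleftrightarrow> prob_space P \<and> sets P = sets Q \<and>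
     absolutely_continuous Q P \<and> absolutely_continuous P Q"

definition dens :: "'a measure \<Rightarrow> 'a measure \<Rightarrow> 'a \<Rightarrow> real" where
  "dens Q P = (\<lambda>\<omega>. enn2real (RN_deriv Q P \<omega>))"

text \<open>The topology on a set of measures obtained by identifying measures with their densities.\<close>

definition dens_topology :: "'a measure \<Rightarrow> 'a measure set \<Rightarrow> 'a measure topology" where
  "dens_topology Q \<Q> = pullback_topology \<Q> (dens Q) (Linf_topology Q)"

definition borel_of :: "'b topology \<Rightarrow> 'b measure" where
  "borel_of T = sigma (topspace T) {U. openin T U}"

definition regular_borel_prob :: "'b topology \<Rightarrow> 'b measure \<Rightarrow> bool" where
  "regular_borel_prob T \<kappa> \<longleftrightarrow> prob_space \<kappa> \<and> sets \<kappa> = sets (borel_of T) \<and>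
     (\<forall>A\<in>sets \<kappa>.
        emeasure \<kappa> A = (SUP K\<in>{K\<in>sets \<kappa>. compactin T K \<and> K \<subseteq> A}. emeasure \<kappa> K) \<and>
        emeasure \<kappa> A = (INF U\<in>{U. openin T U \<and> A \<subseteq> U}. emeasure \<kappa> U))"

text \<open>
  The domain \<open>K\<close> is not assumed convex: the convexity inequality is required for those mixtures that
  belong to \<open>K\<close>.
\<close>

definition convex_penalty :: "'b measure set \<Rightarrow> ('b measure \<Rightarrow> real) \<Rightarrow> bool" where
  "convex_penalty K \<alpha> \<longleftrightarrow>
     (\<forall>\<kappa>\<^sub>0\<in>K. \<forall>\<kappa>\<^sub>1\<in>K. \<forall>\<kappa>\<in>K. \<forall>t\<in>{0..1::real}.
        (\<forall>A\<in>sets \<kappa>. measure \<kappa> A = (1 - t) * measure \<kappa>\<^sub>0 A + t * measure \<kappa>\<^sub>1 A) \<longrightarrow>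
        \<alpha> \<kappa> \<le> (1 - t) * \<alpha> \<kappa>\<^sub>0 + t * \<alpha> \<kappa>\<^sub>1)"

text \<open>
  The integral with values in the extended reals, meaningful whenever the positive or the negative
  part is integrable; \<open>e2ennreal\<close> maps negative numbers to \<open>0\<close>. Unlike the Bochner integral it does
  not default to \<open>0\<close> for non-integrable functions.
\<close>

definition ext_integral :: "'a measure \<Rightarrow> ('a \<Rightarrow> ereal) \<Rightarrow> ereal" where
  "ext_integral M f =
     enn2ereal (\<integral>\<^sup>+ \<omega>. e2ennreal (f \<omega>) \<partial>M) - enn2ereal (\<integral>\<^sup>+ \<omega>. e2ennreal (- f \<omega>) \<partial>M)"

abbreviation expect :: "'a measure \<Rightarrow> ('a \<Rightarrow> real) \<Rightarrow> ereal" where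
  "expect M f \<equiv> ext_integral M (\<lambda>\<omega>. ereal (f \<omega>))"

definition strictly_concave_on :: "real set \<Rightarrow> (real \<Rightarrow> real) \<Rightarrow> bool" where
  "strictly_concave_on S f \<longleftrightarrow> convex S \<and>
     (\<forall>x\<in>S. \<forall>y\<in>S. \<forall>t\<in>{0<..<1::real}. x \<noteq> y \<longrightarrow>
        (1 - t) * f x + t * f y < f ((1 - t) * x + t * y))"

text \<open>
  The utility function lives on \<open>[0,\<infinity>)\<close>; values of \<open>u\<close> at negative arguments are irrelevant.
\<close>

definition utility_fn :: "(real \<Rightarrow> real) \<Rightarrow> bool" where
  "utility_fn u \<longleftrightarrow>
     continuous_on {0..} u \<and> bdd_below (u ` {0..}) \<and>
     strict_mono_on {0..} u \<and> strictly_concave_on {0..} u \<and>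
     u differentiable_on {0<..} \<and> continuous_on {0<..} (deriv u) \<and>
     filterlim (deriv u) at_top (at_right 0) \<and>
     (deriv u \<longlongrightarrow> 0) at_top \<and>
     Limsup at_top (\<lambda>z. ereal (z * deriv u z / u z)) < 1"

definition attainable :: "'a measure \<Rightarrow> ('a \<Rightarrow> real) set \<Rightarrow> ('a \<Rightarrow> real) \<Rightarrow> ('a \<Rightarrow> real) set" where
  "attainable Q X e = {x \<in> borel_measurable Q.
     (AE \<omega> in Q. 0 \<le> x \<omega>) \<and> (\<exists>x'\<in>X. AE \<omega> in Q. x \<omega> \<le> e \<omega> + x' \<omega>)}"

definition individually_rational ::
  "(real \<Rightarrow> real) \<Rightarrow> ('a \<Rightarrow> real) \<Rightarrow> 'a measure set \<Rightarrow> ('a \<Rightarrow> real) \<Rightarrow> bool" where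
  "individually_rational u e\<^sub>a \<Q> x \<longleftrightarrow>
     (\<forall>P\<in>\<Q>. expect P (\<lambda>\<omega>. u (x \<omega>)) \<ge> expect P (\<lambda>\<omega>. u (e\<^sub>a \<omega>)))"

definition principal_utility ::
  "(real \<Rightarrow> real) \<Rightarrow> ('a \<Rightarrow> real) \<Rightarrow> ('a \<Rightarrow> real) \<Rightarrow> 'a measure \<Rightarrow> ('a \<Rightarrow> real) \<Rightarrow> ereal" where
  "principal_utility v e\<^sub>p e\<^sub>a P' x = expect P' (\<lambda>\<omega>. v (e\<^sub>p \<omega> + e\<^sub>a \<omega> - x \<omega>))"

definition objective ::
  "(real \<Rightarrow> real) \<Rightarrow> ('a \<Rightarrow> real) \<Rightarrow> ('a \<Rightarrow> real) \<Rightarrow> 'a measure \<Rightarrow>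
   'a measure measure set \<Rightarrow> ('a measure measure \<Rightarrow> real) \<Rightarrow>
   ('a measure \<Rightarrow> 'a \<Rightarrow> real) \<Rightarrow> ereal" where
  "objective v e\<^sub>p e\<^sub>a P' K \<alpha> x =
     (INF \<kappa>\<in>K. ext_integral \<kappa> (\<lambda>P. principal_utility v e\<^sub>p e\<^sub>a P' (x P)) + ereal (\<alpha> \<kappa>))"

definition feasible ::
  "'a measure \<Rightarrow> (real \<Rightarrow> real) \<Rightarrow> ('a \<Rightarrow> real) set \<Rightarrow> ('a \<Rightarrow> real) \<Rightarrow> ('a \<Rightarrow> real) \<Rightarrow>
   (real \<Rightarrow> real) \<Rightarrow> 'a measure \<Rightarrow> 'a measure set \<Rightarrow> ('a measure \<Rightarrow> 'a \<Rightarrow> real) \<Rightarrow> bool" where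
  "feasible Q u X e\<^sub>a e\<^sub>p v P' \<Q> x \<longleftrightarrow>
     (\<forall>P\<in>\<Q>. x P \<in> attainable Q X e\<^sub>a) \<and>
     (\<lambda>P. principal_utility v e\<^sub>p e\<^sub>a P' (x P)) \<in> borel_measurable (borel_of (dens_topology Q \<Q>)) \<and>
     (\<forall>P\<in>\<Q>. expect P (\<lambda>\<omega>. u (x P \<omega>) - u (e\<^sub>a \<omega>)) \<ge> 0) \<and>
     (\<forall>P\<in>\<Q>. \<forall>P1\<in>\<Q>. expect P (\<lambda>\<omega>. u (x P \<omega>) - u (x P1 \<omega>)) \<ge> 0)"

lemma istopology_nhds:
  fixes N :: "'b \<Rightarrow> real \<Rightarrow> 'b \<Rightarrow> bool"
  assumes mono: "\<And>x y \<delta> \<epsilon>. N x \<delta> y \<Longrightarrow> 0 < \<delta> \<Longrightarrow> \<delta> \<le> \<epsilon> \<Longrightarrow> x \<in> S \<Longrightarrow> y \<in> S \<Longrightarrow> N x \<epsilon> y"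
  shows "istopology (\<lambda>U. U \<subseteq> S \<and> (\<forall>x\<in>U. \<exists>\<epsilon>>0. \<forall>y\<in>S. N x \<epsilon> y \<longrightarrow> y \<in> U))"
  unfolding istopology_def
proof (intro conjI allI impI)
  fix U V
  assume U: "U \<subseteq> S \<and> (\<forall>x\<in>U. \<exists>\<epsilon>>0. \<forall>y\<in>S. N x \<epsilon> y \<longrightarrow> y \<in> U)"
    and V: "V \<subseteq> S \<and> (\<forall>x\<in>V. \<exists>\<epsilon>>0. \<forall>y\<in>S. N x \<epsilon> y \<longrightarrow> y \<in> V)"
  show "U \<inter> V \<subseteq> S" using U by blast
  show "\<forall>x\<in>U \<inter> V. \<exists>\<epsilon>>0. \<forall>y\<in>S. N x \<epsilon> y \<longrightarrow> y \<in> U \<inter> V"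
  proof
    fix x assume x: "x \<in> U \<inter> V"
    obtain a where a: "a > 0" "\<And>y. y \<in> S \<Longrightarrow> N x a y \<Longrightarrow> y \<in> U"
      using U x by blast
    obtain b where b: "b > 0" "\<And>y. y \<in> S \<Longrightarrow> N x b y \<Longrightarrow> y \<in> V"
      using V x by blast
    have xS: "x \<in> S" using U x by blast
    have "y \<in> U \<inter> V" if "y \<in> S" "N x (min a b) y" for y
      using a b that mono[OF that(2) _ _ xS that(1), of a] mono[OF that(2) _ _ xS that(1), of b]
      by auto
    then show "\<exists>\<epsilon>>0. \<forall>y\<in>S. N x \<epsilon> y \<longrightarrow> y \<in> U \<inter> V"
      using a(1) b(1) by (intro exI[of _ "min a b"]) auto
  qed
next
  fix \<U> assume U: "\<forall>U\<in>\<U>. U \<subseteq> S \<and> (\<forall>x\<in>U. \<exists>\<epsilon>>0. \<forall>y\<in>S. N x \<epsilon> y \<longrightarrow> y \<in> U)"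
  show "\<Union>\<U> \<subseteq> S" using U by blast
  show "\<forall>x\<in>\<Union>\<U>. \<exists>\<epsilon>>0. \<forall>y\<in>S. N x \<epsilon> y \<longrightarrow> y \<in> \<Union>\<U>"
    using U by (meson UnionE UnionI)
qed

lemma openin_L0_topology:
  assumes "prob_space Q"
  shows "openin (L0_topology Q) U \<longleftrightarrow> U \<subseteq> borel_measurable Q \<and>
     (\<forall>x\<in>U. \<exists>\<epsilon>>0. \<forall>y\<in>borel_measurable Q.
        measure Q {\<omega>\<in>space Q. \<bar>x \<omega> - y \<omega>\<bar> \<ge> \<epsilon>} < \<epsilon> \<longrightarrow> y \<in> U)"
proof -
  interpret prob_space Q by fact
  have "measure Q {\<omega>\<in>space Q. \<bar>x \<omega> - y \<omega>\<bar> \<ge> \<epsilon>} < \<epsilon>"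
    if "measure Q {\<omega>\<in>space Q. \<bar>x \<omega> - y \<omega>\<bar> \<ge> \<delta>} < \<delta>" "\<delta> \<le> \<epsilon>"
      "x \<in> borel_measurable Q" "y \<in> borel_measurable Q" for x y :: "'a \<Rightarrow> real" and \<delta> \<epsilon> :: real
  proof -
    note [measurable] = that(3,4)
    have "measure Q {\<omega>\<in>space Q. \<bar>x \<omega> - y \<omega>\<bar> \<ge> \<epsilon>} \<le> measure Q {\<omega>\<in>space Q. \<bar>x \<omega> - y \<omega>\<bar> \<ge> \<delta>}"
      by (rule finite_measure_mono) (use that(2) in auto)
    then show ?thesis using that by linarith
  qed
  then have "istopology (\<lambda>U. U \<subseteq> borel_measurable Q \<and>
     (\<forall>x\<in>U. \<exists>\<epsilon>>0. \<forall>y\<in>borel_measurable Q.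
        measure Q {\<omega>\<in>space Q. \<bar>x \<omega> - y \<omega>\<bar> \<ge> \<epsilon>} < \<epsilon> \<longrightarrow> y \<in> U))"
    by (intro istopology_nhds[where S = "borel_measurable Q" and
          N = "\<lambda>x \<epsilon> y. measure Q {\<omega>\<in>space Q. \<bar>x \<omega> - y \<omega>\<bar> \<ge> \<epsilon>} < \<epsilon>"]) blast
  then show ?thesis
    unfolding L0_topology_def by (simp only: topology_inverse')
qed

lemma topspace_L0_topology:
  assumes "prob_space Q"
  shows "topspace (L0_topology Q) = borel_measurable Q"
proof -
  have "openin (L0_topology Q) (borel_measurable Q)"
    unfolding openin_L0_topology[OF assms] by (auto intro: exI[of _ 1])
  then show ?thesis
    by (meson openin_L0_topology[OF assms] openin_subset openin_topspace subset_antisym)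
qed

lemma closedin_L0_AE_cong:
  assumes Q: "prob_space Q" and X: "closedin (L0_topology Q) X" and x: "x \<in> X"
    and y: "y \<in> borel_measurable Q" and eq: "AE \<omega> in Q. x \<omega> = y \<omega>"
  shows "y \<in> X"
proof (rule ccontr)
  assume "y \<notin> X"
  have XM: "X \<subseteq> borel_measurable Q" and op: "openin (L0_topology Q) (borel_measurable Q - X)"
    using X by (auto simp: closedin_def topspace_L0_topology[OF Q])
  obtain \<epsilon> where \<epsilon>: "\<epsilon> > 0" "\<And>z. z \<in> borel_measurable Q \<Longrightarrow>
      measure Q {\<omega>\<in>space Q. \<bar>y \<omega> - z \<omega>\<bar> \<ge> \<epsilon>} < \<epsilon> \<Longrightarrow> z \<in> borel_measurable Q - X"
    using op y \<open>y \<notin> X\<close> unfolding openin_L0_topology[OF Q] by blast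
  have [measurable]: "x \<in> borel_measurable Q" "y \<in> borel_measurable Q" using x XM y by auto
  have "emeasure Q {\<omega>\<in>space Q. \<bar>y \<omega> - x \<omega>\<bar> \<ge> \<epsilon>} = 0"
    by (rule emeasure_eq_0_AE) (use eq \<epsilon>(1) in auto)
  then have "measure Q {\<omega>\<in>space Q. \<bar>y \<omega> - x \<omega>\<bar> \<ge> \<epsilon>} = 0"
    by (simp add: measure_def)
  then show False using \<epsilon>(1) \<epsilon>(2)[of x] x by simp
qed

lemma openin_Linf_topology:
  "openin (Linf_topology Q) U \<longleftrightarrow> U \<subseteq> Linf_space Q \<and>
     (\<forall>f\<in>U. \<exists>\<epsilon>>0. \<forall>g\<in>Linf_space Q. Linf_norm Q (\<lambda>\<omega>. f \<omega> - g \<omega>) < ereal \<epsilon> \<longrightarrow> g \<in> U)"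
proof -
  have "istopology (\<lambda>U. U \<subseteq> Linf_space Q \<and>
     (\<forall>f\<in>U. \<exists>\<epsilon>>0. \<forall>g\<in>Linf_space Q. Linf_norm Q (\<lambda>\<omega>. f \<omega> - g \<omega>) < ereal \<epsilon> \<longrightarrow> g \<in> U))"
    by (rule istopology_nhds) (meson ereal_less_eq(3) order_less_le_trans)
  then show ?thesis
    unfolding Linf_topology_def by (simp only: topology_inverse')
qed

lemma topspace_Linf_topology: "topspace (Linf_topology Q) = Linf_space Q"
proof -
  have "openin (Linf_topology Q) (Linf_space Q)"
    unfolding openin_Linf_topology by (auto intro: exI[of _ 1])
  then show ?thesis
    by (meson openin_Linf_topology openin_subset openin_topspace subset_antisym)
qed

end

theory Submission
  imports Defs "HOL-Complex_Analysis.Great_Picard"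
begin

text \<open>
  Write \<open>\<rho> = u - u 0\<close>. In the coordinate \<open>\<rho> x\<close> the expected utilities of the agent are linear, and since
  \<open>u\<close> is concave and \<open>v\<close> is concave and nondecreasing, the superlevel sets of the principal's utility
  and the attainable set are convex. Asymptotic elasticity makes the utilities of attainable payoffs
  uniformly integrable, so that attainable payoffs admit weak limits along which all \<open>E\<^sub>P (u x)\<close>
  converge and the principal's utility is upper semicontinuous.

  The indirect utilities \<open>P \<mapsto> E\<^sub>P (u (x P))\<close> of incentive compatible mechanisms are Lipschitz in the
  density of \<open>P\<close>, uniformly in the mechanism. Along a maximizing sequence of mechanisms they
  therefore have a pointwise limit \<open>U\<close>. For each \<open>P\<close>, let \<open>y P\<close> maximize the principal's utility over the
  attainable \<open>z\<close> with \<open>E\<^sub>P (u z) = U P\<close> and \<open>E\<^sub>R (u z) \<le> U R\<close> for all \<open>R\<close>. Incentive compatibility of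
  \<open>y\<close> is automatic, and its value function is upper semicontinuous in \<open>P\<close>, hence measurable, and
  dominates the upper limit of the value functions of the sequence; reverse Fatou gives optimality.
\<close>

text \<open>The obstacle is that compactness gives limits only after mixing, and mixtures suited to
  one prior need not suit another, while there may be uncountably many priors. So no limit of the
  mechanisms themselves is formed. Only the numbers \<open>EU (d P) (x n P)\<close> are made to
  converge, along one subsequence for all priors, and payoffs are then rebuilt at each prior
  separately. Mixtures are never written down either: one works with sets cut out by all one-sided
  bounds that a tail of the sequence satisfies. Such sets are stable under the midpoint
  \<open>m\<close> with \<open>\<rho> m = (\<rho> a + \<rho> b) / 2\<close>; concavity puts
  \<open>m\<close> below the arithmetic midpoint, so solidity keeps it attainable and monotonicity
  of \<open>v\<close> makes it no worse for the principal. The choice of payoffs over the priors is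
  arbitrary, which suffices because the problem asks for measurability of the principal's value
  function alone.\<close>

section \<open>Convex compactness for nonnegative random variables\<close>

text \<open>
  The chart of a utility function \<open>u\<close> is \<open>\<rho> z = u (max 0 z) - u 0\<close>. The truncation makes \<open>\<rho>\<close> Borel on the
  whole line, although nothing is known about \<open>u\<close> on negative arguments.
\<close>

locale utility_chart =
  fixes \<rho> :: "real \<Rightarrow> real"
  assumes continuous: "continuous_on UNIV \<rho>"
    and nonpos: "z \<le> 0 \<Longrightarrow> \<rho> z = 0"
    and strict: "0 \<le> a \<Longrightarrow> a < b \<Longrightarrow> \<rho> a < \<rho> b"
begin

lemma mono: "a \<le> b \<Longrightarrow> \<rho> a \<le> \<rho> b"
  using strict[of a b] strict[of 0 b] nonpos[of a] nonpos[of b] nonpos[of 0]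
  by (cases "a \<le> 0"; cases "b \<le> 0"; cases "a = b") auto

lemma nonneg: "0 \<le> \<rho> z"
  using mono[of "min 0 z" z] nonpos[of "min 0 z"] by simp

lemma le_iff: "0 \<le> b \<Longrightarrow> \<rho> a \<le> \<rho> b \<longleftrightarrow> a \<le> b"
  using mono[of a b] strict[of b a] by (cases "a \<le> b") auto

lemma less_iff: "0 \<le> a \<Longrightarrow> \<rho> a < \<rho> b \<longleftrightarrow> a < b"
  using le_iff[of a b] by (simp add: not_le[symmetric])

lemma measurable [measurable]: "\<rho> \<in> borel_measurable borel"
  using continuous by (rule borel_measurable_continuous_onI)

lemma tendsto: "(x \<longlongrightarrow> l) F \<Longrightarrow> ((\<lambda>n. \<rho> (x n)) \<longlongrightarrow> \<rho> l) F"
  using continuous by (metis UNIV_I continuous_on_eq_continuous_at isCont_tendsto_compose open_UNIV)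

text \<open>Strict monotonicity on the half-line makes \<rho> reflect the order, so the order form
  of convergence passes back through \<rho> without constructing an inverse function.\<close>

lemma tendsto_of_chart:
  assumes l: "l \<ge> 0" and x: "eventually (\<lambda>n. 0 \<le> x n) F" and lim: "((\<lambda>n. \<rho> (x n)) \<longlongrightarrow> \<rho> l) F"
  shows "(x \<longlongrightarrow> l) F"
proof (rule order_tendstoI)
  fix a assume "a < l"
  show "eventually (\<lambda>n. a < x n) F"
  proof (cases "a < 0")
    case True
    then show ?thesis using x by (auto elim: eventually_mono)
  next
    case False
    then have "\<rho> a < \<rho> l" using \<open>a < l\<close> by (simp add: strict)
    then have "eventually (\<lambda>n. \<rho> a < \<rho> (x n)) F" using lim by (simp add: order_tendstoD)
    then show ?thesis by eventually_elim (use False less_iff in auto)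
  qed
next
  fix a assume "l < a"
  then have "\<rho> l < \<rho> a" using l by (simp add: strict)
  then have "eventually (\<lambda>n. \<rho> (x n) < \<rho> a) F" using lim by (simp add: order_tendstoD)
  with x show "eventually (\<lambda>n. x n < a) F" by eventually_elim (use less_iff in auto)
qed

text \<open>Convergence of the exponentials alone would allow \<open>x\<close> to run off to
  infinity. The frequent bound yields a cluster point \<open>l\<close> in a compact interval; it
  identifies the limit as \<open>exp (- (\<rho> l / 2))\<close>, which is positive, so logarithms
  can be taken along the whole sequence.\<close>

lemma convergent_of_exp_chart:
  assumes x: "\<And>n. 0 \<le> x n" and conv: "convergent (\<lambda>n. exp (- (\<rho> (x n) / 2)))"
    and R: "\<exists>\<^sub>F n in sequentially. x n \<le> R"
  shows "convergent x"
proof -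
  obtain r :: "nat \<Rightarrow> nat" where r: "strict_mono r" "\<And>n. x (r n) \<le> R"
    using not_eventually_sequentiallyD[of "\<lambda>n. \<not> x n \<le> R"] R by (auto simp: frequently_def)
  then have "range (x \<circ> r) \<subseteq> {0..R}" using x by auto
  then obtain l s where ls: "l \<in> {0..R}" "strict_mono s" "(x \<circ> r \<circ> s) \<longlonglongrightarrow> l"
    using compact_imp_seq_compact[OF compact_Icc, of 0 R] unfolding seq_compact_def
    by (metis range_subsetD)
  define t where "t = r \<circ> s"
  have t: "strict_mono t" "(\<lambda>n. x (t n)) \<longlonglongrightarrow> l"
    using ls r by (auto simp: t_def strict_mono_o comp_assoc) (simp add: o_def)
  obtain w where w: "(\<lambda>n. exp (- (\<rho> (x n) / 2))) \<longlonglongrightarrow> w" using conv convergent_def by blast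
  have "(\<lambda>n. exp (- (\<rho> (x (t n)) / 2))) \<longlonglongrightarrow> w"
    using LIMSEQ_subseq_LIMSEQ[OF w t(1)] by (simp add: o_def)
  moreover have "(\<lambda>n. exp (- (\<rho> (x (t n)) / 2))) \<longlonglongrightarrow> exp (- (\<rho> l / 2))"
    by (intro tendsto_intros tendsto t) auto
  ultimately have "w = exp (- (\<rho> l / 2))" using LIMSEQ_unique by blast
  then have "(\<lambda>n. - 2 * ln (exp (- (\<rho> (x n) / 2)))) \<longlonglongrightarrow> - 2 * ln (exp (- (\<rho> l / 2)))"
    using w by (intro tendsto_mult tendsto_const tendsto_ln) auto
  then have "(\<lambda>n. - 2 * (- (\<rho> (x n) / 2))) \<longlonglongrightarrow> - 2 * (- (\<rho> l / 2))" by (simp only: ln_exp)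
  then have "(\<lambda>n. \<rho> (x n)) \<longlonglongrightarrow> \<rho> l" by simp
  then have "x \<longlonglongrightarrow> l" by (rule tendsto_of_chart[rotated 2]) (use ls(1) x in auto)
  then show ?thesis by (rule convergentI)
qed

end

text \<open>Only upper tails are controlled: the sets to which this is applied consist of a.e.
  nonnegative functions.\<close>

definition uniformly_tight :: "'a measure \<Rightarrow> ('a \<Rightarrow> real) set \<Rightarrow> bool" where
  "uniformly_tight Q A \<longleftrightarrow>
     (\<forall>\<epsilon>>0. \<exists>R. \<forall>x\<in>A. measure Q {\<omega>\<in>space Q. R \<le> x \<omega>} \<le> \<epsilon>)"

lemma uniformly_tight_subset: "uniformly_tight Q B \<Longrightarrow> A \<subseteq> B \<Longrightarrow> uniformly_tight Q A"
  unfolding uniformly_tight_def by blast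

context prob_space
begin

text \<open>The bad event is that \<open>x n\<close> tends to infinity. It is the intersection over
  \<open>m\<close> of the lower limits of the events \<open>m \<le> x n\<close>, and a lower limit
  of events has at most the supremum of their probabilities. A tight sequence may still be a.s.
  unbounded, hence a bound for infinitely many \<open>n\<close> only.\<close>

lemma AE_frequently_bounded:
  fixes x :: "nat \<Rightarrow> 'a \<Rightarrow> real"
  assumes [measurable]: "\<And>n. x n \<in> borel_measurable M"
    and tight: "uniformly_tight M (range x)"
  shows "AE \<omega> in M. \<exists>R. \<exists>\<^sub>F n in sequentially. x n \<omega> \<le> R"
proof -
  define B where "B m = {\<omega>\<in>space M. \<forall>\<^sub>F n in sequentially. real m \<le> x n \<omega>}" for m :: nat
  have [measurable]: "B m \<in> sets M" for m
    unfolding B_def eventually_sequentially by measurable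
  have [measurable]: "(\<Inter>m. B m) \<in> sets M" by (rule sets.countable_INT) auto
  have "prob (\<Inter>m. B m) \<le> \<epsilon>" if "\<epsilon> > 0" for \<epsilon>
  proof -
    obtain R where R: "\<And>n. prob {\<omega>\<in>space M. R \<le> x n \<omega>} \<le> \<epsilon>"
      using tight \<open>\<epsilon> > 0\<close> unfolding uniformly_tight_def by blast
    obtain m :: nat where m: "R \<le> real m" using real_arch_simple by blast
    define G where "G N = {\<omega>\<in>space M. \<forall>n\<ge>N. real m \<le> x n \<omega>}" for N
    have [measurable]: "G N \<in> sets M" for N unfolding G_def by measurable
    have BG: "B m = (\<Union>N. G N)" unfolding B_def G_def eventually_sequentially by auto
    have "(\<lambda>N. prob (G N)) \<longlonglongrightarrow> prob (\<Union>N. G N)"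
      by (rule finite_Lim_measure_incseq) (auto simp: incseq_def G_def)
    moreover have "prob (G N) \<le> \<epsilon>" for N
    proof -
      have "prob (G N) \<le> prob {\<omega>\<in>space M. R \<le> x N \<omega>}"
        by (rule finite_measure_mono) (use m in \<open>auto simp: G_def intro: order_trans\<close>)
      then show ?thesis using R[of N] by simp
    qed
    ultimately have "prob (B m) \<le> \<epsilon>" unfolding BG by (meson LIMSEQ_le_const2)
    moreover have "prob (\<Inter>m. B m) \<le> prob (B m)" by (rule finite_measure_mono) auto
    ultimately show ?thesis by simp
  qed
  then have "prob (\<Inter>m. B m) = 0"
    by (metis measure_le_0_iff dense not_le)
  then have "AE \<omega> in M. \<omega> \<notin> (\<Inter>m. B m)"
    by (intro AE_not_in) (auto simp: null_sets_def emeasure_eq_measure)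
  then show ?thesis
    by (rule AE_mp, intro AE_I2) (auto simp: B_def not_eventually not_le elim!: frequently_elim1
        intro: less_imp_le)
qed

text \<open>The increments are absolutely summable a.s., because their expectations are: weighting
  the squares by \<open>4^n\<close> still leaves a geometric series when they decay like
  \<open>(1/16)^n\<close>.\<close>

lemma AE_convergent_of_fast_Cauchy:
  fixes w :: "nat \<Rightarrow> 'a \<Rightarrow> real"
  assumes [measurable]: "\<And>n. w n \<in> borel_measurable M"
    and int: "\<And>n. integrable M (\<lambda>\<omega>. (w n \<omega> - w (Suc n) \<omega>)\<^sup>2)"
    and fast: "\<And>n. expectation (\<lambda>\<omega>. (w n \<omega> - w (Suc n) \<omega>)\<^sup>2) \<le> 4 * (1/16)^n"
  shows "AE \<omega> in M. convergent (\<lambda>n. w n \<omega>)"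
proof -
  define d where "d n \<omega> = \<bar>w n \<omega> - w (Suc n) \<omega>\<bar>" for n \<omega>
  have [measurable]: "d n \<in> borel_measurable M" for n unfolding d_def by measurable
  \<comment> \<open>Expand the square of \<open>2^n * d n \<omega> - (1/2)^n\<close>.\<close>
  have bound: "d n \<omega> \<le> 4^n * (w n \<omega> - w (Suc n) \<omega>)\<^sup>2 + (1/4)^n" for n \<omega>
  proof -
    have four: "((2::real)^n)\<^sup>2 = 4^n" by (simp add: power2_eq_square flip: power_mult_distrib)
    then have "((1/2::real)^n)\<^sup>2 = (1/4)^n" "(2::real)^n * (1/2)^n = 1"
      by (simp_all add: power_divide)
    moreover note four
    moreover have "0 \<le> (2^n * d n \<omega> - (1/2)^n)\<^sup>2" by simp
    ultimately have "0 \<le> 4^n * (d n \<omega>)\<^sup>2 + (1/4)^n - 2 * d n \<omega>"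
      by (simp add: power2_diff power_mult_distrib algebra_simps)
    then have "2 * d n \<omega> \<le> 4^n * (w n \<omega> - w (Suc n) \<omega>)\<^sup>2 + (1/4)^n" by (simp add: d_def)
    moreover have "0 \<le> d n \<omega>" by (simp add: d_def)
    ultimately show ?thesis by linarith
  qed
  have "(\<integral>\<^sup>+\<omega>. ennreal (d n \<omega>) \<partial>M) \<le> ennreal (5 * (1/4)^n)" for n
  proof -
    have "(\<integral>\<^sup>+\<omega>. ennreal (d n \<omega>) \<partial>M)
        \<le> (\<integral>\<^sup>+\<omega>. ennreal (4^n * (w n \<omega> - w (Suc n) \<omega>)\<^sup>2 + (1/4)^n) \<partial>M)"
      by (intro nn_integral_mono ennreal_leI bound)
    also have "\<dots> = ennreal (expectation (\<lambda>\<omega>. 4^n * (w n \<omega> - w (Suc n) \<omega>)\<^sup>2 + (1/4)^n))"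
      by (intro nn_integral_eq_integral) (use int in auto)
    also have "expectation (\<lambda>\<omega>. 4^n * (w n \<omega> - w (Suc n) \<omega>)\<^sup>2 + (1/4)^n)
        = 4^n * expectation (\<lambda>\<omega>. (w n \<omega> - w (Suc n) \<omega>)\<^sup>2) + (1/4)^n"
      using int[of n] by (simp add: prob_space)
    also have "\<dots> \<le> 4^n * (4 * (1/16)^n) + (1/4)^n"
      using fast[of n] by (intro add_mono mult_left_mono) auto
    also have "\<dots> = 5 * (1/4)^n"
      by (simp add: power_divide field_simps flip: power_mult_distrib)
    finally show ?thesis by (simp add: ennreal_leI)
  qed
  then have "(\<Sum>n. \<integral>\<^sup>+\<omega>. ennreal (d n \<omega>) \<partial>M) \<le> (\<Sum>n. ennreal (5 * (1/4)^n))"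
    by (intro suminf_le) auto
  also have "\<dots> < \<infinity>"
    by (subst suminf_ennreal2) (auto intro!: summable_mult summable_geometric)
  finally have "(\<integral>\<^sup>+\<omega>. (\<Sum>n. ennreal (d n \<omega>)) \<partial>M) \<noteq> \<infinity>"
    by (subst nn_integral_suminf) auto
  then have "AE \<omega> in M. (\<Sum>n. ennreal (d n \<omega>)) \<noteq> \<infinity>"
    by (intro nn_integral_PInf_AE) auto
  then show ?thesis
  proof eventually_elim
    case (elim \<omega>)
    then have "summable (\<lambda>n. d n \<omega>)"
      by (intro summable_suminf_not_top) (auto simp: d_def)
    then have "summable (\<lambda>n. \<bar>w (Suc n) \<omega> - w n \<omega>\<bar>)"
      by (simp add: d_def abs_minus_commute)
    then have "summable (\<lambda>n. w (Suc n) \<omega> - w n \<omega>)"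
      by (rule summable_rabs_cancel)
    then have "convergent (\<lambda>n. \<Sum>i<n. w (Suc i) \<omega> - w i \<omega>)"
      by (simp add: summable_iff_convergent)
    then have "convergent (\<lambda>n. w n \<omega> - w 0 \<omega>)" 
      by (subst (asm) sum_lessThan_telescope)
    then show ?case using convergent_add[OF _ convergent_const[of "w 0 \<omega>"], of "\<lambda>n. w n \<omega> - w 0 \<omega>"] by simp
  qed
qed

end

text \<open>
  This replaces the extraction of convergent convex combinations by Komlos' theorem: minimising \<open>E exp (- \<rho> x)\<close> along the sets \<open>C n\<close> makes
  \<open>exp (- \<rho> (x n) / 2)\<close> a Cauchy sequence in $L^2$, because the midpoint defect of the exponential
  is half the square of the difference of these functions.
\<close>

lemma (in utility_chart) convex_compactness:
  assumes "prob_space Q"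
    and C: "\<And>n x. x \<in> C n \<Longrightarrow> x \<in> borel_measurable Q \<and> (AE \<omega> in Q. 0 \<le> x \<omega>)"
    and ne: "\<And>n. C n \<noteq> {}" and dec: "decseq C"
    and mid: "\<And>n x y. x \<in> C n \<Longrightarrow> y \<in> C n \<Longrightarrow>
      \<exists>m\<in>C n. AE \<omega> in Q. \<rho> (m \<omega>) = (\<rho> (x \<omega>) + \<rho> (y \<omega>)) / 2"
    and tight: "uniformly_tight Q (C 0)"
  obtains x z where "\<And>n. x n \<in> C n" "z \<in> borel_measurable Q" "AE \<omega> in Q. (\<lambda>n. x n \<omega>) \<longlonglongrightarrow> z \<omega>"
proof -
  interpret prob_space Q by fact
  define \<Phi> where "\<Phi> x = expectation (\<lambda>\<omega>. exp (- \<rho> (x \<omega>)))" for x :: "'a \<Rightarrow> real"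
  have M: "x \<in> borel_measurable Q" if "x \<in> C n" for x n using C that by blast
  have int: "integrable Q (\<lambda>\<omega>. exp (- \<rho> (x \<omega>)))" if [measurable]: "x \<in> borel_measurable Q" for x
    by (rule integrable_const_bound[of _ 1]) (auto simp: nonneg)
  have \<Phi>_bd: "0 \<le> \<Phi> x" "\<Phi> x \<le> 1" if "x \<in> borel_measurable Q" for x
    using int[OF that] nonneg by (auto simp: \<Phi>_def intro!: integral_nonneg integral_le_const)
  define J where "J n = (INF x\<in>C n. \<Phi> x)" for n
  have bdd: "bdd_below (\<Phi> ` C n)" for n using \<Phi>_bd(1) M by (intro bdd_belowI[of _ 0]) auto
  have J_le: "J n \<le> \<Phi> x" if "x \<in> C n" for x n
    unfolding J_def using bdd that by (rule cINF_lower)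
  have J_mono: "J m \<le> J n" if "m \<le> n" for m n
    unfolding J_def using bdd ne dec that by (intro cINF_superset_mono) (auto simp: decseq_def)
  have J1: "J n \<le> 1" for n using ne[of n] J_le \<Phi>_bd(2) M by (meson all_not_in_conv order_trans)
  define I where "I = (SUP n. J n)"
  have J_I: "J n \<le> I" for n unfolding I_def using J1 by (intro cSUP_upper bdd_aboveI[of _ 1]) auto
  \<comment> \<open>The infima \<open>J\<close> increase to \<open>I\<close>. Past
    \<open>r n\<close> they are within \<open>(1/16)^n\<close> of \<open>I\<close>, and
    \<open>x n\<close> is later chosen in \<open>C (r n)\<close> with \<Phi> less than
    \<open>(1/16)^n\<close> above \<open>I\<close>.\<close>
  have ex_r: "\<exists>r\<ge>n. I - (1/16)^n < J r" for n
  proof -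
    have "I - (1/16)^n < (SUP n. J n)" by (simp add: I_def)
    moreover have "bdd_above (range J)" using J1 by (auto intro: bdd_aboveI[of _ 1])
    ultimately obtain k where "I - (1/16)^n < J k"
      using less_cSUP_iff[of UNIV J] by auto
    then show ?thesis using J_mono[of k "max n k"] by (intro exI[of _ "max n k"]) auto
  qed
  then obtain r where r: "\<And>n. n \<le> r n" "\<And>n. I - (1/16)^n < J (r n)" by metis
  have "\<exists>x\<in>C (r n). \<Phi> x < I + (1/16)^n" for n
  proof -
    have "(INF x\<in>C (r n). \<Phi> x) < I + (1/16)^n"
      using J_I[of "r n"] by (simp add: J_def add_strict_increasing2 flip: J_def)
         (smt (verit) J_def zero_less_power zero_less_divide_iff)
    then show ?thesis using cINF_less_iff[OF ne bdd] by blast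
  qed
  then obtain x where x: "\<And>n. x n \<in> C (r n)" "\<And>n. \<Phi> (x n) < I + (1/16)^n" by metis
  have xC: "x n \<in> C n" for n using x(1)[of n] r(1)[of n] dec by (auto simp: decseq_def)
  have [measurable]: "x n \<in> borel_measurable Q" for n using xC M by blast
  define w where "w n \<omega> = exp (- (\<rho> (x n \<omega>) / 2))" for n \<omega>
  have [measurable]: "w n \<in> borel_measurable Q" for n unfolding w_def by measurable
  have w1: "0 \<le> w n \<omega>" "w n \<omega> \<le> 1" for n \<omega> by (auto simp: w_def nonneg)
  have w_sq: "(w n \<omega>)\<^sup>2 = exp (- \<rho> (x n \<omega>))" for n \<omega>
    by (simp add: w_def power2_eq_square flip: exp_add)
  have intd: "integrable Q (\<lambda>\<omega>. (w n \<omega> - w (Suc n) \<omega>)\<^sup>2)" for n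
  proof (rule integrable_const_bound[of _ 1])
    show "AE \<omega> in Q. norm ((w n \<omega> - w (Suc n) \<omega>)\<^sup>2) \<le> 1"
      using w1[of n] w1[of "Suc n"] by (intro AE_I2) (simp add: abs_square_le_1 abs_le_iff, smt (verit))
  qed simp
  have fast: "expectation (\<lambda>\<omega>. (w n \<omega> - w (Suc n) \<omega>)\<^sup>2) \<le> 4 * (1/16)^n" for n
  proof -
    \<comment> \<open>Both functions lie in \<open>C k\<close>, hence so does a midpoint
      \<open>m\<close>, and \<open>\<Phi> m\<close> exceeds \<open>I - (1/16)^n\<close>. Two errors
      from the near-minimisers and twice this one make up the factor 4.\<close>
    define k where "k = min (r n) (r (Suc n))"
    have "x n \<in> C k" "x (Suc n) \<in> C k"
      using x(1)[of n] x(1)[of "Suc n"] dec[THEN decseqD, of k "r n"]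
        dec[THEN decseqD, of k "r (Suc n)"] by (auto simp: k_def)
    then obtain m where m: "m \<in> C k"
        "AE \<omega> in Q. \<rho> (m \<omega>) = (\<rho> (x n \<omega>) + \<rho> (x (Suc n) \<omega>)) / 2"
      using mid by blast
    have [measurable]: "m \<in> borel_measurable Q" using m(1) M by blast
    have le: "(1/16::real)^Suc n \<le> (1/16)^n" by simp
    have "I - (1/16)^n < J k" 
      using r(2)[of n] r(2)[of "Suc n"] le unfolding k_def min_def by (smt (verit))
    then have 1: "I - (1/16)^n < \<Phi> m" using J_le[OF m(1)] by simp
    have "expectation (\<lambda>\<omega>. (w n \<omega> - w (Suc n) \<omega>)\<^sup>2)
      = expectation (\<lambda>\<omega>. exp (- \<rho> (x n \<omega>)) + exp (- \<rho> (x (Suc n) \<omega>)) - 2 * exp (- \<rho> (m \<omega>)))"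
    proof (rule integral_cong_AE)
      show "AE \<omega> in Q. (w n \<omega> - w (Suc n) \<omega>)\<^sup>2
          = exp (- \<rho> (x n \<omega>)) + exp (- \<rho> (x (Suc n) \<omega>)) - 2 * exp (- \<rho> (m \<omega>))"
        using m(2)
      proof eventually_elim
        case (elim \<omega>)
        then have "exp (- \<rho> (m \<omega>)) = w n \<omega> * w (Suc n) \<omega>"
          by (simp add: w_def flip: exp_add)
        then show ?case by (simp add: power2_diff w_sq)
      qed
    qed measurable
    also have "\<dots> = \<Phi> (x n) + \<Phi> (x (Suc n)) - 2 * \<Phi> m"
      unfolding \<Phi>_def by (simp add: int)
    finally show ?thesis using x(2)[of n] x(2)[of "Suc n"] 1 le by linarith
  qed
  have conv: "AE \<omega> in Q. convergent (\<lambda>n. w n \<omega>)"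
    by (rule AE_convergent_of_fast_Cauchy) (use intd fast in auto)
  have "range x \<subseteq> C 0" using xC dec by (auto simp: decseq_def)
  then have "AE \<omega> in Q. \<exists>R. \<exists>\<^sub>F n in sequentially. x n \<omega> \<le> R"
    by (intro AE_frequently_bounded uniformly_tight_subset[OF tight]) auto
  moreover have "AE \<omega> in Q. \<forall>n. 0 \<le> x n \<omega>"
    using C xC by (auto simp: AE_all_countable)
  ultimately have "AE \<omega> in Q. convergent (\<lambda>n. x n \<omega>)"
    using conv
  proof eventually_elim
    case (elim \<omega>)
    then show ?case by (auto simp: w_def intro: convergent_of_exp_chart)
  qed
  then have "AE \<omega> in Q. (\<lambda>n. x n \<omega>) \<longlonglongrightarrow> lim (\<lambda>n. x n \<omega>)"
    by eventually_elim (simp add: convergent_LIMSEQ_iff)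
  then show ?thesis
    by (intro that[of x "\<lambda>\<omega>. lim (\<lambda>n. x n \<omega>)"] xC borel_measurable_lim_metric) auto
qed

section \<open>Attainable payoffs\<close>

lemma AE_tendsto_imp_in_probability:
  fixes x :: "nat \<Rightarrow> 'a \<Rightarrow> real"
  assumes "prob_space Q" and [measurable]: "\<And>n. x n \<in> borel_measurable Q" "z \<in> borel_measurable Q"
    and lim: "AE \<omega> in Q. (\<lambda>n. x n \<omega>) \<longlonglongrightarrow> z \<omega>" and "\<epsilon> > 0"
  shows "(\<lambda>n. measure Q {\<omega>\<in>space Q. \<epsilon> \<le> \<bar>z \<omega> - x n \<omega>\<bar>}) \<longlonglongrightarrow> 0"
proof -
  interpret prob_space Q by fact
  have "(\<lambda>n. expectation (indicator {\<omega>\<in>space Q. \<epsilon> \<le> \<bar>z \<omega> - x n \<omega>\<bar>} :: 'a \<Rightarrow> real))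
      \<longlonglongrightarrow> expectation (\<lambda>_. 0)"
  proof (rule integral_dominated_convergence[where w = "\<lambda>_. 1"])
    show "AE \<omega> in Q. (\<lambda>n. indicator {\<omega>\<in>space Q. \<epsilon> \<le> \<bar>z \<omega> - x n \<omega>\<bar>} \<omega> :: real) \<longlonglongrightarrow> 0"
      using lim
    proof eventually_elim
      case (elim \<omega>)
      have "\<forall>\<^sub>F n in sequentially. \<bar>z \<omega> - x n \<omega>\<bar> < \<epsilon>"
        using tendstoD[OF elim \<open>\<epsilon> > 0\<close>] by (simp add: dist_real_def abs_minus_commute)
      then have "\<forall>\<^sub>F n in sequentially. indicator {\<omega>\<in>space Q. \<epsilon> \<le> \<bar>z \<omega> - x n \<omega>\<bar>} \<omega> = (0::real)"
        by eventually_elim simp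
      then show ?case by (rule tendsto_eventually)
    qed
  qed (auto split: split_indicator)
  then show ?thesis by simp
qed

lemma closedin_L0_AE_limit:
  assumes Q: "prob_space Q" and X: "closedin (L0_topology Q) X"
    and x: "\<And>n. x n \<in> X" and z: "z \<in> borel_measurable Q"
    and lim: "AE \<omega> in Q. (\<lambda>n. x n \<omega>) \<longlonglongrightarrow> z \<omega>"
  shows "z \<in> X"
proof (rule ccontr)
  assume "z \<notin> X"
  have XM: "X \<subseteq> borel_measurable Q" and op: "openin (L0_topology Q) (borel_measurable Q - X)"
    using X by (auto simp: closedin_def topspace_L0_topology[OF Q])
  obtain \<epsilon> where \<epsilon>: "\<epsilon> > 0" "\<And>y. y \<in> borel_measurable Q \<Longrightarrow>
      measure Q {\<omega>\<in>space Q. \<bar>z \<omega> - y \<omega>\<bar> \<ge> \<epsilon>} < \<epsilon> \<Longrightarrow> y \<in> borel_measurable Q - X"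
    using op z \<open>z \<notin> X\<close> unfolding openin_L0_topology[OF Q] by blast
  have xM: "x n \<in> borel_measurable Q" for n using x XM by blast
  have "\<forall>\<^sub>F n in sequentially. measure Q {\<omega>\<in>space Q. \<epsilon> \<le> \<bar>z \<omega> - x n \<omega>\<bar>} < \<epsilon>"
    using AE_tendsto_imp_in_probability[OF Q xM z lim \<epsilon>(1)] \<epsilon>(1) by (rule order_tendstoD)
  then obtain n where "measure Q {\<omega>\<in>space Q. \<epsilon> \<le> \<bar>z \<omega> - x n \<omega>\<bar>} < \<epsilon>"
    by (auto simp: eventually_sequentially)
  then show False using \<epsilon>(2)[OF xM] x by auto
qed

lemma bounded_in_probD:
  assumes "prob_space Q" and b: "bounded_in_prob Q Y" and "\<epsilon> > 0"
  obtains R where "\<And>x. x \<in> Y \<Longrightarrow> measure Q {\<omega>\<in>space Q. R \<le> \<bar>x \<omega>\<bar>} \<le> \<epsilon>"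
proof -
  interpret prob_space Q by fact
  have "\<forall>\<^sub>F R in at_top. (SUP x\<in>Y. emeasure Q {\<omega>\<in>space Q. \<bar>x \<omega>\<bar> \<ge> R}) < ennreal \<epsilon>"
    using b \<open>\<epsilon> > 0\<close> unfolding bounded_in_prob_def by (intro order_tendstoD(2)[of _ 0]) auto
  then obtain R where R: "(SUP x\<in>Y. emeasure Q {\<omega>\<in>space Q. \<bar>x \<omega>\<bar> \<ge> R}) < ennreal \<epsilon>"
    by (auto simp: eventually_at_top_linorder)
  have "measure Q {\<omega>\<in>space Q. R \<le> \<bar>x \<omega>\<bar>} \<le> \<epsilon>" if "x \<in> Y" for x
  proof -
    have "emeasure Q {\<omega>\<in>space Q. \<bar>x \<omega>\<bar> \<ge> R} \<le> ennreal \<epsilon>"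
      using SUP_upper[OF that, of "\<lambda>x. emeasure Q {\<omega>\<in>space Q. \<bar>x \<omega>\<bar> \<ge> R}"] R by simp
    then show ?thesis using \<open>\<epsilon> > 0\<close> by (simp add: emeasure_eq_measure)
  qed
  then show ?thesis by (rule that)
qed

text \<open>In this chart midpoints of nonnegative functions are arithmetic, so the compactness
  argument can be run on dominating elements of the convex set \<open>X\<close> as well as in
  utility coordinates.\<close>

interpretation id_chart: utility_chart "\<lambda>z. max 0 z"
  by unfold_locales (auto intro!: continuous_intros)

locale market = prob_space Q for Q :: "'a measure" +
  fixes X :: "('a \<Rightarrow> real) set"
  assumes X_measurable: "X \<subseteq> borel_measurable Q"
    and X_convex: "L0_convex X"
    and X_closed: "closedin (L0_topology Q) X"
    and X_bounded: "bounded_in_prob Q {x\<in>X. AE \<omega> in Q. l \<le> x \<omega>}"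
begin

lemma attainable_solid:
  assumes "x \<in> attainable Q X e" "y \<in> borel_measurable Q" "AE \<omega> in Q. 0 \<le> y \<omega> \<and> y \<omega> \<le> x \<omega>"
  shows "y \<in> attainable Q X e"
proof -
  obtain x' where x': "x' \<in> X" "AE \<omega> in Q. x \<omega> \<le> e \<omega> + x' \<omega>"
    using assms(1) unfolding attainable_def by blast
  have "AE \<omega> in Q. y \<omega> \<le> e \<omega> + x' \<omega>" using x'(2) assms(3) by eventually_elim auto
  then show ?thesis using x'(1) assms(2,3) unfolding attainable_def by auto
qed

lemma X_midpoint: "x \<in> X \<Longrightarrow> y \<in> X \<Longrightarrow> (\<lambda>\<omega>. (x \<omega> + y \<omega>) / 2) \<in> X"
  using X_convex[unfolded L0_convex_def, rule_format, of x y "1/2"] by (simp add: add_divide_distrib)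

lemma attainable_midpoint:
  assumes x: "x \<in> attainable Q X e" and y: "y \<in> attainable Q X e"
  shows "(\<lambda>\<omega>. (x \<omega> + y \<omega>) / 2) \<in> attainable Q X e"
proof -
  obtain x' where x': "x' \<in> X" "AE \<omega> in Q. x \<omega> \<le> e \<omega> + x' \<omega>"
    using x unfolding attainable_def by blast
  obtain y' where y': "y' \<in> X" "AE \<omega> in Q. y \<omega> \<le> e \<omega> + y' \<omega>"
    using y unfolding attainable_def by blast
  have [measurable]: "x \<in> borel_measurable Q" "y \<in> borel_measurable Q"
    and "AE \<omega> in Q. 0 \<le> x \<omega>" "AE \<omega> in Q. 0 \<le> y \<omega>"
    using x y by (auto simp: attainable_def)
  then have "AE \<omega> in Q. 0 \<le> (x \<omega> + y \<omega>) / 2" by auto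
  moreover have "AE \<omega> in Q. (x \<omega> + y \<omega>) / 2 \<le> e \<omega> + (x' \<omega> + y' \<omega>) / 2"
    using x'(2) y'(2) by eventually_elim (simp add: field_simps)
  ultimately show ?thesis
    unfolding attainable_def
    by (intro CollectI conjI bexI[OF _ X_midpoint[OF x'(1) y'(1)]]) auto
qed

lemma X_tight:
  assumes "\<epsilon> > 0"
  obtains R where "\<And>x. x \<in> X \<Longrightarrow> AE \<omega> in Q. l \<le> x \<omega> \<Longrightarrow> prob {\<omega>\<in>space Q. R \<le> x \<omega>} \<le> \<epsilon>"
proof -
  obtain R where R: "\<And>x. x \<in> {x\<in>X. AE \<omega> in Q. l \<le> x \<omega>} \<Longrightarrow> prob {\<omega>\<in>space Q. R \<le> \<bar>x \<omega>\<bar>} \<le> \<epsilon>"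
    using bounded_in_probD[OF prob_space_axioms X_bounded \<open>\<epsilon> > 0\<close>] by blast
  have "prob {\<omega>\<in>space Q. R \<le> x \<omega>} \<le> \<epsilon>" if x: "x \<in> X" "AE \<omega> in Q. l \<le> x \<omega>" for x
  proof -
    have [measurable]: "x \<in> borel_measurable Q" using x X_measurable by blast
    have "prob {\<omega>\<in>space Q. R \<le> x \<omega>} \<le> prob {\<omega>\<in>space Q. R \<le> \<bar>x \<omega>\<bar>}"
      by (intro finite_measure_mono) auto
    then show ?thesis using R[of x] x by simp
  qed
  then show ?thesis by (rule that)
qed

text \<open>From \<open>0 \<le> x \<le> c + x'\<close> the dominating gain inherits the lower bound
  \<open>- c\<close>; only with such a bound does \<open>X_bounded\<close> control it.\<close>

lemma attainable_dominated:
  assumes "x \<in> attainable Q X e" and e: "AE \<omega> in Q. e \<omega> \<le> c"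
  obtains x' where "x' \<in> X" "AE \<omega> in Q. x \<omega> \<le> e \<omega> + x' \<omega>" "AE \<omega> in Q. x \<omega> \<le> c + x' \<omega>"
    "AE \<omega> in Q. - c \<le> x' \<omega>"
proof -
  obtain x' where x': "x' \<in> X" "AE \<omega> in Q. x \<omega> \<le> e \<omega> + x' \<omega>" and x0: "AE \<omega> in Q. 0 \<le> x \<omega>"
    using assms(1) unfolding attainable_def by blast
  have "AE \<omega> in Q. x \<omega> \<le> c + x' \<omega>" using x'(2) e by eventually_elim auto
  moreover have "AE \<omega> in Q. - c \<le> x' \<omega>" using calculation x0 by eventually_elim auto
  ultimately show ?thesis using x' that by blast
qed

lemma attainable_tight:
  assumes e: "AE \<omega> in Q. e \<omega> \<le> c"
  shows "uniformly_tight Q (attainable Q X e)"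
  unfolding uniformly_tight_def
proof (intro allI impI)
  fix \<epsilon> :: real assume "\<epsilon> > 0"
  obtain R where R: "\<And>x. x \<in> X \<Longrightarrow> AE \<omega> in Q. - c \<le> x \<omega> \<Longrightarrow> prob {\<omega>\<in>space Q. R \<le> x \<omega>} \<le> \<epsilon>"
    using X_tight[OF \<open>\<epsilon> > 0\<close>] by blast
  show "\<exists>R. \<forall>x\<in>attainable Q X e. prob {\<omega>\<in>space Q. R \<le> x \<omega>} \<le> \<epsilon>"
  proof (intro exI ballI)
    fix x assume x: "x \<in> attainable Q X e"
    then obtain x' where x': "x' \<in> X" "AE \<omega> in Q. x \<omega> \<le> c + x' \<omega>" "AE \<omega> in Q. - c \<le> x' \<omega>"
      using attainable_dominated[OF x e] by metis
    have [measurable]: "x \<in> borel_measurable Q" "x' \<in> borel_measurable Q"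
      using x x'(1) X_measurable by (auto simp: attainable_def)
    have "prob {\<omega>\<in>space Q. R + c \<le> x \<omega>} \<le> prob {\<omega>\<in>space Q. R \<le> x' \<omega>}"
    proof (rule finite_measure_mono_AE)
      show "AE \<omega> in Q. \<omega> \<in> {\<omega>\<in>space Q. R + c \<le> x \<omega>} \<longrightarrow> \<omega> \<in> {\<omega>\<in>space Q. R \<le> x' \<omega>}"
        using x'(2) by eventually_elim auto
    qed simp
    then show "prob {\<omega>\<in>space Q. R + c \<le> x \<omega>} \<le> \<epsilon>" using R[OF x'(1,3)] by simp
  qed
qed

text \<open>The gains dominating the \<open>x n\<close> need not converge. Instead, convex
  compactness is applied to the sets of all gains that dominate the tails of the sequence from
  below, and a limit of those dominates \<open>z\<close>.\<close>

lemma attainable_closed: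
  assumes e: "AE \<omega> in Q. e \<omega> \<le> c" and x: "\<And>n. x n \<in> attainable Q X e"
    and [measurable]: "z \<in> borel_measurable Q"
    and lim: "AE \<omega> in Q. (\<lambda>n. x n \<omega>) \<longlonglongrightarrow> z \<omega>"
  shows "z \<in> attainable Q X e"
proof -
  \<comment> \<open>The shift by \<open>c\<close> makes the gains nonnegative. The clause on
    \<open>r\<close> says that \<open>e + (y - c)\<close> lies above the infimum of
    \<open>x k\<close> over \<open>k \<ge> n\<close>; stated through lower bounds it weakens as
    \<open>n\<close> grows and survives midpoints.\<close>
  define C where "C n = {y. (\<lambda>\<omega>. y \<omega> - c) \<in> X \<and> (AE \<omega> in Q. 0 \<le> y \<omega>) \<and>
    (AE \<omega> in Q. \<forall>r. (\<forall>k\<ge>n. r \<le> x k \<omega>) \<longrightarrow> r \<le> e \<omega> + (y \<omega> - c))}" for n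
  obtain y z' where y: "\<And>n. y n \<in> C n" and [measurable]: "z' \<in> borel_measurable Q"
    and y_lim: "AE \<omega> in Q. (\<lambda>n. y n \<omega>) \<longlonglongrightarrow> z' \<omega>"
  proof (rule id_chart.convex_compactness[OF prob_space_axioms, of C])
    fix n y assume y: "y \<in> C n"
    then have "(\<lambda>\<omega>. y \<omega> - c) \<in> borel_measurable Q" using X_measurable by (auto simp: C_def)
    then have "(\<lambda>\<omega>. (y \<omega> - c) + c) \<in> borel_measurable Q" by measurable
    then show "y \<in> borel_measurable Q \<and> (AE \<omega> in Q. 0 \<le> y \<omega>)" using y by (simp add: C_def)
  next
    fix n
    obtain x' where x': "x' \<in> X" "AE \<omega> in Q. x n \<omega> \<le> e \<omega> + x' \<omega>" "AE \<omega> in Q. - c \<le> x' \<omega>"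
      using attainable_dominated[OF x e, of n] by metis
    have "(\<lambda>\<omega>. x' \<omega> + c) \<in> C n"
      unfolding C_def
    proof (intro CollectI conjI)
      show "AE \<omega> in Q. \<forall>r. (\<forall>k\<ge>n. r \<le> x k \<omega>) \<longrightarrow> r \<le> e \<omega> + (x' \<omega> + c - c)"
        using x'(2) by eventually_elim (auto intro: order_trans)
      show "AE \<omega> in Q. 0 \<le> x' \<omega> + c" using x'(3) by eventually_elim simp
    qed (use x'(1) in simp)
    then show "C n \<noteq> {}" by blast
  next
    show "decseq C"
    proof (rule decseq_SucI, rule subsetI)
      fix n y assume y: "y \<in> C (Suc n)"
      then have "AE \<omega> in Q. \<forall>r. (\<forall>k\<ge>Suc n. r \<le> x k \<omega>) \<longrightarrow> r \<le> e \<omega> + (y \<omega> - c)"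
        by (simp add: C_def)
      then have "AE \<omega> in Q. \<forall>r. (\<forall>k\<ge>n. r \<le> x k \<omega>) \<longrightarrow> r \<le> e \<omega> + (y \<omega> - c)"
        by eventually_elim (meson Suc_leD)
      then show "y \<in> C n" using y by (simp add: C_def)
    qed
  next
    fix n y y' assume y: "y \<in> C n" and y': "y' \<in> C n"
    define m where "m \<omega> = (y \<omega> + y' \<omega>) / 2" for \<omega>
    have "(\<lambda>\<omega>. ((y \<omega> - c) + (y' \<omega> - c)) / 2) \<in> X"
      using y y' by (intro X_midpoint) (auto simp: C_def)
    moreover have "(\<lambda>\<omega>. ((y \<omega> - c) + (y' \<omega> - c)) / 2) = (\<lambda>\<omega>. m \<omega> - c)"
      by (auto simp: m_def field_simps)
    ultimately have 1: "(\<lambda>\<omega>. m \<omega> - c) \<in> X" by simp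
    have "AE \<omega> in Q. \<forall>r. (\<forall>k\<ge>n. r \<le> x k \<omega>) \<longrightarrow> r \<le> e \<omega> + (y \<omega> - c)"
      and "AE \<omega> in Q. \<forall>r. (\<forall>k\<ge>n. r \<le> x k \<omega>) \<longrightarrow> r \<le> e \<omega> + (y' \<omega> - c)"
      using y y' by (auto simp: C_def)
    then have 2: "AE \<omega> in Q. \<forall>r. (\<forall>k\<ge>n. r \<le> x k \<omega>) \<longrightarrow> r \<le> e \<omega> + (m \<omega> - c)"
    proof eventually_elim
      case (elim \<omega>)
      show ?case
      proof (intro allI impI)
        fix r assume "\<forall>k\<ge>n. r \<le> x k \<omega>"
        then have "r \<le> e \<omega> + (y \<omega> - c)" "r \<le> e \<omega> + (y' \<omega> - c)" using elim by blast+
        then show "r \<le> e \<omega> + (m \<omega> - c)" by (simp add: m_def field_simps)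
      qed
    qed
    have 3: "AE \<omega> in Q. 0 \<le> y \<omega>" "AE \<omega> in Q. 0 \<le> y' \<omega>" using y y' by (auto simp: C_def)
    then have "AE \<omega> in Q. 0 \<le> m \<omega>" by eventually_elim (simp add: m_def)
    with 1 2 have "m \<in> C n" by (simp add: C_def)
    moreover have "AE \<omega> in Q. max 0 (m \<omega>) = (max 0 (y \<omega>) + max 0 (y' \<omega>)) / 2"
      using 3 by eventually_elim (simp add: m_def)
    ultimately show "\<exists>m\<in>C n. AE \<omega> in Q. max 0 (m \<omega>) = (max 0 (y \<omega>) + max 0 (y' \<omega>)) / 2" by blast
  next
    show "uniformly_tight Q (C 0)"
      unfolding uniformly_tight_def
    proof (intro allI impI)
      fix \<epsilon> :: real assume "\<epsilon> > 0"
      obtain R where R: "\<And>x. x \<in> X \<Longrightarrow> AE \<omega> in Q. - c \<le> x \<omega> \<Longrightarrow> prob {\<omega>\<in>space Q. R \<le> x \<omega>} \<le> \<epsilon>"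
        using X_tight[OF \<open>\<epsilon> > 0\<close>] by blast
      have "prob {\<omega>\<in>space Q. R + c \<le> y \<omega>} \<le> \<epsilon>" if "y \<in> C 0" for y
        using that R[of "\<lambda>\<omega>. y \<omega> - c"] by (simp add: C_def le_diff_eq)
      then show "\<exists>R. \<forall>x\<in>C 0. prob {\<omega>\<in>space Q. R \<le> x \<omega>} \<le> \<epsilon>" by blast
    qed
  qed blast
  have "(\<lambda>\<omega>. z' \<omega> - c) \<in> X"
  proof (rule closedin_L0_AE_limit[OF prob_space_axioms X_closed, of "\<lambda>n \<omega>. y n \<omega> - c"])
    show "(\<lambda>\<omega>. y n \<omega> - c) \<in> X" for n using y by (simp add: C_def)
    show "AE \<omega> in Q. (\<lambda>n. y n \<omega> - c) \<longlonglongrightarrow> z' \<omega> - c"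
      using y_lim by eventually_elim (intro tendsto_intros)
  qed measurable
  moreover have "AE \<omega> in Q. \<forall>n. \<forall>r. (\<forall>k\<ge>n. r \<le> x k \<omega>) \<longrightarrow> r \<le> e \<omega> + (y n \<omega> - c)"
    using y by (simp add: AE_all_countable C_def)
  then have "AE \<omega> in Q. z \<omega> \<le> e \<omega> + (z' \<omega> - c)"
    using lim y_lim
  proof eventually_elim
    case (elim \<omega>)
    show ?case
    proof (rule dense_le)
      fix r assume "r < z \<omega>"
      then have "\<forall>\<^sub>F k in sequentially. r < x k \<omega>" by (rule order_tendstoD(1)[OF elim(2)])
      then obtain N where N: "\<And>k. k \<ge> N \<Longrightarrow> r \<le> x k \<omega>"
        by (auto simp: eventually_sequentially intro: less_imp_le)
      have "\<exists>N. \<forall>n\<ge>N. r \<le> e \<omega> + (y n \<omega> - c)"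
        using elim(1) N by (intro exI[of _ N]) (meson order_trans)
      then show "r \<le> e \<omega> + (z' \<omega> - c)"
        by (intro LIMSEQ_le_const[of "\<lambda>n. e \<omega> + (y n \<omega> - c)"] tendsto_intros elim(3)) auto
    qed
  qed
  moreover have "AE \<omega> in Q. \<forall>n. 0 \<le> x n \<omega>" using x by (auto simp: AE_all_countable attainable_def)
  then have "AE \<omega> in Q. 0 \<le> z \<omega>"
    using lim by eventually_elim (meson LIMSEQ_le_const)
  ultimately show ?thesis
    unfolding attainable_def by (intro CollectI conjI bexI[of _ "\<lambda>\<omega>. z' \<omega> - c"]) auto
qed

end

section \<open>Uniform integrability from asymptotic elasticity\<close>

text \<open>\<open>doubling\<close> is the form in which asymptotic elasticity enters: concavity and
  \<open>\<rho> 0 = 0\<close> alone give only the factor 2, and the argument for uniform tails lives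
  on the gap between \<beta> and 2.\<close>

locale concave_chart = utility_chart +
  assumes midpoint_concave: "0 \<le> a \<Longrightarrow> 0 \<le> b \<Longrightarrow> (\<rho> a + \<rho> b) / 2 \<le> \<rho> ((a + b) / 2)"
    and doubling: "\<exists>\<beta><2. \<exists>z0\<ge>0. \<forall>z\<ge>z0. \<rho> (2 * z) \<le> \<beta> * \<rho> z"
begin

text \<open>The intermediate value theorem on the interval from 0 to the arithmetic midpoint
  \<open>c\<close>, where concavity gives \<open>\<rho> c\<close> at least the required
  value.\<close>

lemma chart_midpoint:
  obtains m where "0 \<le> m" "\<rho> m = (\<rho> a + \<rho> b) / 2" "m \<le> (max 0 a + max 0 b) / 2"
proof -
  have *: "\<rho> (max 0 z) = \<rho> z" for z using nonpos[of z] nonpos[of 0] by (cases "z \<le> 0") auto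
  define c where "c = (max 0 a + max 0 b) / 2"
  have le: "(\<rho> a + \<rho> b) / 2 \<le> \<rho> c"
    using midpoint_concave[of "max 0 a" "max 0 b"] by (simp add: * c_def)
  moreover have "\<rho> 0 \<le> (\<rho> a + \<rho> b) / 2" using nonneg[of a] nonneg[of b] nonpos[of 0] by simp
  moreover have "0 \<le> c" by (simp add: c_def)
  ultimately obtain m where "0 \<le> m" "m \<le> c" "\<rho> m = (\<rho> a + \<rho> b) / 2"
    using IVT'[of \<rho> 0 "(\<rho> a + \<rho> b) / 2" c] continuous_on_subset[OF continuous, of "{0..c}"] by auto
  then show ?thesis using that by (simp add: c_def)
qed

lemma chart_midpoint_measurable:
  assumes [measurable]: "x \<in> borel_measurable Q" "y \<in> borel_measurable Q"
  obtains m where "m \<in> borel_measurable Q"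
    "\<And>\<omega>. 0 \<le> m \<omega>" "\<And>\<omega>. \<rho> (m \<omega>) = (\<rho> (x \<omega>) + \<rho> (y \<omega>)) / 2"
    "\<And>\<omega>. m \<omega> \<le> (max 0 (x \<omega>) + max 0 (y \<omega>)) / 2"
proof -
  have "\<forall>\<omega>. \<exists>m. 0 \<le> m \<and> \<rho> m = (\<rho> (x \<omega>) + \<rho> (y \<omega>)) / 2 \<and> m \<le> (max 0 (x \<omega>) + max 0 (y \<omega>)) / 2"
    using chart_midpoint by metis
  then obtain m where m: "\<And>\<omega>. 0 \<le> m \<omega>" "\<And>\<omega>. \<rho> (m \<omega>) = (\<rho> (x \<omega>) + \<rho> (y \<omega>)) / 2"
    "\<And>\<omega>. m \<omega> \<le> (max 0 (x \<omega>) + max 0 (y \<omega>)) / 2" by metis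
  \<comment> \<open>\<open>m\<close> was chosen pointwise. It is measurable because for
    \<open>t \<ge> 0\<close> its sublevel sets are those of the averaged chart at the level
    \<open>\<rho> t\<close>.\<close>
  have "{\<omega> \<in> space Q. m \<omega> \<le> t} \<in> sets Q" for t
  proof (cases "0 \<le> t")
    case True
    then have "{\<omega> \<in> space Q. m \<omega> \<le> t} = {\<omega> \<in> space Q. (\<rho> (x \<omega>) + \<rho> (y \<omega>)) / 2 \<le> \<rho> t}"
      using le_iff m(2) by metis
    then show ?thesis by simp
  next
    case False
    then have "{\<omega> \<in> space Q. m \<omega> \<le> t} = {}" using m(1) by (auto simp: not_le intro: less_le_trans)
    then show ?thesis by (metis sets.empty_sets)
  qed
  then have "m \<in> borel_measurable Q" by (simp add: borel_measurable_iff_le)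
  then show ?thesis using m that by blast
qed

end

text \<open>Uniform integrability of \<open>\<rho> x\<close>, with the cut placed on the payoff
  rather than on its utility, since \<open>doubling\<close> holds beyond a threshold for the
  payoff.\<close>

definition uniform_tails :: "'a measure \<Rightarrow> (real \<Rightarrow> real) \<Rightarrow> ('a \<Rightarrow> real) set \<Rightarrow> bool" where
  "uniform_tails Q \<rho> A \<longleftrightarrow>
     (\<forall>\<epsilon>>0. \<exists>R. \<forall>x\<in>A. integral\<^sup>L Q (\<lambda>\<omega>. \<rho> (x \<omega>) * indicator {R..} (x \<omega>)) \<le> \<epsilon>)"

lemma (in finite_measure) integral_small_on_small_sets:
  fixes f :: "'a \<Rightarrow> real"
  assumes f: "integrable M f" "\<And>\<omega>. 0 \<le> f \<omega>" and "\<epsilon> > 0"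
  obtains \<delta> where "\<delta> > 0"
    "\<And>E. E \<in> sets M \<Longrightarrow> measure M E \<le> \<delta> \<Longrightarrow> integral\<^sup>L M (\<lambda>\<omega>. f \<omega> * indicator E \<omega>) \<le> \<epsilon>"
proof -
  have [measurable]: "f \<in> borel_measurable M" using f by simp
  have "(\<lambda>n. integral\<^sup>L M (\<lambda>\<omega>. f \<omega> - min (f \<omega>) (real n))) \<longlonglongrightarrow> integral\<^sup>L M (\<lambda>_. 0)"
  proof (rule integral_dominated_convergence[where w = f])
    show "AE \<omega> in M. (\<lambda>n. f \<omega> - min (f \<omega>) (real n)) \<longlonglongrightarrow> 0"
    proof (intro AE_I2 tendsto_eventually)
      fix \<omega>
      obtain N :: nat where "f \<omega> \<le> real N" using real_arch_simple by blast
      then show "\<forall>\<^sub>F n in sequentially. f \<omega> - min (f \<omega>) (real n) = 0"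
        by (intro eventually_sequentiallyI[of N]) auto
    qed
  qed (use f in \<open>auto simp: min_def\<close>)
  then have "\<forall>\<^sub>F n in sequentially. integral\<^sup>L M (\<lambda>\<omega>. f \<omega> - min (f \<omega>) (real n)) < \<epsilon> / 2"
    using \<open>\<epsilon> > 0\<close> by (intro order_tendstoD(2)[of _ 0]) auto
  then obtain n where n: "integral\<^sup>L M (\<lambda>\<omega>. f \<omega> - min (f \<omega>) (real n)) < \<epsilon> / 2"
    by (auto simp: eventually_sequentially)
  have int: "integrable M (\<lambda>\<omega>. f \<omega> - min (f \<omega>) (real n))"
    by (rule Bochner_Integration.integrable_bound[OF f(1)]) (use f(2) in \<open>auto simp: min_def\<close>)
  show ?thesis
  proof (rule that[of "\<epsilon> / (2 * (real n + 1))"])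
    fix E assume E [measurable]: "E \<in> sets M" and small: "measure M E \<le> \<epsilon> / (2 * (real n + 1))"
    have "integral\<^sup>L M (\<lambda>\<omega>. f \<omega> * indicator E \<omega>)
        \<le> integral\<^sup>L M (\<lambda>\<omega>. (f \<omega> - min (f \<omega>) (real n)) + real n * indicator E \<omega>)"
      using int E by (intro integral_mono integrable_mult_indicator f Bochner_Integration.integrable_add)
        (auto simp: f split: split_indicator intro!: integrable_real_mult_indicator integrable_real_indicator
          simp: emeasure_eq_measure)
    also have "\<dots> = integral\<^sup>L M (\<lambda>\<omega>. f \<omega> - min (f \<omega>) (real n)) + real n * measure M E"
      using int E by (subst Bochner_Integration.integral_add) (auto simp: emeasure_eq_measure)
    also have "real n * measure M E \<le> (real n + 1) * (\<epsilon> / (2 * (real n + 1)))"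
      using small by (intro mult_mono) auto
    also have "\<dots> = \<epsilon> / 2" by (simp add: field_simps)
    finally show "integral\<^sup>L M (\<lambda>\<omega>. f \<omega> * indicator E \<omega>) \<le> \<epsilon>" using n by linarith
  qed (use \<open>\<epsilon> > 0\<close> in auto)
qed

text \<open>
  If the tails of two members of \<open>A\<close> over disjoint events carry utility close to the limit \<open>L\<close> of the
  worst tails, then their average \<open>h\<close> has a tail of utility about \<open>2 L / \<beta> > L\<close>.
\<close>

lemma (in concave_chart) uniform_tails:
  assumes "prob_space Q"
    and A: "\<And>x. x \<in> A \<Longrightarrow> x \<in> borel_measurable Q" "\<And>x. x \<in> A \<Longrightarrow> AE \<omega> in Q. 0 \<le> x \<omega>"
    and tight: "uniformly_tight Q A"
    and avg: "\<And>x y E F. x \<in> A \<Longrightarrow> y \<in> A \<Longrightarrow> E \<in> sets Q \<Longrightarrow> F \<in> sets Q \<Longrightarrow>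
      (\<lambda>\<omega>. (x \<omega> * indicator E \<omega> + y \<omega> * indicator F \<omega>) / 2) \<in> A"
    and int: "\<And>x. x \<in> A \<Longrightarrow> integrable Q (\<lambda>\<omega>. \<rho> (x \<omega>))"
    and bound: "\<And>x. x \<in> A \<Longrightarrow> integral\<^sup>L Q (\<lambda>\<omega>. \<rho> (x \<omega>)) \<le> B"
  shows "uniform_tails Q \<rho> A"
proof (rule ccontr)
  interpret prob_space Q by fact
  define T where "T R x = expectation (\<lambda>\<omega>. \<rho> (x \<omega>) * indicator {R..} (x \<omega>))" for R x
  have intE: "integrable Q (\<lambda>\<omega>. \<rho> (x \<omega>) * indicator E \<omega>)" if "x \<in> A" "E \<in> sets Q" for x E
    using integrable_real_mult_indicator[OF that(2) int[OF that(1)]] by simp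
  have ind: "indicator {R..} (x \<omega>) = indicator {\<omega>\<in>space Q. R \<le> x \<omega>} \<omega>"
    if "\<omega> \<in> space Q" for R x \<omega> using that by (auto split: split_indicator)
  have T_eq: "T R x = expectation (\<lambda>\<omega>. \<rho> (x \<omega>) * indicator {\<omega>\<in>space Q. R \<le> x \<omega>} \<omega>)" for R x
    unfolding T_def by (intro Bochner_Integration.integral_cong refl) (simp add: ind)
  have meas: "{\<omega>\<in>space Q. R \<le> x \<omega>} \<in> sets Q" if "x \<in> A" for R x
    using A(1)[OF that] by measurable
  have T_mono: "T R' x \<le> T R x" if "R \<le> R'" "x \<in> A" for R R' x
    unfolding T_eq using that(1)
    by (intro integral_mono intE meas that(2)) (auto split: split_indicator simp: nonneg)
  have T_nonneg: "0 \<le> T R x" for R x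
    unfolding T_def by (intro integral_nonneg_AE AE_I2) (simp add: nonneg)
  have T_B: "T R x \<le> B" if "x \<in> A" for R x
  proof -
    have "T R x \<le> expectation (\<lambda>\<omega>. \<rho> (x \<omega>))"
      unfolding T_eq by (intro integral_mono intE meas int that) (auto split: split_indicator simp: nonneg)
    then show ?thesis using bound[OF that] by simp
  qed
  assume "\<not> uniform_tails Q \<rho> A"
  then obtain \<epsilon>0 where \<epsilon>0: "\<epsilon>0 > 0" "\<And>R. \<exists>x\<in>A. \<epsilon>0 < T R x"
    unfolding uniform_tails_def T_def by (meson not_le)
  then have ne: "A \<noteq> {}" by blast
  define S where "S R = (SUP x\<in>A. T R x)" for R
  have bdd: "bdd_above (T R ` A)" for R using T_B by (auto intro!: bdd_aboveI[of _ B])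
  have T_S: "T R x \<le> S R" if "x \<in> A" for R x unfolding S_def by (rule cSUP_upper[OF that bdd])
  have S_\<epsilon>0: "\<epsilon>0 \<le> S R" for R using \<epsilon>0(2)[of R] T_S by (meson less_imp_le order_trans)
  have S_mono: "S R' \<le> S R" if "R \<le> R'" for R R'
    unfolding S_def using T_mono[OF that] T_S[of _ R]
    by (intro cSUP_least ne) (auto simp: S_def intro: order_trans)
  define L where "L = (INF R. S R)"
  have bddS: "bdd_below (range S)" using S_\<epsilon>0 by (auto intro!: bdd_belowI[of _ \<epsilon>0])
  have L_S: "L \<le> S R" for R unfolding L_def by (rule cINF_lower[OF bddS]) simp
  have "\<epsilon>0 \<le> L" unfolding L_def by (rule cINF_greatest) (use S_\<epsilon>0 in auto)
  then have "L > 0" using \<epsilon>0 by simp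
  obtain \<beta> z0 where \<beta>: "\<beta> < 2" "0 \<le> z0" "\<And>z. z0 \<le> z \<Longrightarrow> \<rho> (2 * z) \<le> \<beta> * \<rho> z"
    using doubling by blast
  have "0 < \<rho> (z0 + 1)" using strict[of 0 "z0 + 1"] \<beta>(2) nonpos[of 0] by simp
  moreover have "\<rho> (z0 + 1) \<le> \<beta> * \<rho> (z0 + 1)"
    using \<beta>(2) \<beta>(3)[of "z0 + 1"] mono[of "z0 + 1" "2 * (z0 + 1)"] by simp
  ultimately have "1 \<le> \<beta>" by simp
  \<comment> \<open>This makes \<open>(2 - \<beta>) * L\<close> equal to
    \<open>8 * \<epsilon>\<close>, while the final estimate bounds it by
    \<open>5 * \<epsilon>\<close>: one \<epsilon> each for the tail of \<open>x\<close>, the tail of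
    \<open>y\<close> and the loss of \<open>x\<close> on \<open>F\<close>, and two from
    \<open>\<beta> * (L + \<epsilon>)\<close>.\<close>
  define \<epsilon> where "\<epsilon> = L * (2 - \<beta>) / 8"
  have "\<epsilon> > 0" using \<open>L > 0\<close> \<beta>(1) by (simp add: \<epsilon>_def)
  have "(INF R. S R) < L + \<epsilon>" using \<open>\<epsilon> > 0\<close> by (simp add: L_def)
  then obtain R1 where R1: "S R1 < L + \<epsilon>" using cINF_less_iff[OF _ bddS] by auto
  define R0 where "R0 = max R1 (max z0 1)"
  have R0: "S R0 < L + \<epsilon>" "z0 \<le> R0" "0 < R0" using S_mono[of R1 R0] R1 by (auto simp: R0_def)
  have near_sup: "\<exists>x\<in>A. L - \<epsilon> < T R x" for R
  proof -
    have "L - \<epsilon> < (SUP x\<in>A. T R x)" using L_S[of R] \<open>\<epsilon> > 0\<close> by (simp add: S_def)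
    then show ?thesis using less_cSUP_iff[OF ne bdd] by blast
  qed
  obtain x where x: "x \<in> A" "L - \<epsilon> < T (2 * R0) x" using near_sup by blast
  \<comment> \<open>\<open>y\<close> is chosen after \<open>x\<close>, with a tail event
    \<open>F\<close> so improbable that \<open>x\<close> carries at most \<epsilon> of utility on
    it. This stands in for disjointness of the two tails.\<close>
  obtain \<delta> where \<delta>: "\<delta> > 0"
    "\<And>E. E \<in> sets Q \<Longrightarrow> prob E \<le> \<delta> \<Longrightarrow> expectation (\<lambda>\<omega>. \<rho> (x \<omega>) * indicator E \<omega>) \<le> \<epsilon>"
    using integral_small_on_small_sets[OF int[OF x(1)] nonneg \<open>\<epsilon> > 0\<close>] by blast
  obtain R2 where R2: "\<And>y. y \<in> A \<Longrightarrow> prob {\<omega>\<in>space Q. R2 \<le> y \<omega>} \<le> \<delta>"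
    using tight \<delta>(1) unfolding uniformly_tight_def by blast
  define R' where "R' = max R2 (2 * R0)"
  obtain y where y: "y \<in> A" "L - \<epsilon> < T R' y" using near_sup by blast
  note [measurable] = A(1)[OF x(1)] A(1)[OF y(1)]
  define E where "E = {\<omega>\<in>space Q. 2 * R0 \<le> x \<omega>}"
  define F where "F = {\<omega>\<in>space Q. R' \<le> y \<omega>}"
  have [measurable]: "E \<in> sets Q" "F \<in> sets Q" unfolding E_def F_def by measurable
  have "prob F \<le> prob {\<omega>\<in>space Q. R2 \<le> y \<omega>}"
    unfolding F_def by (intro finite_measure_mono) (auto simp: R'_def)
  then have F: "expectation (\<lambda>\<omega>. \<rho> (x \<omega>) * indicator F \<omega>) \<le> \<epsilon>"
    using R2[OF y(1)] by (intro \<delta>(2)) auto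
  define h where "h \<omega> = (x \<omega> * indicator E \<omega> + y \<omega> * indicator F \<omega>) / 2" for \<omega>
  have hA: "h \<in> A" unfolding h_def by (intro avg x y) auto
  \<comment> \<open>On \<open>F\<close> the contribution of \<open>x\<close> is written off and
    \<open>2 * h\<close> dominates \<open>y\<close>; on \<open>E\<close> outside \<open>F\<close> it
    equals \<open>x\<close>. Tails beyond \<open>2 * R0\<close> were taken so that the half
    \<open>h\<close> still exceeds \<open>R0\<close>, where \<open>doubling\<close> applies.\<close>
  have pw: "\<rho> (x \<omega>) * indicator E \<omega> - \<rho> (x \<omega>) * indicator F \<omega> + \<rho> (y \<omega>) * indicator F \<omega>
      \<le> \<beta> * (\<rho> (h \<omega>) * indicator {\<omega>\<in>space Q. R0 \<le> h \<omega>} \<omega>)"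
    if \<omega>: "\<omega> \<in> space Q" for \<omega>
  proof -
    consider "\<omega> \<in> F" | "\<omega> \<in> E" "\<omega> \<notin> F" | "\<omega> \<notin> E" "\<omega> \<notin> F" by blast
    then show ?thesis
    proof cases
      case 1
      then have "R' \<le> y \<omega>" by (simp add: F_def)
      moreover have "0 \<le> x \<omega> * indicator E \<omega>" using R0(3) by (auto simp: E_def split: split_indicator)
      ultimately have h: "y \<omega> \<le> 2 * h \<omega>" "R0 \<le> h \<omega>" using 1 by (auto simp: h_def R'_def)
      have "\<rho> (x \<omega>) * indicator E \<omega> - \<rho> (x \<omega>) \<le> 0" by (auto split: split_indicator simp: nonneg)
      then have "\<rho> (x \<omega>) * indicator E \<omega> - \<rho> (x \<omega>) + \<rho> (y \<omega>) \<le> \<rho> (2 * h \<omega>)"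
        using mono[OF h(1)] by simp
      also have "\<dots> \<le> \<beta> * \<rho> (h \<omega>)" using h R0 by (intro \<beta>) simp
      finally show ?thesis using 1 h \<omega> by simp
    next
      case 2
      then have h: "x \<omega> = 2 * h \<omega>" "R0 \<le> h \<omega>" by (auto simp: h_def E_def)
      have "\<rho> (2 * h \<omega>) \<le> \<beta> * \<rho> (h \<omega>)" using h R0 by (intro \<beta>) simp
      then show ?thesis using 2 h \<omega> by simp
    next
      case 3
      then show ?thesis using \<open>1 \<le> \<beta>\<close> by (simp add: nonneg)
    qed
  qed
  have "2 * L - 3 * \<epsilon> < T (2 * R0) x - expectation (\<lambda>\<omega>. \<rho> (x \<omega>) * indicator F \<omega>) + T R' y"
    using x(2) y(2) F by simp
  also have "\<dots> = expectation (\<lambda>\<omega>. \<rho> (x \<omega>) * indicator E \<omega> - \<rho> (x \<omega>) * indicator F \<omega>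
      + \<rho> (y \<omega>) * indicator F \<omega>)"
    unfolding T_eq E_def[symmetric] F_def[symmetric] by (simp add: intE x y)
  also have "\<dots> \<le> expectation (\<lambda>\<omega>. \<beta> * (\<rho> (h \<omega>) * indicator {\<omega>\<in>space Q. R0 \<le> h \<omega>} \<omega>))"
    by (intro integral_mono pw Bochner_Integration.integrable_add Bochner_Integration.integrable_diff
        integrable_mult_right intE x y hA meas) auto
  also have "\<dots> = \<beta> * T R0 h" by (simp add: T_eq)
  also have "\<dots> \<le> \<beta> * (L + \<epsilon>)" using T_S[OF hA, of R0] R0(1) \<open>1 \<le> \<beta>\<close> by (intro mult_left_mono) auto
  also have "\<dots> \<le> \<beta> * L + 2 * \<epsilon>" using \<beta>(1) \<open>\<epsilon> > 0\<close> by (simp add: distrib_left)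
  finally have "(2 - \<beta>) * L < 5 * \<epsilon>" by (simp add: algebra_simps)
  then show False using \<open>\<epsilon> > 0\<close> by (simp add: \<epsilon>_def algebra_simps)
qed

text \<open>Vitali's argument: the charts truncated at \<open>\<rho> R\<close> converge by
  domination, and the uniform tails make the truncation error small for all members of
  \<open>A\<close> at once.\<close>

lemma (in utility_chart) integral_chart_tendsto:
  assumes "prob_space Q" and tails: "uniform_tails Q \<rho> A"
    and A: "\<And>x. x \<in> A \<Longrightarrow> x \<in> borel_measurable Q" "\<And>x. x \<in> A \<Longrightarrow> integrable Q (\<lambda>\<omega>. \<rho> (x \<omega>))"
    and x: "\<And>n. x n \<in> A" and z: "z \<in> A" and lim: "AE \<omega> in Q. (\<lambda>n. x n \<omega>) \<longlonglongrightarrow> z \<omega>"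
    and p: "p \<in> borel_measurable Q" "AE \<omega> in Q. 0 \<le> p \<omega>" "AE \<omega> in Q. p \<omega> \<le> c"
  shows "(\<lambda>n. integral\<^sup>L Q (\<lambda>\<omega>. p \<omega> * \<rho> (x n \<omega>))) \<longlonglongrightarrow> integral\<^sup>L Q (\<lambda>\<omega>. p \<omega> * \<rho> (z \<omega>))"
proof (rule LIMSEQ_I)
  interpret prob_space Q by fact
  fix r :: real assume "r > 0"
  have [measurable]: "x n \<in> borel_measurable Q" "z \<in> borel_measurable Q" "p \<in> borel_measurable Q" for n
    using x z p A by auto
  have "AE \<omega> in Q. 0 \<le> c" using p(2,3) by eventually_elim simp
  then have c: "0 \<le> c" by simp
  define \<epsilon> where "\<epsilon> = r / (4 * (c + 1))"
  have "\<epsilon> > 0" using \<open>r > 0\<close> c by (simp add: \<epsilon>_def)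
  then obtain R where R: "\<And>x. x \<in> A \<Longrightarrow> expectation (\<lambda>\<omega>. \<rho> (x \<omega>) * indicator {R..} (x \<omega>)) \<le> \<epsilon>"
    using tails unfolding uniform_tails_def by blast
  have intp: "integrable Q (\<lambda>\<omega>. p \<omega> * \<rho> (y \<omega>))" if "y \<in> A" for y
    using p A(1)[OF that]
    by (intro Bochner_Integration.integrable_bound[OF integrable_mult_right[OF A(2)[OF that], of c]])
       (auto simp: abs_mult nonneg elim!: eventually_elim2 intro!: mult_right_mono)
  have intm: "integrable Q (\<lambda>\<omega>. p \<omega> * min (\<rho> (y \<omega>)) (\<rho> R))" if "y \<in> A" for y
    using p A(1)[OF that]
    by (intro Bochner_Integration.integrable_bound[OF intp[OF that]])
       (auto simp: abs_mult nonneg elim!: eventually_mono intro!: mult_left_mono)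
  have trunc: "0 \<le> expectation (\<lambda>\<omega>. p \<omega> * \<rho> (y \<omega>)) - expectation (\<lambda>\<omega>. p \<omega> * min (\<rho> (y \<omega>)) (\<rho> R))
     \<and> expectation (\<lambda>\<omega>. p \<omega> * \<rho> (y \<omega>)) - expectation (\<lambda>\<omega>. p \<omega> * min (\<rho> (y \<omega>)) (\<rho> R)) \<le> c * \<epsilon>"
    if y: "y \<in> A" for y
  proof -
    have [measurable]: "y \<in> borel_measurable Q" using A y by auto
    have eq: "expectation (\<lambda>\<omega>. p \<omega> * \<rho> (y \<omega>)) - expectation (\<lambda>\<omega>. p \<omega> * min (\<rho> (y \<omega>)) (\<rho> R))
      = expectation (\<lambda>\<omega>. p \<omega> * \<rho> (y \<omega>) - p \<omega> * min (\<rho> (y \<omega>)) (\<rho> R))"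
      using intp[OF y] intm[OF y] by simp
    have "0 \<le> expectation (\<lambda>\<omega>. p \<omega> * \<rho> (y \<omega>) - p \<omega> * min (\<rho> (y \<omega>)) (\<rho> R))"
      using p(2) by (intro integral_nonneg_AE) (auto elim!: eventually_mono intro!: mult_left_mono)
    moreover have "expectation (\<lambda>\<omega>. p \<omega> * \<rho> (y \<omega>) - p \<omega> * min (\<rho> (y \<omega>)) (\<rho> R))
        \<le> expectation (\<lambda>\<omega>. c * (\<rho> (y \<omega>) * indicator {R..} (y \<omega>)))"
    proof (rule integral_mono_AE)
      show "integrable Q (\<lambda>\<omega>. c * (\<rho> (y \<omega>) * indicator {R..} (y \<omega>)))"
        by (intro integrable_mult_right Bochner_Integration.integrable_bound[OF A(2)[OF y]])
           (auto split: split_indicator simp: nonneg)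
      show "AE \<omega> in Q. p \<omega> * \<rho> (y \<omega>) - p \<omega> * min (\<rho> (y \<omega>)) (\<rho> R)
          \<le> c * (\<rho> (y \<omega>) * indicator {R..} (y \<omega>))"
        using p(2,3)
      proof eventually_elim
        case (elim \<omega>)
        show ?case
        proof (cases "R \<le> y \<omega>")
          case True
          have "p \<omega> * \<rho> (y \<omega>) - p \<omega> * min (\<rho> (y \<omega>)) (\<rho> R) \<le> p \<omega> * \<rho> (y \<omega>)"
            using elim by (simp add: nonneg)
          also have "\<dots> \<le> c * \<rho> (y \<omega>)" using elim by (intro mult_right_mono nonneg)
          finally show ?thesis using True by simp
        next
          case False
          then show ?thesis using mono[of "y \<omega>" R] by simp
        qed
      qed
    qed (use intp[OF y] intm[OF y] in simp)
    moreover have "\<dots> \<le> c * \<epsilon>" using R[OF y] c by (simp add: mult_left_mono)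
    ultimately show ?thesis using eq by simp
  qed
  have lim_trunc: "(\<lambda>n. expectation (\<lambda>\<omega>. p \<omega> * min (\<rho> (x n \<omega>)) (\<rho> R)))
      \<longlonglongrightarrow> expectation (\<lambda>\<omega>. p \<omega> * min (\<rho> (z \<omega>)) (\<rho> R))"
  proof (rule integral_dominated_convergence[where w = "\<lambda>_. c * \<rho> R"])
    show "AE \<omega> in Q. (\<lambda>n. p \<omega> * min (\<rho> (x n \<omega>)) (\<rho> R)) \<longlonglongrightarrow> p \<omega> * min (\<rho> (z \<omega>)) (\<rho> R)"
      using lim by eventually_elim (intro tendsto_intros tendsto)
    show "AE \<omega> in Q. norm (p \<omega> * min (\<rho> (x n \<omega>)) (\<rho> R)) \<le> c * \<rho> R" for n
      using p(2,3) by eventually_elim (auto simp: abs_mult nonneg intro!: mult_mono)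
  qed auto
  obtain N where N: "\<And>n. n \<ge> N \<Longrightarrow> \<bar>expectation (\<lambda>\<omega>. p \<omega> * min (\<rho> (x n \<omega>)) (\<rho> R))
      - expectation (\<lambda>\<omega>. p \<omega> * min (\<rho> (z \<omega>)) (\<rho> R))\<bar> < r / 2"
    using LIMSEQ_D[OF lim_trunc, of "r / 2"] \<open>r > 0\<close> by auto
  \<comment> \<open>The truncation errors of \<open>x n\<close> and of \<open>z\<close> both lie
    between 0 and \<open>c * \<epsilon>\<close>, so their difference is at most one such term, not
    two.\<close>
  have "c * \<epsilon> < r / 2" using \<open>r > 0\<close> c by (simp add: \<epsilon>_def field_simps add_pos_nonneg)
  then have "norm (expectation (\<lambda>\<omega>. p \<omega> * \<rho> (x n \<omega>)) - expectation (\<lambda>\<omega>. p \<omega> * \<rho> (z \<omega>))) < r"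
    if "n \<ge> N" for n
    using N[OF that] trunc[OF x[of n]] trunc[OF z] unfolding real_norm_def abs_less_iff by linarith
  then show "\<exists>N. \<forall>n\<ge>N. norm (expectation (\<lambda>\<omega>. p \<omega> * \<rho> (x n \<omega>)) - expectation (\<lambda>\<omega>. p \<omega> * \<rho> (z \<omega>))) < r"
    by blast
qed

section \<open>Integrals of functions bounded above\<close>

lemma expect_eq:
  "expect M f = enn2ereal (\<integral>\<^sup>+ \<omega>. ennreal (f \<omega>) \<partial>M) - enn2ereal (\<integral>\<^sup>+ \<omega>. ennreal (- f \<omega>) \<partial>M)"
  by (simp add: ext_integral_def e2ennreal_ereal)

lemma expect_integrable:
  assumes f: "integrable M f"
  shows "expect M f = ereal (integral\<^sup>L M f)"
proof -
  have fin: "(\<integral>\<^sup>+ \<omega>. ennreal (f \<omega>) \<partial>M) \<noteq> \<infinity>" "(\<integral>\<^sup>+ \<omega>. ennreal (- f \<omega>) \<partial>M) \<noteq> \<infinity>"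
    using f by (auto simp: real_integrable_def)
  show ?thesis
    unfolding expect_eq real_lebesgue_integral_def[OF f] using fin
    by (cases "\<integral>\<^sup>+ \<omega>. ennreal (f \<omega>) \<partial>M"; cases "\<integral>\<^sup>+ \<omega>. ennreal (- f \<omega>) \<partial>M")
       (auto simp: enn2ereal_ennreal)
qed

lemma ext_integral_cong_AE:
  assumes "AE \<omega> in M. f \<omega> = g \<omega>"
  shows "ext_integral M f = ext_integral M g"
proof -
  have "(\<integral>\<^sup>+ \<omega>. e2ennreal (f \<omega>) \<partial>M) = (\<integral>\<^sup>+ \<omega>. e2ennreal (g \<omega>) \<partial>M)"
    and "(\<integral>\<^sup>+ \<omega>. e2ennreal (- f \<omega>) \<partial>M) = (\<integral>\<^sup>+ \<omega>. e2ennreal (- g \<omega>) \<partial>M)"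
    using assms by (auto intro!: nn_integral_cong_AE elim!: eventually_mono)
  then show ?thesis by (simp add: ext_integral_def)
qed

text \<open>Monotone even when both parts are infinite, because
  \<open>\<infinity> - \<infinity> = \<infinity>\<close> for \<open>ereal\<close>.\<close>

lemma ext_integral_mono_AE:
  assumes "AE \<omega> in M. f \<omega> \<le> g \<omega>"
  shows "ext_integral M f \<le> ext_integral M g"
  unfolding ext_integral_def using assms
  by (intro ereal_minus_mono less_eq_ennreal.rep_eq[THEN iffD1] nn_integral_mono_AE)
     (auto elim!: eventually_mono intro!: e2ennreal_mono)

lemma integrable_of_expect_le:
  assumes "finite_measure M" and f [measurable]: "f \<in> borel_measurable M" and l: "AE \<omega> in M. l \<le> f \<omega>"
    and S: "expect M f \<le> ereal S"
  shows "integrable M f" "integral\<^sup>L M f \<le> S"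
proof -
  interpret finite_measure M by fact
  have "(\<integral>\<^sup>+ \<omega>. ennreal (- f \<omega>) \<partial>M) \<le> (\<integral>\<^sup>+ \<omega>. ennreal \<bar>l\<bar> \<partial>M)"
    using l by (intro nn_integral_mono_AE) (auto elim!: eventually_mono intro!: ennreal_leI)
  also have "\<dots> < \<infinity>" by (simp add: ennreal_mult_less_top emeasure_eq_measure)
  finally have neg: "(\<integral>\<^sup>+ \<omega>. ennreal (- f \<omega>) \<partial>M) < \<infinity>" .
  then have "(\<integral>\<^sup>+ \<omega>. ennreal (f \<omega>) \<partial>M) \<noteq> \<infinity>"
    using S unfolding expect_eq by (cases "\<integral>\<^sup>+ \<omega>. ennreal (- f \<omega>) \<partial>M") (auto simp: enn2ereal_ennreal)
  then show int: "integrable M f" using neg by (auto simp: real_integrable_def)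
  show "integral\<^sup>L M f \<le> S" using S unfolding expect_integrable[OF int] by simp
qed

text \<open>The majorant keeps the positive part integrable, so a finite lower bound on the
  expectation forces the negative part to be integrable too.\<close>

lemma le_expect_iff:
  assumes f [measurable]: "f \<in> borel_measurable M" and b: "integrable M b" "AE \<omega> in M. f \<omega> \<le> b \<omega>"
  shows "ereal c \<le> expect M f \<longleftrightarrow> integrable M f \<and> c \<le> integral\<^sup>L M f"
proof
  have "(\<integral>\<^sup>+ \<omega>. ennreal (f \<omega>) \<partial>M) \<le> (\<integral>\<^sup>+ \<omega>. ennreal (b \<omega>) \<partial>M)"
    using b(2) by (intro nn_integral_mono_AE) (auto elim!: eventually_mono intro!: ennreal_leI)
  then have pos: "(\<integral>\<^sup>+ \<omega>. ennreal (f \<omega>) \<partial>M) < \<infinity>"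
    using b(1) unfolding real_integrable_def by (metis infinity_ennreal_def le_less_trans less_top)
  assume c: "ereal c \<le> expect M f"
  then have "(\<integral>\<^sup>+ \<omega>. ennreal (- f \<omega>) \<partial>M) \<noteq> \<infinity>"
    using pos unfolding expect_eq by (cases "\<integral>\<^sup>+ \<omega>. ennreal (f \<omega>) \<partial>M") (auto simp: enn2ereal_ennreal)
  then have int: "integrable M f" using pos by (auto simp: real_integrable_def)
  then show "integrable M f \<and> c \<le> integral\<^sup>L M f" using c by (simp add: expect_integrable)
qed (simp add: expect_integrable)

lemma le_expect_midpoint:
  assumes [measurable]: "f \<in> borel_measurable M" "g \<in> borel_measurable M" "h \<in> borel_measurable M"
    and b: "integrable M b" "AE \<omega> in M. f \<omega> \<le> b \<omega>" "AE \<omega> in M. g \<omega> \<le> b \<omega>" "AE \<omega> in M. h \<omega> \<le> b \<omega>"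
    and h: "AE \<omega> in M. (f \<omega> + g \<omega>) / 2 \<le> h \<omega>"
    and c: "c \<le> expect M f" "c \<le> expect M g"
  shows "c \<le> expect M h"
proof (cases c)
  case (real r)
  have f: "integrable M f" "r \<le> integral\<^sup>L M f" and g: "integrable M g" "r \<le> integral\<^sup>L M g"
    using c le_expect_iff[of f M b r] le_expect_iff[of g M b r] b real by auto
  have int: "integrable M h"
  proof (rule Bochner_Integration.integrable_bound)
    show "integrable M (\<lambda>\<omega>. \<bar>b \<omega>\<bar> + \<bar>(f \<omega> + g \<omega>) / 2\<bar>)" using b f g by simp
    show "AE \<omega> in M. norm (h \<omega>) \<le> norm (\<bar>b \<omega>\<bar> + \<bar>(f \<omega> + g \<omega>) / 2\<bar>)"
      using b(4) h by eventually_elim (unfold real_norm_def, linarith)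
  qed measurable
  have "r \<le> integral\<^sup>L M (\<lambda>\<omega>. (f \<omega> + g \<omega>) / 2)" using f g by simp
  also have "\<dots> \<le> integral\<^sup>L M h" using f g int h by (intro integral_mono_AE) auto
  finally show ?thesis using int real by (simp add: expect_integrable)
next
  \<comment> \<open>Impossible: \<open>f\<close> would have infinite expectation below an integrable
    majorant.\<close>
  case PInf
  then have top: "expect M f = \<infinity>" using c by simp
  then have "ereal 0 \<le> expect M f" by simp
  then have "integrable M f" using le_expect_iff[of f M b 0] b by auto
  then show ?thesis using top by (simp add: expect_integrable)
qed simp

text \<open>Moves the sign into one nonnegative integrand, to which Fatou applies. The equation
  comes from adding the positive part of \<phi> to \<open>b - \<phi>\<close>, which avoids
  subtraction in \<open>ennreal\<close>.\<close>

lemma ext_integral_eq_bound_minus: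
  assumes [measurable]: "\<phi> \<in> borel_measurable M" and b: "integrable M b" "\<And>\<omega>. 0 \<le> b \<omega>"
    and le: "AE \<omega> in M. \<phi> \<omega> \<le> ereal (b \<omega>)"
  shows "ext_integral M \<phi>
    = ereal (integral\<^sup>L M b) - enn2ereal (\<integral>\<^sup>+ \<omega>. e2ennreal (ereal (b \<omega>) - \<phi> \<omega>) \<partial>M)"
proof -
  define P where "P = (\<integral>\<^sup>+ \<omega>. e2ennreal (\<phi> \<omega>) \<partial>M)"
  define N where "N = (\<integral>\<^sup>+ \<omega>. e2ennreal (- \<phi> \<omega>) \<partial>M)"
  define D where "D = (\<integral>\<^sup>+ \<omega>. e2ennreal (ereal (b \<omega>) - \<phi> \<omega>) \<partial>M)"
  have [measurable]: "b \<in> borel_measurable M" using b by simp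
  have B: "(\<integral>\<^sup>+ \<omega>. ennreal (b \<omega>) \<partial>M) = ennreal (integral\<^sup>L M b)"
    using b by (intro nn_integral_eq_integral) auto
  have pw: "e2ennreal (ereal (b \<omega>) - \<phi> \<omega>) + e2ennreal (\<phi> \<omega>) = ennreal (b \<omega>) + e2ennreal (- \<phi> \<omega>)"
    if "\<phi> \<omega> \<le> ereal (b \<omega>)" for \<omega>
  proof (cases "\<phi> \<omega>")
    case (real r)
    then have "r \<le> b \<omega>" using that by simp
    then show ?thesis using real b(2)[of \<omega>]
      by (cases "0 \<le> r") (auto simp: e2ennreal_ereal ennreal_neg simp flip: ennreal_plus)
  qed (use that in \<open>auto simp: e2ennreal_neg e2ennreal_infty\<close>)
  have "D + P = (\<integral>\<^sup>+ \<omega>. e2ennreal (ereal (b \<omega>) - \<phi> \<omega>) + e2ennreal (\<phi> \<omega>) \<partial>M)"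
    unfolding D_def P_def by (rule nn_integral_add[symmetric]) auto
  also have "\<dots> = (\<integral>\<^sup>+ \<omega>. ennreal (b \<omega>) + e2ennreal (- \<phi> \<omega>) \<partial>M)"
    using le by (intro nn_integral_cong_AE) (auto elim!: eventually_mono simp: pw)
  also have "\<dots> = ennreal (integral\<^sup>L M b) + N"
    unfolding N_def B[symmetric] by (rule nn_integral_add) auto
  finally have sum: "D + P = ennreal (integral\<^sup>L M b) + N" .
  have "P \<le> (\<integral>\<^sup>+ \<omega>. ennreal (b \<omega>) \<partial>M)"
    unfolding P_def using le
    by (intro nn_integral_mono_AE) (auto elim!: eventually_mono dest: e2ennreal_mono simp: e2ennreal_ereal)
  then have "P < \<infinity>" unfolding B by (metis ennreal_less_top infinity_ennreal_def le_less_trans)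
  moreover have "0 \<le> integral\<^sup>L M b" using b by simp
  ultimately have "enn2ereal P - enn2ereal N = ereal (integral\<^sup>L M b) - enn2ereal D"
    using sum
    by (cases P; cases N; cases D) (auto simp: enn2ereal_ennreal simp flip: ennreal_plus)
  then show ?thesis by (simp add: ext_integral_def P_def N_def D_def)
qed

lemma e2ennreal_diff_limsup_le:
  fixes \<phi> :: "nat \<Rightarrow> ereal"
  shows "e2ennreal (ereal b - limsup \<phi>) \<le> liminf (\<lambda>n. e2ennreal (ereal b - \<phi> n))"
  unfolding le_Liminf_iff
proof (intro allI impI)
  fix y assume y: "y < e2ennreal (ereal b - limsup \<phi>)"
  then have "y \<noteq> top" by auto
  then obtain r where r: "0 \<le> r" "y = ennreal r" by (cases y) auto
  have "ereal r < ereal b - limsup \<phi>"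
    using y r by (metis e2ennreal_ereal e2ennreal_mono not_le)
  then have "limsup \<phi> < ereal (b - r)" by (cases "limsup \<phi>") auto
  then have "\<forall>\<^sub>F n in sequentially. \<phi> n < ereal (b - r)" by (rule Limsup_lessD)
  then show "\<forall>\<^sub>F n in sequentially. y < e2ennreal (ereal b - \<phi> n)"
  proof eventually_elim
    case (elim n)
    then show ?case using r by (cases "\<phi> n") (auto simp: e2ennreal_ereal ennreal_lessI e2ennreal_infty)
  qed
qed

text \<open>Reverse Fatou. It is used twice: over states, for upper semicontinuity of the
  principal's utility, and over priors, for optimality.\<close>

lemma le_ext_integral_limsup:
  fixes \<phi> :: "nat \<Rightarrow> 'a \<Rightarrow> ereal"
  assumes [measurable]: "\<And>n. \<phi> n \<in> borel_measurable M"
    and b: "integrable M b" "\<And>\<omega>. 0 \<le> b \<omega>"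
    and le: "\<And>n. AE \<omega> in M. \<phi> n \<omega> \<le> ereal (b \<omega>)"
    and c: "\<exists>\<^sub>F n in sequentially. c \<le> ext_integral M (\<phi> n)"
  shows "c \<le> ext_integral M (\<lambda>\<omega>. limsup (\<lambda>n. \<phi> n \<omega>))"
proof -
  define D where "D \<psi> = (\<integral>\<^sup>+ \<omega>. e2ennreal (ereal (b \<omega>) - \<psi> \<omega>) \<partial>M)" for \<psi> :: "'a \<Rightarrow> ereal"
  define \<phi>' where "\<phi>' \<omega> = limsup (\<lambda>n. \<phi> n \<omega>)" for \<omega>
  have [measurable]: "b \<in> borel_measurable M" "\<phi>' \<in> borel_measurable M"
    using b unfolding \<phi>'_def by auto
  have eq: "ext_integral M (\<phi> n) = ereal (integral\<^sup>L M b) - enn2ereal (D (\<phi> n))" for n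
    unfolding D_def by (rule ext_integral_eq_bound_minus[OF _ b le]) measurable
  have "AE \<omega> in M. \<forall>n. \<phi> n \<omega> \<le> ereal (b \<omega>)" using le by (simp add: AE_all_countable)
  then have le': "AE \<omega> in M. \<phi>' \<omega> \<le> ereal (b \<omega>)"
    unfolding \<phi>'_def by eventually_elim (auto intro!: Limsup_bounded)
  have eq': "ext_integral M \<phi>' = ereal (integral\<^sup>L M b) - enn2ereal (D \<phi>')"
    unfolding D_def by (rule ext_integral_eq_bound_minus[OF _ b le']) measurable
  have "D \<phi>' \<le> (\<integral>\<^sup>+ \<omega>. liminf (\<lambda>n. e2ennreal (ereal (b \<omega>) - \<phi> n \<omega>)) \<partial>M)"
    unfolding D_def \<phi>'_def by (intro nn_integral_mono e2ennreal_diff_limsup_le)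
  also have "\<dots> \<le> liminf (\<lambda>n. D (\<phi> n))"
    unfolding D_def by (rule nn_integral_liminf) measurable
  finally have fatou: "D \<phi>' \<le> liminf (\<lambda>n. D (\<phi> n))" .
  define B where "B = integral\<^sup>L M b"
  \<comment> \<open>\<open>e2ennreal\<close> cuts negative values to 0; the bound returns to
    \<open>ereal\<close> only together with \<open>c \<le> ereal B\<close>, shown right
    afterwards.\<close>
  have "D \<phi>' \<le> e2ennreal (ereal B - c)"
  proof (rule ccontr)
    assume "\<not> D \<phi>' \<le> e2ennreal (ereal B - c)"
    then have "e2ennreal (ereal B - c) < liminf (\<lambda>n. D (\<phi> n))" using fatou by simp
    then have "\<forall>\<^sub>F n in sequentially. e2ennreal (ereal B - c) < D (\<phi> n)" by (rule less_LiminfD)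
    then obtain n where n: "c \<le> ext_integral M (\<phi> n)" "e2ennreal (ereal B - c) < D (\<phi> n)"
      using frequently_eventually_frequently[OF c] frequently_ex by blast
    have "enn2ereal (D (\<phi> n)) \<le> ereal B - c"
      using n(1) unfolding eq B_def[symmetric] by (cases c; cases "D (\<phi> n)") (auto simp: enn2ereal_ennreal)
    then have "D (\<phi> n) \<le> e2ennreal (ereal B - c)" by (metis e2ennreal_enn2ereal e2ennreal_mono)
    then show False using n(2) by simp
  qed
  moreover obtain n where "c \<le> ext_integral M (\<phi> n)" using c frequently_ex by blast
  then have "c \<le> ereal B"
    unfolding eq B_def[symmetric] by (cases c; cases "D (\<phi> n)") (auto simp: enn2ereal_ennreal)
  ultimately have "c \<le> ereal B - enn2ereal (D \<phi>')"
    by (cases c; cases "D \<phi>'") (auto simp: enn2ereal_ennreal e2ennreal_ereal top_unique)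
  then show ?thesis using eq' by (simp add: B_def \<phi>'_def[abs_def])
qed

section \<open>Expected utility of the agent\<close>

text \<open>The graph lies below its tangent at \<open>z\<close>, evaluated at \<open>2 * z\<close>.
  The right-hand side is the numerator of the elasticity quotient.\<close>

lemma utility_concave_tangent:
  assumes u: "utility_fn u" and z: "z > 0"
  shows "u (2 * z) - u z \<le> z * deriv u z"
proof -
  have sc: "strictly_concave_on {0..} u" and diff: "u differentiable_on {0<..}"
    using u by (auto simp: utility_fn_def)
  have "convex_on {0<..} (\<lambda>x. - u x)"
  proof (rule convex_onI)
    fix t x y :: real assume "0 < t" "t < 1" "x \<in> {0<..}" "y \<in> {0<..}"
    then show "- u ((1 - t) *\<^sub>R x + t *\<^sub>R y) \<le> (1 - t) * - u x + t * - u y"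
      using sc[unfolded strictly_concave_on_def, THEN conjunct2, rule_format, of x y t]
      by (cases "x = y") (auto simp: algebra_simps)
  qed simp
  moreover have "u differentiable (at z)"
    using diff z by (meson differentiable_on_eq_differentiable_at greaterThan_iff open_greaterThan)
  then have "(u has_real_derivative deriv u z) (at z)"
    by (simp add: DERIV_deriv_iff_real_differentiable)
  then have "((\<lambda>x. - u x) has_real_derivative (- deriv u z)) (at z within {0<..})"
    by (rule DERIV_minus[OF has_field_derivative_at_within])
  ultimately have "- u (2 * z) - (- u z) \<ge> - deriv u z * (2 * z - z)"
    using z by (intro convex_on_imp_above_tangent[where A = "{0<..}"]) (auto simp: interior_open)
  then show ?thesis by (simp add: algebra_simps)
qed

lemma utility_doubling:
  assumes u: "utility_fn u"
  defines "\<rho> \<equiv> \<lambda>z. u (max 0 z) - u 0"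
  shows "\<exists>\<beta><2. \<exists>z0\<ge>0. \<forall>z\<ge>z0. \<rho> (2 * z) \<le> \<beta> * \<rho> z"
proof -
  have sm: "strict_mono_on {0..} u" and AE: "Limsup at_top (\<lambda>z. ereal (z * deriv u z / u z)) < 1"
    using u by (auto simp: utility_fn_def)
  have less: "\<rho> a < \<rho> b" if "0 \<le> a" "a < b" for a b
    using that sm by (auto simp: \<rho>_def strict_mono_on_def)
  have le: "\<rho> a \<le> \<rho> b" if "0 \<le> a" "a \<le> b" for a b
    using less[of a b] that by (cases "a = b") auto
  show ?thesis
  proof (cases "bdd_above (\<rho> ` {0..})")
    case True
    define L where "L = (SUP z\<in>{0..}. \<rho> z)"
    have L: "\<rho> z \<le> L" if "0 \<le> z" for z unfolding L_def using True that by (intro cSUP_upper) auto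
    have "0 < L" using less[of 0 1] L[of 1] by (simp add: \<rho>_def)
    \<comment> \<open>Once \<rho> has passed two thirds of its supremum, doubling the argument can
      multiply it by at most \<open>3 / 2\<close>.\<close>
    then have "2 / 3 * L < (SUP z\<in>{0..}. \<rho> z)" by (simp add: L_def)
    then have "\<exists>z0\<in>{0..}. 2 / 3 * L < \<rho> z0"
      by (subst (asm) less_cSUP_iff) (use True in auto)
    then obtain z0 where z0: "z0 \<ge> 0" "2 / 3 * L < \<rho> z0" by auto
    have "\<rho> (2 * z) \<le> 3 / 2 * \<rho> z" if "z \<ge> z0" for z
      using L[of "2 * z"] le[of z0 z] z0 that by simp
    then show ?thesis using z0(1) by (intro exI[of _ "3/2"]) auto
  next
    case False
    have large: "\<forall>\<^sub>F z in at_top. K \<le> \<rho> z" for K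
    proof -
      obtain z1 where "z1 \<ge> 0" "K < \<rho> z1"
        using False by (force simp: bdd_above_def not_le)
      then show ?thesis using le[of z1] by (intro eventually_at_top_linorderI[of z1]) force
    qed
    obtain \<gamma>0 where \<gamma>0: "Limsup at_top (\<lambda>z. ereal (z * deriv u z / u z)) < ereal \<gamma>0" "ereal \<gamma>0 < 1"
      using ereal_dense2[OF AE] by blast
    \<comment> \<open>\<gamma>0 comes from density of the reals and might be negative. The larger
      value is admissible where \<open>u z \<ge> 1\<close>.\<close>
    define \<gamma> where "\<gamma> = max 0 \<gamma>0"
    have \<gamma>: "0 \<le> \<gamma>" "\<gamma> < 1" using \<gamma>0(2) by (auto simp: \<gamma>_def)
    have "\<forall>\<^sub>F z in at_top. z * deriv u z / u z < \<gamma>0"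
      using Limsup_lessD[OF \<gamma>0(1)] by simp
    \<comment> \<open>Elasticity gives \<open>u (2 * z) \<le> (1 + \<gamma>) * u z\<close>. Passing
      from \<open>u\<close> to \<rho> costs \<open>\<gamma> * u 0\<close>, which is at most
      \<open>(1 - \<gamma>) / 2 * \<rho> z\<close> once \<rho> is large, and
      \<open>1 + \<gamma> + (1 - \<gamma>) / 2 = (3 + \<gamma>) / 2\<close>. The first instance of
      \<open>large\<close> makes \<open>u z \<ge> 1\<close>, so that the quotient can be
      cleared.\<close>
    then have "\<forall>\<^sub>F z in at_top. \<rho> (2 * z) \<le> (3 + \<gamma>) / 2 * \<rho> z"
      using large[of "1 - u 0"] large[of "2 * \<gamma> * u 0 / (1 - \<gamma>)"] eventually_gt_at_top[of 0]
    proof eventually_elim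
      case (elim z)
      then have "1 \<le> u z" by (simp add: \<rho>_def)
      then have "z * deriv u z < \<gamma>0 * u z" using elim by (simp add: divide_less_eq)
      also have "\<dots> \<le> \<gamma> * u z" using \<open>1 \<le> u z\<close> by (intro mult_right_mono) (auto simp: \<gamma>_def)
      finally have 1: "u (2 * z) \<le> (1 + \<gamma>) * u z"
        using utility_concave_tangent[OF u, of z] elim by (simp add: algebra_simps)
      have 2: "\<gamma> * u 0 \<le> (1 - \<gamma>) / 2 * \<rho> z"
        using elim(3) \<gamma> by (simp add: divide_le_eq algebra_simps)
      have "\<rho> (2 * z) = u (2 * z) - u 0" "u z = \<rho> z + u 0" using elim by (auto simp: \<rho>_def)
      then show ?case using 1 2 by (simp add: algebra_simps)
    qed
    then obtain z0 where z0: "\<And>z. z \<ge> z0 \<Longrightarrow> \<rho> (2 * z) \<le> (3 + \<gamma>) / 2 * \<rho> z"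
      by (auto simp: eventually_at_top_linorder)
    then show ?thesis using \<gamma> by (intro exI[of _ "(3 + \<gamma>) / 2"] conjI exI[of _ "max 0 z0"]) auto
  qed
qed

lemma utility_concave_chart:
  assumes u: "utility_fn u"
  shows "concave_chart (\<lambda>z. u (max 0 z) - u 0)"
proof
  have cont: "continuous_on {0..} u" and sm: "strict_mono_on {0..} u"
    and sc: "strictly_concave_on {0..} u"
    using u by (auto simp: utility_fn_def)
  show "continuous_on UNIV (\<lambda>z. u (max 0 z) - u 0)"
    by (intro continuous_intros continuous_on_compose2[OF cont]) auto
  show "u (max 0 z) - u 0 = 0" if "z \<le> 0" for z using that by simp
  show "u (max 0 a) - u 0 < u (max 0 b) - u 0" if "0 \<le> a" "a < b" for a b
    using that sm by (auto simp: strict_mono_on_def)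
  show "(u (max 0 a) - u 0 + (u (max 0 b) - u 0)) / 2 \<le> u (max 0 ((a + b) / 2)) - u 0"
    if "0 \<le> a" "0 \<le> b" for a b
    using sc[unfolded strictly_concave_on_def, THEN conjunct2, rule_format, of a b "1/2"] that
    by (cases "a = b") (auto simp: field_simps)
qed (rule utility_doubling[OF u])

locale agent = market Q X + concave_chart \<rho>
  for Q :: "'a measure" and X and \<rho> :: "real \<Rightarrow> real" +
  fixes e :: "'a \<Rightarrow> real" and c B :: real
  assumes e_le: "AE \<omega> in Q. e \<omega> \<le> c"
    and integrable_utility: "x \<in> attainable Q X e \<Longrightarrow> integrable Q (\<lambda>\<omega>. \<rho> (x \<omega>))"
    and expected_utility_le: "x \<in> attainable Q X e \<Longrightarrow> expectation (\<lambda>\<omega>. \<rho> (x \<omega>)) \<le> B"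
begin

abbreviation "A \<equiv> attainable Q X e"

lemma A_measurable: "x \<in> A \<Longrightarrow> x \<in> borel_measurable Q"
  and A_nonneg: "x \<in> A \<Longrightarrow> AE \<omega> in Q. 0 \<le> x \<omega>"
  by (auto simp: attainable_def)

lemma uniform_tails_A: "uniform_tails Q \<rho> A"
proof (rule uniform_tails[OF prob_space_axioms A_measurable A_nonneg attainable_tight[OF e_le]])
  fix x y E F assume x: "x \<in> A" and y: "y \<in> A" and [measurable]: "E \<in> sets Q" "F \<in> sets Q"
  note [measurable] = A_measurable[OF x] A_measurable[OF y]
  show "(\<lambda>\<omega>. (x \<omega> * indicator E \<omega> + y \<omega> * indicator F \<omega>) / 2) \<in> A"
  proof (rule attainable_solid[OF attainable_midpoint[OF x y]])
    show "AE \<omega> in Q. 0 \<le> (x \<omega> * indicator E \<omega> + y \<omega> * indicator F \<omega>) / 2 \<and>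
        (x \<omega> * indicator E \<omega> + y \<omega> * indicator F \<omega>) / 2 \<le> (x \<omega> + y \<omega>) / 2"
      using A_nonneg[OF x] A_nonneg[OF y] by eventually_elim (auto split: split_indicator)
  qed measurable
qed (use integrable_utility expected_utility_le in auto)

text \<open>Bounded densities without normalisation: the zero function belongs to the set and serves
  as reference point when \<open>EU\<close> is bounded through its Lipschitz estimate.\<close>

definition weights :: "('a \<Rightarrow> real) set" where
  "weights = {p \<in> borel_measurable Q. (AE \<omega> in Q. 0 \<le> p \<omega>) \<and> (\<exists>C. AE \<omega> in Q. p \<omega> \<le> C)}"

definition EU :: "('a \<Rightarrow> real) \<Rightarrow> ('a \<Rightarrow> real) \<Rightarrow> real" where
  "EU p x = expectation (\<lambda>\<omega>. p \<omega> * \<rho> (x \<omega>))"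

lemma integrable_EU:
  assumes p: "p \<in> weights" and x: "x \<in> A"
  shows "integrable Q (\<lambda>\<omega>. p \<omega> * \<rho> (x \<omega>))"
proof -
  obtain C where C: "AE \<omega> in Q. p \<omega> \<le> C" and p0: "AE \<omega> in Q. 0 \<le> p \<omega>"
    and [measurable]: "p \<in> borel_measurable Q" using p by (auto simp: weights_def)
  note [measurable] = A_measurable[OF x]
  show ?thesis
    using C p0
    by (intro Bochner_Integration.integrable_bound[OF integrable_mult_right[OF integrable_utility[OF x], of C]])
       (auto simp: abs_mult nonneg elim!: eventually_elim2 intro!: mult_right_mono)
qed

text \<open>Integrate \<open>\<bar>p - q\<bar> * \<rho> x\<close>. The constant is the bound
  \<open>B\<close> on expected utility under \<open>Q\<close>, the same for all attainable
  payoffs.\<close>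

lemma EU_Lipschitz:
  assumes p: "p \<in> weights" and q: "q \<in> weights" and x: "x \<in> A"
    and d: "AE \<omega> in Q. \<bar>p \<omega> - q \<omega>\<bar> \<le> d"
  shows "\<bar>EU p x - EU q x\<bar> \<le> d * B"
proof -
  have "EU p x - EU q x = expectation (\<lambda>\<omega>. p \<omega> * \<rho> (x \<omega>) - q \<omega> * \<rho> (x \<omega>))"
    unfolding EU_def using integrable_EU[OF p x] integrable_EU[OF q x] by simp
  also have "\<bar>\<dots>\<bar> \<le> expectation (\<lambda>\<omega>. \<bar>p \<omega> * \<rho> (x \<omega>) - q \<omega> * \<rho> (x \<omega>)\<bar>)"
    by (rule integral_abs_bound)
  also have "\<dots> \<le> expectation (\<lambda>\<omega>. d * \<rho> (x \<omega>))"
  proof (rule integral_mono_AE)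
    show "AE \<omega> in Q. \<bar>p \<omega> * \<rho> (x \<omega>) - q \<omega> * \<rho> (x \<omega>)\<bar> \<le> d * \<rho> (x \<omega>)"
      using d
    proof eventually_elim
      case (elim \<omega>)
      have "\<bar>p \<omega> * \<rho> (x \<omega>) - q \<omega> * \<rho> (x \<omega>)\<bar> = \<bar>p \<omega> - q \<omega>\<bar> * \<rho> (x \<omega>)"
        by (simp add: abs_mult nonneg flip: left_diff_distrib)
      then show ?case using elim by (simp add: mult_right_mono nonneg)
    qed
  qed (use integrable_EU[OF p x] integrable_EU[OF q x] integrable_utility[OF x] in auto)
  also have "\<dots> \<le> d * B"
  proof -
    have "AE \<omega> in Q. 0 \<le> d" using d by eventually_elim (meson abs_ge_zero order_trans)
    then show ?thesis using expected_utility_le[OF x] by (simp add: mult_left_mono)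
  qed
  finally show ?thesis .
qed

lemma EU_tendsto:
  assumes "p \<in> weights" "\<And>n. x n \<in> A" "z \<in> A" "AE \<omega> in Q. (\<lambda>n. x n \<omega>) \<longlonglongrightarrow> z \<omega>"
  shows "(\<lambda>n. EU p (x n)) \<longlonglongrightarrow> EU p z"
  using assms unfolding EU_def weights_def
  by (auto intro!: integral_chart_tendsto[OF prob_space_axioms uniform_tails_A A_measurable integrable_utility])

end

section \<open>Limits of incentive compatible mechanisms\<close>

text \<open>
  \<open>D\<close> is the set of priors, \<open>d\<close> maps a prior to its density and \<open>f\<close> is the utility of the principal.
\<close>

locale contract_problem = agent Q X \<rho> e c B
  for Q :: "'a measure" and X and \<rho> :: "real \<Rightarrow> real" and e :: "'a \<Rightarrow> real" and c B :: real +
  fixes f :: "('a \<Rightarrow> real) \<Rightarrow> ereal" and D :: "'p set" and d :: "'p \<Rightarrow> 'a \<Rightarrow> real"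
  assumes f_mid: "\<And>x y m r. x \<in> A \<Longrightarrow> y \<in> A \<Longrightarrow> m \<in> A \<Longrightarrow> AE \<omega> in Q. m \<omega> \<le> (x \<omega> + y \<omega>) / 2 \<Longrightarrow>
      r \<le> f x \<Longrightarrow> r \<le> f y \<Longrightarrow> r \<le> f m"
    and f_usc: "\<And>x z r. (\<And>n. x n \<in> A) \<Longrightarrow> z \<in> A \<Longrightarrow> AE \<omega> in Q. (\<lambda>n. x n \<omega>) \<longlonglongrightarrow> z \<omega> \<Longrightarrow>
      (\<And>n::nat. r \<le> f (x n)) \<Longrightarrow> r \<le> f z"
    and d_weights: "P \<in> D \<Longrightarrow> d P \<in> weights"
    and totally_bounded: "\<epsilon> > 0 \<Longrightarrow>
      \<exists>F\<subseteq>D. finite F \<and> (\<forall>P\<in>D. \<exists>P'\<in>F. AE \<omega> in Q. \<bar>d P \<omega> - d P' \<omega>\<bar> \<le> \<epsilon>)"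
begin

text \<open>The payoffs that may be offered to \<open>P\<close> if \<open>U\<close> is to be the
  indirect utility: the equality serves \<open>P\<close> itself, the inequalities stop every other
  prior from preferring this payoff. All coupling between priors sits in \<open>U\<close>, so
  elements can be picked independently.\<close>

definition menu :: "('p \<Rightarrow> real) \<Rightarrow> 'p \<Rightarrow> ('a \<Rightarrow> real) set" where
  "menu U P = {z \<in> A. EU (d P) z = U P \<and> (\<forall>P'\<in>D. EU (d P') z \<le> U P')}"

definition incentive_compatible :: "('p \<Rightarrow> 'a \<Rightarrow> real) \<Rightarrow> bool" where
  "incentive_compatible x \<longleftrightarrow>
     (\<forall>P\<in>D. x P \<in> A) \<and> (\<forall>P\<in>D. \<forall>P'\<in>D. EU (d P) (x P') \<le> EU (d P) (x P))"

text \<open>\<open>C n\<close> replaces the closed convex hull of the tail from \<open>n\<close> on: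
  it holds all payoffs that obey every one-sided bound shared by that tail, for all weights at once.
  These bounds survive midpoints, since \<open>EU\<close> is affine in the chart and
  \<open>f\<close> is quasi-concave, and they survive limits by \<open>EU_tendsto\<close> and
  \<open>f_usc\<close>.\<close>

lemma weak_compactness:
  assumes x: "\<And>k. x k \<in> A"
  obtains z where "z \<in> A" "\<And>r. \<forall>\<^sub>F k in sequentially. r \<le> f (x k) \<Longrightarrow> r \<le> f z"
    "\<And>p r. p \<in> weights \<Longrightarrow> \<forall>\<^sub>F k in sequentially. EU p (x k) \<le> r \<Longrightarrow> EU p z \<le> r"
    "\<And>p r. p \<in> weights \<Longrightarrow> \<forall>\<^sub>F k in sequentially. r \<le> EU p (x k) \<Longrightarrow> r \<le> EU p z"
proof -
  define C where "C n = {y \<in> A. (\<forall>r. (\<forall>k\<ge>n. r \<le> f (x k)) \<longrightarrow> r \<le> f y) \<and>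
    (\<forall>p\<in>weights. \<forall>r. (\<forall>k\<ge>n. EU p (x k) \<le> r) \<longrightarrow> EU p y \<le> r) \<and>
    (\<forall>p\<in>weights. \<forall>r. (\<forall>k\<ge>n. r \<le> EU p (x k)) \<longrightarrow> r \<le> EU p y)}" for n
  obtain y z where y: "\<And>n. y n \<in> C n" and z: "z \<in> borel_measurable Q"
    and lim: "AE \<omega> in Q. (\<lambda>n. y n \<omega>) \<longlonglongrightarrow> z \<omega>"
  proof (rule convex_compactness[OF prob_space_axioms, of C])
    show "C n \<noteq> {}" for n
    proof -
      have "x n \<in> C n" using x by (auto simp: C_def)
      then show ?thesis by blast
    qed
    show "decseq C"
      unfolding decseq_Suc_iff
    proof (intro allI subsetI)
      fix n y assume "y \<in> C (Suc n)"
      then show "y \<in> C n" unfolding C_def by (auto dest: Suc_leD)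
    qed
    show "\<exists>m\<in>C n. AE \<omega> in Q. \<rho> (m \<omega>) = (\<rho> (a \<omega>) + \<rho> (b \<omega>)) / 2"
      if a: "a \<in> C n" and b: "b \<in> C n" for n a b
    proof -
      have ab: "a \<in> A" "b \<in> A" using a b by (auto simp: C_def)
      obtain m where m: "m \<in> borel_measurable Q" "\<And>\<omega>. 0 \<le> m \<omega>"
        "\<And>\<omega>. \<rho> (m \<omega>) = (\<rho> (a \<omega>) + \<rho> (b \<omega>)) / 2" "\<And>\<omega>. m \<omega> \<le> (max 0 (a \<omega>) + max 0 (b \<omega>)) / 2"
        using chart_midpoint_measurable[OF A_measurable[OF ab(1)] A_measurable[OF ab(2)]] by blast
      have le: "AE \<omega> in Q. m \<omega> \<le> (a \<omega> + b \<omega>) / 2"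
        using A_nonneg[OF ab(1)] A_nonneg[OF ab(2)]
      proof eventually_elim
        case (elim \<omega>)
        then show ?case using m(4)[of \<omega>] by simp
      qed
      have mA: "m \<in> A"
        by (rule attainable_solid[OF attainable_midpoint[OF ab] m(1)]) (use le m(2) in auto)
      have EUm: "EU p m = (EU p a + EU p b) / 2" if "p \<in> weights" for p
      proof -
        have "EU p m = expectation (\<lambda>\<omega>. (p \<omega> * \<rho> (a \<omega>) + p \<omega> * \<rho> (b \<omega>)) / 2)"
          unfolding EU_def by (simp add: m(3) distrib_left)
        then show ?thesis
          unfolding EU_def using integrable_EU[OF that ab(1)] integrable_EU[OF that ab(2)] by simp
      qed
      have "m \<in> C n"
        unfolding C_def
      proof (intro CollectI conjI allI impI ballI mA)
        fix r assume "\<forall>k\<ge>n. r \<le> f (x k)"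
        then show "r \<le> f m" using a b by (intro f_mid[OF ab mA le]) (auto simp: C_def)
      next
        fix p r assume p: "p \<in> weights" "\<forall>k\<ge>n. EU p (x k) \<le> r"
        then have "EU p a \<le> r" "EU p b \<le> r" using a b by (auto simp: C_def)
        then show "EU p m \<le> r" by (simp add: EUm p)
      next
        fix p r assume p: "p \<in> weights" "\<forall>k\<ge>n. r \<le> EU p (x k)"
        then have "r \<le> EU p a" "r \<le> EU p b" using a b by (auto simp: C_def)
        then show "r \<le> EU p m" by (simp add: EUm p)
      qed
      then show ?thesis using m(3) by auto
    qed
    show "uniformly_tight Q (C 0)"
      by (rule uniformly_tight_subset[OF attainable_tight[OF e_le]]) (auto simp: C_def)
    show "w \<in> borel_measurable Q \<and> (AE \<omega> in Q. 0 \<le> w \<omega>)" if "w \<in> C n" for n w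
      using that A_measurable A_nonneg by (auto simp: C_def)
  qed blast
  have yA: "y n \<in> A" for n using y by (auto simp: C_def)
  have zA: "z \<in> A" by (rule attainable_closed[OF e_le yA z lim])
  show ?thesis
  proof (rule that[OF zA])
    fix r assume "\<forall>\<^sub>F k in sequentially. r \<le> f (x k)"
    then obtain N where N: "\<And>k. k \<ge> N \<Longrightarrow> r \<le> f (x k)" by (auto simp: eventually_sequentially)
    show "r \<le> f z"
    \<comment> \<open>\<open>y n\<close> inherits the bound only from index \<open>N\<close> on,
      whereas \<open>f_usc\<close> wants it for every index.\<close>
    proof (rule f_usc[of "\<lambda>n. y (n + N)"])
      show "AE \<omega> in Q. (\<lambda>n. y (n + N) \<omega>) \<longlonglongrightarrow> z \<omega>"
        using lim by eventually_elim (rule LIMSEQ_ignore_initial_segment)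
      show "r \<le> f (y (n + N))" for n
        using y[of "n + N"] N by (simp add: C_def)
    qed (use yA zA in auto)
  next
    fix p r assume p: "p \<in> weights" and "\<forall>\<^sub>F k in sequentially. EU p (x k) \<le> r"
    then obtain N where N: "\<And>k. k \<ge> N \<Longrightarrow> EU p (x k) \<le> r" by (auto simp: eventually_sequentially)
    have "EU p (y n) \<le> r" if "n \<ge> N" for n using y[of n] N that p by (simp add: C_def)
    then show "EU p z \<le> r" by (intro LIMSEQ_le_const2[OF EU_tendsto[OF p yA zA lim]]) blast
  next
    fix p r assume p: "p \<in> weights" and "\<forall>\<^sub>F k in sequentially. r \<le> EU p (x k)"
    then obtain N where N: "\<And>k. k \<ge> N \<Longrightarrow> r \<le> EU p (x k)" by (auto simp: eventually_sequentially)
    have "r \<le> EU p (y n)" if "n \<ge> N" for n using y[of n] N that p by (simp add: C_def)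
    then show "r \<le> EU p z" by (intro LIMSEQ_le_const[OF EU_tendsto[OF p yA zA lim]]) blast
  qed
qed

text \<open>At priors other than \<open>P\<close> only upper control is at hand, since
  \<open>x k\<close> need not be the payoff they would choose; hence dominating sequences
  \<open>a\<close> instead of convergence of \<open>EU (d P') (x k)\<close>.\<close>

lemma menu_limit:
  assumes x: "\<And>k::nat. x k \<in> A" and P: "P \<in> D"
    and lim: "(\<lambda>k. EU (d P) (x k)) \<longlonglongrightarrow> U P"
    and le: "\<And>P'. P' \<in> D \<Longrightarrow> \<exists>a. a \<longlonglongrightarrow> U P' \<and> (\<forall>k. EU (d P') (x k) \<le> a k)"
  obtains z where "z \<in> menu U P" "\<And>r. \<forall>\<^sub>F k in sequentially. r \<le> f (x k) \<Longrightarrow> r \<le> f z"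
proof -
  obtain z where z: "z \<in> A" "\<And>r. \<forall>\<^sub>F k in sequentially. r \<le> f (x k) \<Longrightarrow> r \<le> f z"
    "\<And>p r. p \<in> weights \<Longrightarrow> \<forall>\<^sub>F k in sequentially. EU p (x k) \<le> r \<Longrightarrow> EU p z \<le> r"
    "\<And>p r. p \<in> weights \<Longrightarrow> \<forall>\<^sub>F k in sequentially. r \<le> EU p (x k) \<Longrightarrow> r \<le> EU p z"
    using weak_compactness[of x, OF x] by blast
  have upper: "EU (d P') z \<le> U P'" if P': "P' \<in> D" for P'
  proof (rule dense_ge)
    fix r assume "U P' < r"
    obtain a where a: "a \<longlonglongrightarrow> U P'" "\<And>k. EU (d P') (x k) \<le> a k" using le[OF P'] by blast
    have "\<forall>\<^sub>F k in sequentially. a k < r" by (rule order_tendstoD(2)[OF a(1) \<open>U P' < r\<close>])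
    then have "\<forall>\<^sub>F k in sequentially. EU (d P') (x k) \<le> r"
      by eventually_elim (meson a(2) less_imp_le order_trans)
    then show "EU (d P') z \<le> r" by (rule z(3)[OF d_weights[OF P']])
  qed
  have "U P \<le> EU (d P) z"
  proof (rule dense_le)
    fix r assume "r < U P"
    then have "\<forall>\<^sub>F k in sequentially. r < EU (d P) (x k)" by (rule order_tendstoD(1)[OF lim])
    then have "\<forall>\<^sub>F k in sequentially. r \<le> EU (d P) (x k)" by eventually_elim simp
    then show "r \<le> EU (d P) z" by (rule z(4)[OF d_weights[OF P]])
  qed
  then have "z \<in> menu U P" using z(1) upper P by (auto simp: menu_def intro: antisym)
  then show ?thesis using z(2) that by blast
qed

lemma menu_limit_const:
  assumes x: "\<And>k::nat. x k \<in> menu U P" and P: "P \<in> D"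
  obtains z where "z \<in> menu U P" "\<And>r. \<forall>\<^sub>F k in sequentially. r \<le> f (x k) \<Longrightarrow> r \<le> f z"
proof (rule menu_limit[of x P U])
  show "x k \<in> A" for k using x by (auto simp: menu_def)
  show "(\<lambda>k. EU (d P) (x k)) \<longlonglongrightarrow> U P" using x by (simp add: menu_def)
  show "\<exists>a. a \<longlonglongrightarrow> U P' \<and> (\<forall>k. EU (d P') (x k) \<le> a k)" if "P' \<in> D" for P'
    using x that by (intro exI[of _ "\<lambda>_. U P'"]) (auto simp: menu_def)
qed (use P that in auto)

lemma menu_maximum:
  assumes ne: "menu U P \<noteq> {}" and P: "P \<in> D"
  obtains z where "z \<in> menu U P" "\<And>y. y \<in> menu U P \<Longrightarrow> f y \<le> f z"
proof -
  obtain h where h: "incseq h" "range h \<subseteq> f ` menu U P" "Sup (f ` menu U P) = (SUP i. h i)"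
    using Sup_countable_SUP[of "f ` menu U P"] ne by auto
  have "\<forall>k. \<exists>x\<in>menu U P. h k = f x" using h(2) by blast
  then obtain x where x: "\<And>k. x k \<in> menu U P" "\<And>k. h k = f (x k)" by metis
  obtain z where z: "z \<in> menu U P" "\<And>r. \<forall>\<^sub>F k in sequentially. r \<le> f (x k) \<Longrightarrow> r \<le> f z"
    using menu_limit_const[of x, OF x(1) P] by blast
  have "Sup (f ` menu U P) \<le> f z"
  proof (rule dense_le)
    fix r assume "r < Sup (f ` menu U P)"
    then obtain N where "r < h N" unfolding h(3) by (auto simp: less_SUP_iff)
    then have "r \<le> f (x k)" if "N \<le> k" for k
      using incseqD[OF h(1) that] x(2)[of k] by simp
    then have "\<forall>\<^sub>F k in sequentially. r \<le> f (x k)" by (rule eventually_sequentiallyI)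
    then show "r \<le> f z" by (rule z(2))
  qed
  then show ?thesis using z(1) that by (meson SUP_upper order_trans)
qed

text \<open>An envelope argument: each incentive constraint bounds the indirect utility at one prior
  below by what that prior gets from the other's payoff, and for a fixed payoff the change of prior
  costs at most \<open>\<delta> * B\<close>.\<close>

lemma indirect_utility_Lipschitz:
  assumes x: "incentive_compatible x" and P: "P \<in> D" and P': "P' \<in> D"
    and near: "AE \<omega> in Q. \<bar>d P \<omega> - d P' \<omega>\<bar> \<le> \<delta>"
  shows "\<bar>EU (d P) (x P) - EU (d P') (x P')\<bar> \<le> \<delta> * B"
proof -
  have xA: "x P \<in> A" "x P' \<in> A" and ic: "EU (d P) (x P') \<le> EU (d P) (x P)" "EU (d P') (x P) \<le> EU (d P') (x P')"
    using x P P' by (auto simp: incentive_compatible_def)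
  show ?thesis
    using EU_Lipschitz[OF d_weights[OF P] d_weights[OF P'] xA(1) near]
      EU_Lipschitz[OF d_weights[OF P] d_weights[OF P'] xA(2) near] ic
    by linarith
qed

text \<open>The Arzela-Ascoli argument for pointwise limits: a diagonal subsequence converges on a
  countable dense set of priors, and the common Lipschitz constant carries the Cauchy property to
  all others.\<close>

lemma indirect_utilities_convergent_subseq:
  assumes x: "\<And>n::nat. incentive_compatible (x n)"
  obtains s U where "strict_mono s"
    "\<And>P. P \<in> D \<Longrightarrow> (\<lambda>n. EU (d P) (x (s n) P)) \<longlonglongrightarrow> U P"
proof -
  define V where "V n P = EU (d P) (x n P)" for n P
  have "\<forall>k::nat. \<exists>F\<subseteq>D. finite F \<and>
      (\<forall>P\<in>D. \<exists>P'\<in>F. AE \<omega> in Q. \<bar>d P \<omega> - d P' \<omega>\<bar> \<le> 1 / real (Suc k))"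
    by (intro allI totally_bounded) simp
  then obtain F where F: "\<And>k. F k \<subseteq> D" "\<And>k. finite (F k)"
    "\<And>k P. P \<in> D \<Longrightarrow> \<exists>P'\<in>F k. AE \<omega> in Q. \<bar>d P \<omega> - d P' \<omega>\<bar> \<le> 1 / real (Suc k)" by metis
  define G where "G = (\<Union>k. F k)"
  have G: "countable G" "G \<subseteq> D" using F(1)
    by (auto simp: G_def intro!: countable_UN countable_finite[OF F(2)])
  have "\<forall>P\<in>D. \<exists>C. AE \<omega> in Q. d P \<omega> \<le> C" using d_weights by (auto simp: weights_def)
  then obtain C where C: "\<And>P. P \<in> D \<Longrightarrow> AE \<omega> in Q. d P \<omega> \<le> C P" by metis
  \<comment> \<open>The Lipschitz estimate is applied against the zero weight.\<close>
  have V_bd: "\<bar>V n P\<bar> \<le> C P * B" if P: "P \<in> D" for n P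
  proof -
    have "AE \<omega> in Q. 0 \<le> d P \<omega>" using d_weights[OF P] by (simp add: weights_def)
    then have "AE \<omega> in Q. \<bar>d P \<omega> - 0\<bar> \<le> C P" using C[OF P] by eventually_elim simp
    moreover have "(\<lambda>_. 0) \<in> weights" by (auto simp: weights_def)
    ultimately have "\<bar>EU (d P) (x n P) - EU (\<lambda>_. 0) (x n P)\<bar> \<le> C P * B"
      using x P by (intro EU_Lipschitz d_weights) (auto simp: incentive_compatible_def)
    then show ?thesis by (simp add: V_def EU_def)
  qed
  \<comment> \<open>The extraction theorem needs one bound for all priors, so values are divided by
    \<open>C P * B + 1\<close>; the added 1 keeps the divisor positive.\<close>
  obtain s where s: "strict_mono s" "\<And>P. P \<in> G \<Longrightarrow> \<exists>l. (\<lambda>n. V (s n) P / (C P * B + 1)) \<longlonglongrightarrow> l"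
  proof (rule function_convergent_subsequence[OF G(1), of "\<lambda>n P. V n P / (C P * B + 1)" 1])
    fix n P assume "P \<in> G"
    then have "\<bar>V n P\<bar> \<le> C P * B" using V_bd G by blast
    moreover from this have "0 \<le> C P * B" by (meson abs_ge_zero order_trans)
    ultimately show "norm (V n P / (C P * B + 1)) \<le> 1" by (simp add: divide_le_eq)
  qed blast
  have conv_G: "convergent (\<lambda>n. V (s n) P)" if "P \<in> G" for P
  proof -
    obtain l where l: "(\<lambda>n. V (s n) P / (C P * B + 1)) \<longlonglongrightarrow> l" using s(2)[OF \<open>P \<in> G\<close>] by blast
    have "\<bar>V 0 P\<bar> \<le> C P * B" using V_bd that G by blast
    then have "C P * B + 1 \<noteq> 0" by linarith
    then have "(\<lambda>n. V (s n) P) = (\<lambda>n. V (s n) P / (C P * B + 1) * (C P * B + 1))" by simp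
    also have "\<dots> \<longlonglongrightarrow> l * (C P * B + 1)" by (intro tendsto_mult l tendsto_const)
    finally show ?thesis by (rule convergentI)
  qed
  have "\<exists>l. (\<lambda>n. V (s n) P) \<longlonglongrightarrow> l" if P: "P \<in> D" for P
  proof -
    have "Cauchy (\<lambda>n. V (s n) P)"
    proof (rule metric_CauchyI)
      fix r :: real assume "0 < r"
      obtain k :: nat where k: "3 * \<bar>B\<bar> / r < real k" using reals_Archimedean2 by blast
      have k': "\<bar>B\<bar> / real (Suc k) < r / 3" using k \<open>0 < r\<close> by (simp add: field_simps)
      obtain P' where P': "P' \<in> F k" "AE \<omega> in Q. \<bar>d P \<omega> - d P' \<omega>\<bar> \<le> 1 / real (Suc k)"
        using F(3)[OF P] by blast
      have "P' \<in> D" "P' \<in> G" using P'(1) F(1) by (auto simp: G_def)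
      have near: "\<bar>V n P - V n P'\<bar> < r / 3" for n
      proof -
        have "\<bar>V n P - V n P'\<bar> \<le> 1 / real (Suc k) * B"
          unfolding V_def by (rule indirect_utility_Lipschitz[OF x P \<open>P' \<in> D\<close> P'(2)])
        also have "\<dots> \<le> \<bar>B\<bar> / real (Suc k)" by (simp add: divide_right_mono)
        finally show ?thesis using k' by linarith
      qed
      have "Cauchy (\<lambda>n. V (s n) P')" by (rule convergent_Cauchy[OF conv_G[OF \<open>P' \<in> G\<close>]])
      then obtain N where N: "\<And>m n. m \<ge> N \<Longrightarrow> n \<ge> N \<Longrightarrow> \<bar>V (s m) P' - V (s n) P'\<bar> < r / 3"
        using \<open>0 < r\<close> unfolding Cauchy_def dist_real_def by (meson zero_less_divide_iff zero_less_numeral)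
      have "dist (V (s m) P) (V (s n) P) < r" if "m \<ge> N" "n \<ge> N" for m n
        using N[OF that] near[of "s m"] near[of "s n"] unfolding dist_real_def by linarith
      then show "\<exists>N. \<forall>m\<ge>N. \<forall>n\<ge>N. dist (V (s m) P) (V (s n) P) < r" by blast
    qed
    then show ?thesis by (simp add: Cauchy_convergent_iff convergent_def)
  qed
  then obtain U where "\<And>P. P \<in> D \<Longrightarrow> (\<lambda>n. V (s n) P) \<longlonglongrightarrow> U P" by metis
  then show ?thesis by (intro that[of s U] s(1)) (simp add: V_def)
qed

text \<open>
  The limit mechanism picks, for every prior, a best element for the principal among the payoffs that
  are compatible with the limit \<open>U\<close> of the indirect utilities of the agent.
\<close>

theorem limit_mechanism:
  assumes x: "\<And>n::nat. incentive_compatible (x n)"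
  obtains s y where "strict_mono s" "incentive_compatible y"
    "\<And>P r. P \<in> D \<Longrightarrow> (\<And>n. r \<le> EU (d P) (x n P)) \<Longrightarrow> r \<le> EU (d P) (y P)"
    "\<And>P. P \<in> D \<Longrightarrow> limsup (\<lambda>n. f (x (s n) P)) \<le> f (y P)"
    "\<And>P R r. P \<in> D \<Longrightarrow> (\<And>n::nat. R n \<in> D) \<Longrightarrow>
       (\<And>n. AE \<omega> in Q. \<bar>d P \<omega> - d (R n) \<omega>\<bar> \<le> 1 / real (Suc n)) \<Longrightarrow>
       (\<And>n. r \<le> f (y (R n))) \<Longrightarrow> r \<le> f (y P)"
proof -
  obtain s U where s: "strict_mono s"
    and U: "\<And>P. P \<in> D \<Longrightarrow> (\<lambda>n. EU (d P) (x (s n) P)) \<longlonglongrightarrow> U P"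
    using indirect_utilities_convergent_subseq[of x, OF x] by blast
  have xA: "x n P \<in> A" if "P \<in> D" for n P using x that by (auto simp: incentive_compatible_def)
  \<comment> \<open>The prior \<open>P'\<close> cannot gain from the payoff meant for
    \<open>P\<close>, so its own indirect utilities are the dominating sequence required by
    \<open>menu_limit\<close>.\<close>
  have dominated: "\<exists>a. a \<longlonglongrightarrow> U P' \<and> (\<forall>k. EU (d P') (x (s (t k)) P) \<le> a k)"
    if "P \<in> D" "P' \<in> D" "strict_mono t" for P P' and t :: "nat \<Rightarrow> nat"
  proof (intro exI conjI allI)
    show "(\<lambda>k. EU (d P') (x (s (t k)) P')) \<longlonglongrightarrow> U P'"
      using LIMSEQ_subseq_LIMSEQ[OF U[OF that(2)] that(3)] by (simp add: o_def)
    show "EU (d P') (x (s (t k)) P) \<le> EU (d P') (x (s (t k)) P')" for k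
      using x that by (auto simp: incentive_compatible_def)
  qed
  \<comment> \<open>Subsequences are allowed because a value below an upper limit is reached only
    along some subsequence.\<close>
  have menu_ge: "\<exists>z\<in>menu U P. \<forall>r. (\<forall>k. r \<le> f (x (s (t k)) P)) \<longrightarrow> r \<le> f z"
    if P: "P \<in> D" and t: "strict_mono t" for P and t :: "nat \<Rightarrow> nat"
  proof -
    have "(\<lambda>k. EU (d P) (x (s (t k)) P)) \<longlonglongrightarrow> U P"
      using LIMSEQ_subseq_LIMSEQ[OF U[OF P] t] by (simp add: o_def)
    from menu_limit[of "\<lambda>k. x (s (t k)) P", OF xA[OF P] P this dominated[OF P _ t]]
    obtain z where "z \<in> menu U P"
      "\<And>r. \<forall>\<^sub>F k in sequentially. r \<le> f (x (s (t k)) P) \<Longrightarrow> r \<le> f z" by blast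
    then show ?thesis by (auto intro: always_eventually)
  qed
  have ne: "menu U P \<noteq> {}" if "P \<in> D" for P
    using menu_ge[OF that strict_mono_id] by blast
  have "\<exists>z\<in>menu U P. \<forall>w\<in>menu U P. f w \<le> f z" if "P \<in> D" for P
    by (rule menu_maximum[OF ne[OF that] that]) blast
  then obtain y where "\<forall>P\<in>D. y P \<in> menu U P \<and> (\<forall>w\<in>menu U P. f w \<le> f (y P))"
    by (metis bchoice)
  then have y: "\<And>P. P \<in> D \<Longrightarrow> y P \<in> menu U P"
    "\<And>P w. P \<in> D \<Longrightarrow> w \<in> menu U P \<Longrightarrow> f w \<le> f (y P)" by blast+
  have yD: "y P \<in> A" "EU (d P) (y P) = U P" if "P \<in> D" for P
    using y(1)[OF that] by (auto simp: menu_def)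
  have ic: "incentive_compatible y"
    unfolding incentive_compatible_def using y(1) yD by (auto simp: menu_def)
  show ?thesis
  proof (rule that[OF s ic])
    fix P r assume P: "P \<in> D" and "\<And>n. r \<le> EU (d P) (x n P)"
    then show "r \<le> EU (d P) (y P)"
      unfolding yD(2)[OF P] by (intro LIMSEQ_le_const[OF U[OF P]]) blast
  next
    fix P assume P: "P \<in> D"
    show "limsup (\<lambda>n. f (x (s n) P)) \<le> f (y P)"
    proof (rule dense_le)
      fix r assume r: "r < limsup (\<lambda>n. f (x (s n) P))"
      have "\<exists>\<^sub>F n in sequentially. r \<le> f (x (s n) P)"
      proof (rule ccontr)
        assume "\<not> (\<exists>\<^sub>F n in sequentially. r \<le> f (x (s n) P))"
        then have "\<forall>\<^sub>F n in sequentially. f (x (s n) P) \<le> r"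
          by (auto simp: not_frequently elim!: eventually_mono)
        then show False using Limsup_bounded[of "\<lambda>n. f (x (s n) P)" r sequentially] r by simp
      qed
      then obtain t :: "nat \<Rightarrow> nat" where t: "strict_mono t" "\<And>k. r \<le> f (x (s (t k)) P)"
        using not_eventually_sequentiallyD[of "\<lambda>n. \<not> r \<le> f (x (s n) P)"] by (auto simp: frequently_def)
      then show "r \<le> f (y P)" using menu_ge[OF P t(1)] y(2)[OF P] by (meson order_trans)
    qed
  next
    fix P R r
    assume P: "P \<in> D" and R: "\<And>n::nat. R n \<in> D"
      and near: "\<And>n. AE \<omega> in Q. \<bar>d P \<omega> - d (R n) \<omega>\<bar> \<le> 1 / real (Suc n)"
      and r: "\<And>n. r \<le> f (y (R n))"
    have small: "(\<lambda>n. 1 / real (Suc n) * B) \<longlonglongrightarrow> 0"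
      using tendsto_mult_left_zero[OF LIMSEQ_inverse_real_of_nat, of B] by (simp add: inverse_eq_divide)
    have lim: "(\<lambda>n. EU (d P) (y (R n))) \<longlonglongrightarrow> U P"
    proof (rule LIM_zero_cancel, rule tendsto_rabs_zero_cancel, rule tendsto_sandwich[of "\<lambda>_. 0"])
      \<comment> \<open>One Lipschitz error for evaluating the same payoff \<open>y (R n)\<close>
        under \<open>P\<close> instead of \<open>R n\<close>, one for the indirect utilities at
        these priors.\<close>
      have "\<bar>EU (d P) (y (R n)) - U P\<bar> \<le> 2 * (1 / real (Suc n) * B)" for n
        using indirect_utility_Lipschitz[OF ic P R near, of n]
          EU_Lipschitz[OF d_weights[OF P] d_weights[OF R[of n]] yD(1)[OF R[of n]] near[of n]]
        unfolding yD(2)[OF P] by linarith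
      then show "\<forall>\<^sub>F n in sequentially. \<bar>EU (d P) (y (R n)) - U P\<bar> \<le> 2 * (1 / real (Suc n) * B)"
        by (auto intro: always_eventually)
      show "(\<lambda>n. 2 * (1 / real (Suc n) * B)) \<longlonglongrightarrow> 0" by (rule tendsto_mult_right_zero[OF small])
    qed auto
    have "\<exists>a. a \<longlonglongrightarrow> U P' \<and> (\<forall>k. EU (d P') (y (R k)) \<le> a k)" if "P' \<in> D" for P'
      using y(1)[OF R] that by (intro exI[of _ "\<lambda>_. U P'"]) (auto simp: menu_def)
    from menu_limit[of "\<lambda>n. y (R n)", OF yD(1)[OF R] P lim this]
    obtain z where "z \<in> menu U P" "\<And>r. \<forall>\<^sub>F k in sequentially. r \<le> f (y (R k)) \<Longrightarrow> r \<le> f z" by blast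
    then show "r \<le> f (y P)" using r y(2)[OF P] by (meson always_eventually order_trans)
  qed
qed

end

section \<open>Densities of priors\<close>

lemma AE_abs_le_Linf_norm:
  assumes "f \<in> Linf_space Q"
  shows "AE \<omega> in Q. \<bar>f \<omega>\<bar> \<le> real_of_ereal (Linf_norm Q f)"
proof -
  have "AE \<omega> in Q. ereal \<bar>f \<omega>\<bar> \<le> Linf_norm Q f" unfolding Linf_norm_def by (rule esssup_AE)
  then show ?thesis
  proof eventually_elim
    case (elim \<omega>)
    then show ?case using assms by (cases "Linf_norm Q f") (auto simp: Linf_space_def)
  qed
qed

lemma AE_abs_le_of_Linf_norm_less:
  assumes "Linf_norm Q f < ereal \<delta>"
  shows "AE \<omega> in Q. \<bar>f \<omega>\<bar> \<le> \<delta>"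
proof -
  have "AE \<omega> in Q. ereal \<bar>f \<omega>\<bar> \<le> Linf_norm Q f" unfolding Linf_norm_def by (rule esssup_AE)
  then show ?thesis
  proof eventually_elim
    case (elim \<omega>)
    then have "ereal \<bar>f \<omega>\<bar> \<le> ereal \<delta>" using assms by (meson less_imp_le order_trans)
    then show ?case by simp
  qed
qed

text \<open>For \<open>g\<close> in \<open>Linf_space Q\<close> this is the open norm ball. Phrased
  by a.e. bounds, the triangle inequality becomes pointwise arithmetic; the slack
  \<open>r < \<epsilon>\<close> makes the set open.\<close>

definition Linf_ball :: "'a measure \<Rightarrow> ('a \<Rightarrow> real) \<Rightarrow> real \<Rightarrow> ('a \<Rightarrow> real) set" where
  "Linf_ball Q g \<epsilon> = {h \<in> Linf_space Q. \<exists>r<\<epsilon>. AE \<omega> in Q. \<bar>g \<omega> - h \<omega>\<bar> \<le> r}"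

lemma openin_Linf_ball: "openin (Linf_topology Q) (Linf_ball Q g \<epsilon>)"
  unfolding openin_Linf_topology
proof (intro conjI ballI)
  fix h assume "h \<in> Linf_ball Q g \<epsilon>"
  then obtain r where r: "r < \<epsilon>" "AE \<omega> in Q. \<bar>g \<omega> - h \<omega>\<bar> \<le> r" by (auto simp: Linf_ball_def)
  define \<delta> where "\<delta> = (\<epsilon> - r) / 2"
  have "k \<in> Linf_ball Q g \<epsilon>" if k: "k \<in> Linf_space Q" "Linf_norm Q (\<lambda>\<omega>. h \<omega> - k \<omega>) < ereal \<delta>" for k
  proof -
    have "AE \<omega> in Q. \<bar>g \<omega> - k \<omega>\<bar> \<le> r + \<delta>"
      using AE_abs_le_of_Linf_norm_less[OF k(2)] r(2) by eventually_elim linarith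
    moreover have "r + \<delta> < \<epsilon>" using r(1) by (simp add: \<delta>_def field_simps)
    ultimately show ?thesis using k(1) by (auto simp: Linf_ball_def)
  qed
  moreover have "\<delta> > 0" using r(1) by (simp add: \<delta>_def)
  ultimately show "\<exists>\<delta>>0. \<forall>k\<in>Linf_space Q. Linf_norm Q (\<lambda>\<omega>. h \<omega> - k \<omega>) < ereal \<delta> \<longrightarrow> k \<in> Linf_ball Q g \<epsilon>"
    by blast
qed (auto simp: Linf_ball_def)

lemma Linf_ball_center: "g \<in> Linf_space Q \<Longrightarrow> 0 < \<epsilon> \<Longrightarrow> g \<in> Linf_ball Q g \<epsilon>"
  by (auto simp: Linf_ball_def intro!: exI[of _ 0])

lemma Linf_ballD: "h \<in> Linf_ball Q g \<epsilon> \<Longrightarrow> AE \<omega> in Q. \<bar>g \<omega> - h \<omega>\<bar> \<le> \<epsilon>"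
  by (auto simp: Linf_ball_def elim: eventually_mono)

lemma compactin_Linf_totally_bounded:
  assumes K: "compactin (Linf_topology Q) (d ` D)" and "\<epsilon> > 0"
  shows "\<exists>F\<subseteq>D. finite F \<and> (\<forall>P\<in>D. \<exists>P'\<in>F. AE \<omega> in Q. \<bar>d P \<omega> - d P' \<omega>\<bar> \<le> \<epsilon>)"
proof -
  have sub: "d ` D \<subseteq> Linf_space Q" using compactin_subset_topspace[OF K] by (simp add: topspace_Linf_topology)
  define \<U> where "\<U> = (\<lambda>P. Linf_ball Q (d P) \<epsilon>) ` D"
  have "\<forall>U\<in>\<U>. openin (Linf_topology Q) U" by (auto simp: \<U>_def openin_Linf_ball)
  moreover have "d ` D \<subseteq> \<Union>\<U>" using sub \<open>\<epsilon> > 0\<close> by (auto simp: \<U>_def intro: Linf_ball_center)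
  ultimately obtain \<F> where \<F>: "finite \<F>" "\<F> \<subseteq> \<U>" "d ` D \<subseteq> \<Union>\<F>"
    using K unfolding compactin_def by meson
  obtain F where F: "F \<subseteq> D" "finite F" "\<F> = (\<lambda>P. Linf_ball Q (d P) \<epsilon>) ` F"
    using finite_subset_image[OF \<F>(1) \<F>(2)[unfolded \<U>_def]] by blast
  have "\<exists>P'\<in>F. AE \<omega> in Q. \<bar>d P \<omega> - d P' \<omega>\<bar> \<le> \<epsilon>" if "P \<in> D" for P
  proof -
    have "d P \<in> (\<Union>P'\<in>F. Linf_ball Q (d P') \<epsilon>)" using \<F>(3) that unfolding F(3) by auto
    then obtain P' where P': "P' \<in> F" "d P \<in> Linf_ball Q (d P') \<epsilon>" by (rule UN_E)
    have "AE \<omega> in Q. \<bar>d P \<omega> - d P' \<omega>\<bar> \<le> \<epsilon>"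
      using Linf_ballD[OF P'(2)] by (simp add: abs_minus_commute)
    then show ?thesis using P'(1) by blast
  qed
  then show ?thesis using F by blast
qed

lemma topspace_dens_topology:
  assumes "dens Q ` \<Q> \<subseteq> Linf_space Q"
  shows "topspace (dens_topology Q \<Q>) = \<Q>"
  using assms by (auto simp: dens_topology_def topspace_pullback_topology topspace_Linf_topology)

lemma space_borel_of: "space (borel_of T) = topspace T"
  unfolding borel_of_def by (rule space_measure_of) (auto dest: openin_subset)

lemma borel_of_openin: "openin T U \<Longrightarrow> U \<in> sets (borel_of T)"
  unfolding borel_of_def by (subst sets_measure_of) (auto dest: openin_subset)

text \<open>Sequential upper semicontinuity makes each set \<open>g P < r\<close> open: if no ball
  around \<open>P\<close> worked, picking offenders in balls of radius
  \<open>1 / real (Suc n)\<close> would give a sequence to which \<open>usc\<close> applies.\<close>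

lemma usc_measurable_dens_topology:
  fixes g :: "'a measure \<Rightarrow> ereal"
  assumes sub: "dens Q ` \<Q> \<subseteq> Linf_space Q"
    and usc: "\<And>P R r. P \<in> \<Q> \<Longrightarrow> (\<And>n::nat. R n \<in> \<Q>) \<Longrightarrow>
       (\<And>n. AE \<omega> in Q. \<bar>dens Q P \<omega> - dens Q (R n) \<omega>\<bar> \<le> 1 / real (Suc n)) \<Longrightarrow>
       (\<And>n. r \<le> g (R n)) \<Longrightarrow> r \<le> g P"
  shows "g \<in> borel_measurable (borel_of (dens_topology Q \<Q>))"
proof (rule borel_measurableI_less)
  fix r :: ereal
  \<comment> \<open>Open sets of the pullback topology are preimages, so the open set must be built
    among the densities, not among the measures.\<close>
  define V where "V = \<Union>{Linf_ball Q (dens Q P) \<epsilon> | P \<epsilon>. P \<in> \<Q> \<and> 0 < \<epsilon> \<and>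
    (\<forall>R\<in>\<Q>. dens Q R \<in> Linf_ball Q (dens Q P) \<epsilon> \<longrightarrow> g R < r)}"
  have "openin (Linf_topology Q) V" unfolding V_def by (rule openin_Union) (auto simp: openin_Linf_ball)
  moreover have "{P \<in> \<Q>. g P < r} = dens Q -` V \<inter> \<Q>"
  proof (intro equalityI subsetI)
    fix P assume P: "P \<in> {P \<in> \<Q>. g P < r}"
    have "\<exists>\<epsilon>>0. \<forall>R\<in>\<Q>. dens Q R \<in> Linf_ball Q (dens Q P) \<epsilon> \<longrightarrow> g R < r"
    proof (rule ccontr)
      assume neg: "\<not> ?thesis"
      have "\<forall>n::nat. \<exists>R\<in>\<Q>. dens Q R \<in> Linf_ball Q (dens Q P) (1 / real (Suc n)) \<and> r \<le> g R"
      proof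
        fix n :: nat
        have "0 < 1 / real (Suc n)" by simp
        then show "\<exists>R\<in>\<Q>. dens Q R \<in> Linf_ball Q (dens Q P) (1 / real (Suc n)) \<and> r \<le> g R"
          using neg by (meson not_le)
      qed
      then obtain R where R: "\<And>n::nat. R n \<in> \<Q>"
        "\<And>n. dens Q (R n) \<in> Linf_ball Q (dens Q P) (1 / real (Suc n))" "\<And>n. r \<le> g (R n)" by metis
      then have "r \<le> g P" using P by (intro usc[of P R] Linf_ballD) auto
      then show False using P by (auto dest: leD)
    qed
    then show "P \<in> dens Q -` V \<inter> \<Q>" using P sub Linf_ball_center[of "dens Q P" Q] unfolding V_def by blast
  qed (auto simp: V_def)
  ultimately have "openin (dens_topology Q \<Q>) {P \<in> \<Q>. g P < r}"
    unfolding dens_topology_def openin_pullback_topology by blast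
  then show "{P \<in> space (borel_of (dens_topology Q \<Q>)). g P < r} \<in> sets (borel_of (dens_topology Q \<Q>))"
    by (simp add: space_borel_of topspace_dens_topology[OF sub] borel_of_openin)
qed

lemma equivalent_prob_density:
  assumes "prob_space Q" and P: "equivalent_prob Q P"
  shows "density Q (\<lambda>\<omega>. ennreal (dens Q P \<omega>)) = P"
proof -
  interpret prob_space Q by fact
  interpret P: prob_space P using P by (simp add: equivalent_prob_def)
  have ac: "absolutely_continuous Q P" "sets P = sets Q" using P by (auto simp: equivalent_prob_def)
  \<comment> \<open>\<open>dens\<close> sends an infinite derivative to 0, which is harmless because
    that happens only on a null set.\<close>
  have "AE \<omega> in Q. RN_deriv Q P \<omega> \<noteq> \<infinity>" by (rule RN_deriv_finite[OF P.sigma_finite_measure_axioms ac])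
  then have "AE \<omega> in Q. ennreal (dens Q P \<omega>) = RN_deriv Q P \<omega>"
    by eventually_elim (simp add: dens_def less_top)
  then have "density Q (\<lambda>\<omega>. ennreal (dens Q P \<omega>)) = density Q (RN_deriv Q P)"
    by (intro density_cong) (auto simp: dens_def)
  then show ?thesis using density_RN_deriv[OF ac] by simp
qed

lemma dens_measurable [measurable]: "dens Q P \<in> borel_measurable Q"
  by (simp add: dens_def)

lemma dens_nonneg: "0 \<le> dens Q P \<omega>"
  by (simp add: dens_def)

lemma
  fixes f :: "'a \<Rightarrow> real"
  assumes "prob_space Q" "equivalent_prob Q P" "f \<in> borel_measurable Q"
  shows integral_equivalent_prob: "integral\<^sup>L P f = integral\<^sup>L Q (\<lambda>\<omega>. dens Q P \<omega> * f \<omega>)"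
    and integrable_equivalent_prob: "integrable P f \<longleftrightarrow> integrable Q (\<lambda>\<omega>. dens Q P \<omega> * f \<omega>)"
  using integral_real_density[of "dens Q P" Q f] integrable_real_density[of "dens Q P" Q f]
    equivalent_prob_density[OF assms(1,2)] assms(3)
  by (auto simp: dens_nonneg)

lemma integrable_equivalent_prob_bounded:
  fixes f :: "'a \<Rightarrow> real"
  assumes Q: "prob_space Q" and P: "equivalent_prob Q P" and bdd: "dens Q P \<in> Linf_space Q"
    and f: "integrable Q f"
  shows "integrable P f"
proof -
  obtain C where "AE \<omega> in Q. \<bar>dens Q P \<omega>\<bar> \<le> C" using AE_abs_le_Linf_norm[OF bdd] by blast
  then have "integrable Q (\<lambda>\<omega>. dens Q P \<omega> * f \<omega>)"
    using f by (intro Bochner_Integration.integrable_bound[OF integrable_mult_right[OF f, of C]])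
      (auto simp: abs_mult elim!: eventually_mono intro!: mult_right_mono)
  then show ?thesis using integrable_equivalent_prob[OF Q P] f by simp
qed

lemma AE_equivalent_prob:
  assumes "equivalent_prob Q P" "AE \<omega> in Q. R \<omega>"
  shows "AE \<omega> in P. R \<omega>"
  using assms by (auto simp: equivalent_prob_def intro: absolutely_continuous_AE)

lemma measurable_equivalent_prob:
  assumes "equivalent_prob Q P"
  shows "borel_measurable P = borel_measurable Q"
  using assms by (auto simp: equivalent_prob_def intro!: measurable_cong_sets)

section \<open>Utility of the principal\<close>

lemma concave_mono_linear_bound:
  fixes v :: "real \<Rightarrow> real"
  assumes v: "concave_on UNIV v" "mono v"
  shows "v w \<le> \<bar>v 0\<bar> + \<bar>v 1\<bar> + (v 1 - v 0) * \<bar>w\<bar>"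
proof -
  have inc: "v 0 \<le> v 1" using v(2) by (simp add: monoD)
  show ?thesis
  proof (cases "w \<le> 1")
    case True
    then have "v w \<le> v 1" using v(2) by (simp add: monoD)
    moreover have "0 \<le> (v 1 - v 0) * \<bar>w\<bar>" using inc by simp
    ultimately show ?thesis by linarith
  next
    case False
    have "convex_on UNIV (\<lambda>x. - v x)" using v(1) by (simp add: concave_on_def)
    \<comment> \<open>The point 1 is the mixture of 0 and \<open>w\<close> with weight
      \<open>1 / w\<close>; beyond 1 the graph stays under the chord through the points at 0 and
      1.\<close>
    from convex_onD[OF this, of "1 / w" 0 w] False
    have "(1 - 1 / w) * v 0 + 1 / w * v w \<le> v 1" by simp
    then have "w * ((1 - 1 / w) * v 0 + 1 / w * v w) \<le> w * v 1"
      using False by (intro mult_left_mono) auto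
    moreover have "w * ((1 - 1 / w) * v 0 + 1 / w * v w) = (w - 1) * v 0 + v w"
      using False by (simp add: field_simps)
    ultimately have "v w \<le> v 0 + (v 1 - v 0) * w" by (simp add: algebra_simps)
    then show ?thesis using False by simp
  qed
qed

lemma concave_continuous:
  fixes v :: "real \<Rightarrow> real"
  assumes "concave_on UNIV v"
  shows "continuous_on UNIV v"
proof -
  have "continuous_on UNIV (\<lambda>x. - v x)"
    using assms by (intro convex_on_continuous) (auto simp: concave_on_def)
  then have "continuous_on UNIV (\<lambda>x. - (- v x))" by (rule continuous_on_minus)
  then show ?thesis by simp
qed

locale principal = prob_space Q for Q :: "'a measure" +
  fixes P' :: "'a measure" and e\<^sub>a e\<^sub>p :: "'a \<Rightarrow> real" and v :: "real \<Rightarrow> real"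
  assumes e\<^sub>a_Linf: "e\<^sub>a \<in> Linf_space Q" and e\<^sub>p_integrable: "integrable Q e\<^sub>p"
    and v: "concave_on UNIV v" "mono v"
    and P': "equivalent_prob Q P'" "dens Q P' \<in> Linf_space Q"
begin

abbreviation "g \<equiv> \<lambda>x. principal_utility v e\<^sub>p e\<^sub>a P' x"

text \<open>The linear majorant of \<open>v\<close> at the total endowment. As \<open>v\<close> is
  nondecreasing, it dominates the principal's payoff for all nonnegative payments at once.\<close>

definition bound :: "'a \<Rightarrow> real" where
  "bound \<omega> = \<bar>v 0\<bar> + \<bar>v 1\<bar> + (v 1 - v 0) * \<bar>e\<^sub>p \<omega> + e\<^sub>a \<omega>\<bar>"

lemma v_measurable [measurable]: "v \<in> borel_measurable borel"
  using concave_continuous[OF v(1)] by (rule borel_measurable_continuous_onI)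

lemma endowments_measurable [measurable]:
  "e\<^sub>a \<in> borel_measurable Q" "e\<^sub>p \<in> borel_measurable Q"
  using e\<^sub>a_Linf e\<^sub>p_integrable by (auto simp: Linf_space_def)

lemma integrable_bound: "integrable P' bound"
proof (rule integrable_equivalent_prob_bounded[OF prob_space_axioms P'])
  have "integrable Q e\<^sub>a"
    using AE_abs_le_Linf_norm[OF e\<^sub>a_Linf] by (intro integrable_const_bound[of _ "real_of_ereal (Linf_norm Q e\<^sub>a)"]) auto
  then show "integrable Q bound" unfolding bound_def using e\<^sub>p_integrable by auto
qed

lemma bound_nonneg: "0 \<le> bound \<omega>"
proof -
  have "v 0 \<le> v 1" using v(2) by (simp add: monoD)
  then show ?thesis by (simp add: bound_def)
qed

lemma payoff_le_bound:
  assumes "AE \<omega> in Q. 0 \<le> x \<omega>"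
  shows "AE \<omega> in P'. v (e\<^sub>p \<omega> + e\<^sub>a \<omega> - x \<omega>) \<le> bound \<omega>"
  using AE_equivalent_prob[OF P'(1) assms]
proof eventually_elim
  case (elim \<omega>)
  then have "v (e\<^sub>p \<omega> + e\<^sub>a \<omega> - x \<omega>) \<le> v (e\<^sub>p \<omega> + e\<^sub>a \<omega>)" using v(2) by (simp add: monoD)
  then show ?case using concave_mono_linear_bound[OF v, of "e\<^sub>p \<omega> + e\<^sub>a \<omega>"] by (simp add: bound_def)
qed

lemma payoff_measurable:
  assumes [measurable]: "x \<in> borel_measurable Q"
  shows "(\<lambda>\<omega>. v (e\<^sub>p \<omega> + e\<^sub>a \<omega> - x \<omega>)) \<in> borel_measurable P'"
  unfolding measurable_equivalent_prob[OF P'(1)] by measurable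

lemma principal_utility_le:
  assumes "AE \<omega> in Q. 0 \<le> x \<omega>"
  shows "g x \<le> ereal (integral\<^sup>L P' bound)"
  unfolding principal_utility_def expect_integrable[OF integrable_bound, symmetric]
  using payoff_le_bound[OF assms] by (intro ext_integral_mono_AE) auto

lemma principal_utility_midpoint:
  assumes [measurable]: "x \<in> borel_measurable Q" "y \<in> borel_measurable Q" "m \<in> borel_measurable Q"
    and nn: "AE \<omega> in Q. 0 \<le> x \<omega>" "AE \<omega> in Q. 0 \<le> y \<omega>" "AE \<omega> in Q. 0 \<le> m \<omega>"
    and m: "AE \<omega> in Q. m \<omega> \<le> (x \<omega> + y \<omega>) / 2" and r: "r \<le> g x" "r \<le> g y"
  shows "r \<le> g m"
proof -
  have "AE \<omega> in P'. (v (e\<^sub>p \<omega> + e\<^sub>a \<omega> - x \<omega>) + v (e\<^sub>p \<omega> + e\<^sub>a \<omega> - y \<omega>)) / 2 \<le> v (e\<^sub>p \<omega> + e\<^sub>a \<omega> - m \<omega>)"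
    using AE_equivalent_prob[OF P'(1) m]
  proof eventually_elim
    case (elim \<omega>)
    define a b where "a = e\<^sub>p \<omega> + e\<^sub>a \<omega> - x \<omega>" and "b = e\<^sub>p \<omega> + e\<^sub>a \<omega> - y \<omega>"
    have "convex_on UNIV (\<lambda>x. - v x)" using v(1) by (simp add: concave_on_def)
    from convex_onD[OF this, of "1 / 2" a b] have "(v a + v b) / 2 \<le> v ((a + b) / 2)"
      by (simp add: field_simps)
    also have "\<dots> \<le> v (e\<^sub>p \<omega> + e\<^sub>a \<omega> - m \<omega>)"
      using elim by (intro monoD[OF v(2)]) (simp add: a_def b_def field_simps)
    finally show ?case by (simp add: a_def b_def)
  qed
  then show ?thesis
    using r unfolding principal_utility_def
    by (intro le_expect_midpoint[OF _ _ _ integrable_bound _ _ _ _ r[unfolded principal_utility_def]]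
        payoff_measurable payoff_le_bound nn) auto
qed

lemma principal_utility_usc:
  fixes x :: "nat \<Rightarrow> 'a \<Rightarrow> real"
  assumes [measurable]: "\<And>n. x n \<in> borel_measurable Q" and nn: "\<And>n. AE \<omega> in Q. 0 \<le> x n \<omega>"
    and lim: "AE \<omega> in Q. (\<lambda>n. x n \<omega>) \<longlonglongrightarrow> z \<omega>" and r: "\<And>n. r \<le> g (x n)"
  shows "r \<le> g z"
proof -
  have "r \<le> ext_integral P' (\<lambda>\<omega>. limsup (\<lambda>n. ereal (v (e\<^sub>p \<omega> + e\<^sub>a \<omega> - x n \<omega>))))"
  proof (rule le_ext_integral_limsup[OF _ integrable_bound bound_nonneg])
    show "(\<lambda>\<omega>. ereal (v (e\<^sub>p \<omega> + e\<^sub>a \<omega> - x n \<omega>))) \<in> borel_measurable P'" for n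
      by (intro borel_measurable_ereal payoff_measurable) measurable
    show "AE \<omega> in P'. ereal (v (e\<^sub>p \<omega> + e\<^sub>a \<omega> - x n \<omega>)) \<le> ereal (bound \<omega>)" for n
      using payoff_le_bound[OF nn] by simp
    show "\<exists>\<^sub>F n in sequentially. r \<le> ext_integral P' (\<lambda>\<omega>. ereal (v (e\<^sub>p \<omega> + e\<^sub>a \<omega> - x n \<omega>)))"
      using r unfolding principal_utility_def by (intro eventually_frequently always_eventually) auto
  qed
  also have "\<dots> = g z"
    unfolding principal_utility_def
  proof (rule ext_integral_cong_AE)
    show "AE \<omega> in P'. limsup (\<lambda>n. ereal (v (e\<^sub>p \<omega> + e\<^sub>a \<omega> - x n \<omega>))) = ereal (v (e\<^sub>p \<omega> + e\<^sub>a \<omega> - z \<omega>))"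
      using AE_equivalent_prob[OF P'(1) lim]
    proof eventually_elim
      case (elim \<omega>)
      have "isCont v (e\<^sub>p \<omega> + e\<^sub>a \<omega> - z \<omega>)"
        using concave_continuous[OF v(1)] by (simp add: continuous_on_eq_continuous_at)
      then have "(\<lambda>n. v (e\<^sub>p \<omega> + e\<^sub>a \<omega> - x n \<omega>)) \<longlonglongrightarrow> v (e\<^sub>p \<omega> + e\<^sub>a \<omega> - z \<omega>)"
        by (rule isCont_tendsto_compose) (intro tendsto_intros elim)
      then show ?case by (intro lim_imp_Limsup) auto
    qed
  qed
  finally show ?thesis .
qed

end

section \<open>Existence of an optimal mechanism\<close>

theorem theorem7:
  fixes Q P' :: "'a measure"
    and u v :: "real \<Rightarrow> real"
    and X :: "('a \<Rightarrow> real) set"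
    and e\<^sub>a e\<^sub>p :: "'a \<Rightarrow> real"
    and \<Q> :: "'a measure set"
    and K :: "'a measure measure set"
    and \<alpha> :: "'a measure measure \<Rightarrow> real"
  assumes Q: "prob_space Q"
    and u: "utility_fn u"
    and X_subset: "X \<subseteq> borel_measurable Q"
    and X_convex: "L0_convex X"
    and X_closed: "closedin (L0_topology Q) X"
    and X_bounded: "\<And>l::real. bounded_in_prob Q {x\<in>X. AE \<omega> in Q. l \<le> x \<omega>}"
    and e\<^sub>a: "e\<^sub>a \<in> Linf_space Q" "AE \<omega> in Q. 0 \<le> e\<^sub>a \<omega>"
    and e\<^sub>p: "integrable Q e\<^sub>p"
    and v: "concave_on UNIV v" "mono v"
    and P': "equivalent_prob Q P'" "dens Q P' \<in> Linf_space Q"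
    and finite_sup:
      "(SUP x\<in>attainable Q X (\<lambda>_. real_of_ereal (Linf_norm Q e\<^sub>a)). expect Q (\<lambda>\<omega>. u (x \<omega>))) < \<infinity>"
    and \<Q>: "\<Q> \<noteq> {}" "\<And>P. P \<in> \<Q> \<Longrightarrow> equivalent_prob Q P"
      "compactin (Linf_topology Q) (dens Q ` \<Q>)"
    and K: "K \<noteq> {}" "\<And>\<kappa>. \<kappa> \<in> K \<Longrightarrow> regular_borel_prob (dens_topology Q \<Q>) \<kappa>"
    and \<alpha>: "convex_penalty K \<alpha>"
  shows "((\<exists>x\<in>attainable Q X e\<^sub>a. individually_rational u e\<^sub>a \<Q> x) \<longrightarrow>
           (\<exists>x. feasible Q u X e\<^sub>a e\<^sub>p v P' \<Q> x \<and>
             (\<forall>y. feasible Q u X e\<^sub>a e\<^sub>p v P' \<Q> y \<longrightarrow>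
               objective v e\<^sub>p e\<^sub>a P' K \<alpha> y \<le> objective v e\<^sub>p e\<^sub>a P' K \<alpha> x))) \<and>
         ((\<lambda>_. 0) \<in> X \<longrightarrow> (\<exists>x\<in>attainable Q X e\<^sub>a. individually_rational u e\<^sub>a \<Q> x))"
proof -
  interpret Q: prob_space Q by fact

  \<comment> \<open>Reduction to the abstract contract problem\<close>
  define \<rho> where "\<rho> z = u (max 0 z) - u 0" for z
  interpret concave_chart \<rho> unfolding \<rho>_def[abs_def] by (rule utility_concave_chart[OF u])
  interpret market Q X by unfold_locales fact+
  interpret principal Q P' e\<^sub>a e\<^sub>p v by unfold_locales (fact e\<^sub>a e\<^sub>p v P')+
  define c where "c = real_of_ereal (Linf_norm Q e\<^sub>a)"
  have e_c: "AE \<omega> in Q. e\<^sub>a \<omega> \<le> c"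
    using AE_abs_le_Linf_norm[OF e\<^sub>a(1)] unfolding c_def by eventually_elim simp
  have \<rho>_u: "\<rho> z = u z - u 0" if "0 \<le> z" for z using that by (simp add: \<rho>_def)
  obtain S :: real where S: "\<And>x. x \<in> attainable Q X (\<lambda>_. c) \<Longrightarrow> expect Q (\<lambda>\<omega>. u (x \<omega>)) \<le> ereal S"
  proof -
    \<comment> \<open>The supremum is \<open>-\<infinity>\<close> when nothing is attainable;
      \<open>real_of_ereal\<close> then returns 0, which is still an upper bound.\<close>
    define s where "s = (SUP x\<in>attainable Q X (\<lambda>_. c). expect Q (\<lambda>\<omega>. u (x \<omega>)))"
    have "s \<le> ereal (real_of_ereal s)" if "s \<noteq> -\<infinity>"
      using finite_sup that unfolding s_def[symmetric] c_def[symmetric] by (cases s) auto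
    then have "s \<le> ereal (real_of_ereal s)" by (cases "s = -\<infinity>") auto
    then show ?thesis
      using that[of "real_of_ereal s"] unfolding s_def by (meson SUP_upper order_trans)
  qed
  interpret agent Q X \<rho> e\<^sub>a c "S - u 0"
  proof
    fix x assume x: "x \<in> attainable Q X e\<^sub>a"
    then have [measurable]: "x \<in> borel_measurable Q" and x0: "AE \<omega> in Q. 0 \<le> x \<omega>"
      by (auto simp: attainable_def)
    obtain x' where "x' \<in> X" "AE \<omega> in Q. x \<omega> \<le> c + x' \<omega>"
      using attainable_dominated[OF x e_c] by metis
    \<comment> \<open>The finiteness hypothesis concerns the constant endowment \<open>c\<close>;
      payoffs attainable from \<open>e\<^sub>a\<close> are attainable from it. As utility is bounded
      below by \<open>u 0\<close>, finite expected utility then yields integrability.\<close>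
    then have "x \<in> attainable Q X (\<lambda>_. c)" using x0 by (auto simp: attainable_def)
    moreover have "expect Q (\<lambda>\<omega>. u (x \<omega>)) = expect Q (\<lambda>\<omega>. \<rho> (x \<omega>) + u 0)"
      using x0 by (intro ext_integral_cong_AE) (auto elim!: eventually_mono simp: \<rho>_u)
    ultimately have le: "expect Q (\<lambda>\<omega>. \<rho> (x \<omega>) + u 0) \<le> ereal S" using S[of x] by simp
    have l: "AE \<omega> in Q. u 0 \<le> \<rho> (x \<omega>) + u 0" by (simp add: nonneg)
    have int: "integrable Q (\<lambda>\<omega>. \<rho> (x \<omega>) + u 0)" and S': "Q.expectation (\<lambda>\<omega>. \<rho> (x \<omega>) + u 0) \<le> S"
      using integrable_of_expect_le[OF Q.finite_measure_axioms _ l le] by auto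
    from Bochner_Integration.integrable_diff[OF int, of "\<lambda>_. u 0"]
    show int': "integrable Q (\<lambda>\<omega>. \<rho> (x \<omega>))" by simp
    show "Q.expectation (\<lambda>\<omega>. \<rho> (x \<omega>)) \<le> S - u 0" using S' int' by (simp add: Q.prob_space)
  qed (rule e_c)
  have dens_sub: "dens Q ` \<Q> \<subseteq> Linf_space Q"
    using compactin_subset_topspace[OF \<Q>(3)] by (simp add: topspace_Linf_topology)
  interpret contract_problem Q X \<rho> e\<^sub>a c "S - u 0" g \<Q> "dens Q"
  proof
    fix x y m r assume "x \<in> A" "y \<in> A" "m \<in> A" "AE \<omega> in Q. m \<omega> \<le> (x \<omega> + y \<omega>) / 2" "r \<le> g x" "r \<le> g y"
    then show "r \<le> g m" by (intro principal_utility_midpoint[of x y m] A_measurable A_nonneg)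
  next
    fix x z r assume "\<And>n. x n \<in> A" "AE \<omega> in Q. (\<lambda>n. x n \<omega>) \<longlonglongrightarrow> z \<omega>" "\<And>n::nat. r \<le> g (x n)"
    then show "r \<le> g z" by (intro principal_utility_usc[of x z] A_measurable A_nonneg)
  next
    fix P assume "P \<in> \<Q>"
    then have "AE \<omega> in Q. \<bar>dens Q P \<omega>\<bar> \<le> real_of_ereal (Linf_norm Q (dens Q P))"
      using dens_sub by (intro AE_abs_le_Linf_norm) auto
    then have "AE \<omega> in Q. dens Q P \<omega> \<le> real_of_ereal (Linf_norm Q (dens Q P))"
      by eventually_elim simp
    then show "dens Q P \<in> weights" by (auto simp: weights_def dens_nonneg)
  next
    fix \<epsilon> :: real assume "0 < \<epsilon>"
    then show "\<exists>F\<subseteq>\<Q>. finite F \<and> (\<forall>P\<in>\<Q>. \<exists>P'\<in>F. AE \<omega> in Q. \<bar>dens Q P \<omega> - dens Q P' \<omega>\<bar> \<le> \<epsilon>)"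
      by (rule compactin_Linf_totally_bounded[OF \<Q>(3)])
  qed

  \<comment> \<open>The constraints in chart coordinates\<close>
  have int_A: "integrable P (\<lambda>\<omega>. \<rho> (x \<omega>))" and eu_A: "integral\<^sup>L P (\<lambda>\<omega>. \<rho> (x \<omega>)) = EU (dens Q P) x"
    if "P \<in> \<Q>" "x \<in> A" for P x
  proof -
    note [measurable] = A_measurable[OF that(2)]
    have \<rho>x: "(\<lambda>\<omega>. \<rho> (x \<omega>)) \<in> borel_measurable Q" by measurable
    show "integrable P (\<lambda>\<omega>. \<rho> (x \<omega>))"
      using integrable_EU[OF d_weights[OF that(1)] that(2)]
        integrable_equivalent_prob[OF Q \<Q>(2)[OF that(1)] \<rho>x] by simp
    show "integral\<^sup>L P (\<lambda>\<omega>. \<rho> (x \<omega>)) = EU (dens Q P) x"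
      unfolding EU_def by (rule integral_equivalent_prob[OF Q \<Q>(2)[OF that(1)] \<rho>x])
  qed
  \<comment> \<open>The endowment itself may fail to be attainable, so its utility is shown
    integrable through boundedness.\<close>
  have int_ea: "integrable P (\<lambda>\<omega>. \<rho> (e\<^sub>a \<omega>))" if P: "P \<in> \<Q>" for P
  proof -
    interpret P: prob_space P using \<Q>(2)[OF P] by (simp add: equivalent_prob_def)
    have "AE \<omega> in P. e\<^sub>a \<omega> \<le> c" by (rule AE_equivalent_prob[OF \<Q>(2)[OF P] e_c])
    then have "AE \<omega> in P. norm (\<rho> (e\<^sub>a \<omega>)) \<le> \<rho> c"
      by eventually_elim (simp add: nonneg mono)
    moreover have "(\<lambda>\<omega>. \<rho> (e\<^sub>a \<omega>)) \<in> borel_measurable P"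
      unfolding measurable_equivalent_prob[OF \<Q>(2)[OF P]] by measurable
    ultimately show ?thesis by (rule P.integrable_const_bound)
  qed
  have expect_diff: "expect P (\<lambda>\<omega>. u (x \<omega>) - u (y \<omega>))
      = ereal (integral\<^sup>L P (\<lambda>\<omega>. \<rho> (x \<omega>)) - integral\<^sup>L P (\<lambda>\<omega>. \<rho> (y \<omega>)))"
    if P: "P \<in> \<Q>" and nn: "AE \<omega> in Q. 0 \<le> x \<omega>" "AE \<omega> in Q. 0 \<le> y \<omega>"
      and int: "integrable P (\<lambda>\<omega>. \<rho> (x \<omega>))" "integrable P (\<lambda>\<omega>. \<rho> (y \<omega>))" for P x y
  proof -
    have "expect P (\<lambda>\<omega>. u (x \<omega>) - u (y \<omega>)) = expect P (\<lambda>\<omega>. \<rho> (x \<omega>) - \<rho> (y \<omega>))"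
      using AE_equivalent_prob[OF \<Q>(2)[OF P] nn(1)] AE_equivalent_prob[OF \<Q>(2)[OF P] nn(2)]
      by (intro ext_integral_cong_AE) (auto elim!: eventually_elim2 simp: \<rho>_u)
    then show ?thesis using int by (simp add: expect_integrable)
  qed
  have expect_u: "expect P (\<lambda>\<omega>. u (x \<omega>)) = ereal (integral\<^sup>L P (\<lambda>\<omega>. \<rho> (x \<omega>)) + u 0)"
    if P: "P \<in> \<Q>" and nn: "AE \<omega> in Q. 0 \<le> x \<omega>" and int: "integrable P (\<lambda>\<omega>. \<rho> (x \<omega>))" for P x
  proof -
    interpret P: prob_space P using \<Q>(2)[OF P] by (simp add: equivalent_prob_def)
    have "expect P (\<lambda>\<omega>. u (x \<omega>)) = expect P (\<lambda>\<omega>. \<rho> (x \<omega>) + u 0)"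
      using AE_equivalent_prob[OF \<Q>(2)[OF P] nn]
      by (intro ext_integral_cong_AE) (auto elim!: eventually_mono simp: \<rho>_u)
    then show ?thesis using int by (simp add: expect_integrable P.prob_space)
  qed
  define Ea where "Ea P = integral\<^sup>L P (\<lambda>\<omega>. \<rho> (e\<^sub>a \<omega>))" for P
  let ?feasible = "feasible Q u X e\<^sub>a e\<^sub>p v P' \<Q>"
  let ?objective = "objective v e\<^sub>p e\<^sub>a P' K \<alpha>"
  let ?borel = "borel_of (dens_topology Q \<Q>)"
  have feasible_iff: "?feasible x \<longleftrightarrow> incentive_compatible x \<and>
      (\<lambda>P. g (x P)) \<in> borel_measurable ?borel \<and> (\<forall>P\<in>\<Q>. Ea P \<le> EU (dens Q P) (x P))" for x
  proof -
    have ir: "expect P (\<lambda>\<omega>. u (x P \<omega>) - u (e\<^sub>a \<omega>)) \<ge> 0 \<longleftrightarrow> Ea P \<le> EU (dens Q P) (x P)"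
      if "P \<in> \<Q>" "x P \<in> A" for P
      unfolding expect_diff[OF that(1) A_nonneg[OF that(2)] e\<^sub>a(2) int_A[OF that] int_ea[OF that(1)]]
        eu_A[OF that] Ea_def[symmetric] by simp
    have ic: "expect P (\<lambda>\<omega>. u (x P \<omega>) - u (x P1 \<omega>)) \<ge> 0 \<longleftrightarrow> EU (dens Q P) (x P1) \<le> EU (dens Q P) (x P)"
      if "P \<in> \<Q>" "x P \<in> A" "x P1 \<in> A" for P P1
      unfolding expect_diff[OF that(1) A_nonneg[OF that(2)] A_nonneg[OF that(3)]
          int_A[OF that(1,2)] int_A[OF that(1,3)]] eu_A[OF that(1,2)] eu_A[OF that(1,3)] by simp
    show ?thesis
    \<comment> \<open>The translations \<open>ir\<close> and \<open>ic\<close> hold only for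
      attainable payoffs; if attainability fails, both sides are false.\<close>
    proof (cases "\<forall>P\<in>\<Q>. x P \<in> A")
      case True
      then show ?thesis
        unfolding feasible_def incentive_compatible_def by (simp add: ir ic cong: ball_cong) blast
    next
      case False
      then show ?thesis by (simp only: feasible_def incentive_compatible_def simp_thms)
    qed
  qed
  have dens_space: "space ?borel = \<Q>" by (simp add: space_borel_of topspace_dens_topology[OF dens_sub])

  \<comment> \<open>Optimality of the limit mechanism\<close>
  have "\<exists>x. ?feasible x \<and> (\<forall>y. ?feasible y \<longrightarrow> ?objective y \<le> ?objective x)"
    if xs: "x\<^sub>0 \<in> A" "individually_rational u e\<^sub>a \<Q> x\<^sub>0" for x\<^sub>0
  proof -
    have "Ea P \<le> EU (dens Q P) x\<^sub>0" if P: "P \<in> \<Q>" for P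
    proof -
      have "expect P (\<lambda>\<omega>. u (e\<^sub>a \<omega>)) \<le> expect P (\<lambda>\<omega>. u (x\<^sub>0 \<omega>))"
        using xs(2) P by (simp add: individually_rational_def)
      then show ?thesis
        unfolding expect_u[OF P A_nonneg[OF xs(1)] int_A[OF P xs(1)]]
          expect_u[OF P e\<^sub>a(2) int_ea[OF P]] eu_A[OF P xs(1)] Ea_def by simp
    qed
    \<comment> \<open>Offering the same contract to every prior is trivially incentive compatible
      and has a constant value function; this starts the maximizing sequence.\<close>
    then have "?feasible (\<lambda>_. x\<^sub>0)" using xs(1) by (simp add: feasible_iff incentive_compatible_def)
    then have "?objective ` Collect ?feasible \<noteq> {}" by blast
    from Sup_countable_SUP[OF this] obtain h where h: "incseq h" "range h \<subseteq> ?objective ` Collect ?feasible"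
      "Sup (?objective ` Collect ?feasible) = (SUP i. h i)" by blast
    have "\<forall>n. \<exists>x. ?feasible x \<and> h n = ?objective x" using h(2) by blast
    then obtain x where x: "\<And>n. ?feasible (x n)" and hx: "\<And>n. h n = ?objective (x n)" by metis
    have ic: "incentive_compatible (x n)" for n using x feasible_iff by blast
    obtain t y where t: "strict_mono t" and y_ic: "incentive_compatible y"
      and y_ir: "\<And>P r. P \<in> \<Q> \<Longrightarrow> (\<And>n. r \<le> EU (dens Q P) (x n P)) \<Longrightarrow> r \<le> EU (dens Q P) (y P)"
      and y_g: "\<And>P. P \<in> \<Q> \<Longrightarrow> limsup (\<lambda>n. g (x (t n) P)) \<le> g (y P)"
      and y_usc: "\<And>P R r. P \<in> \<Q> \<Longrightarrow> (\<And>n::nat. R n \<in> \<Q>) \<Longrightarrow>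
         (\<And>n. AE \<omega> in Q. \<bar>dens Q P \<omega> - dens Q (R n) \<omega>\<bar> \<le> 1 / real (Suc n)) \<Longrightarrow>
         (\<And>n. r \<le> g (y (R n))) \<Longrightarrow> r \<le> g (y P)"
      by (rule limit_mechanism[of x, OF ic]) blast
    have y: "?feasible y"
      unfolding feasible_iff
    proof (intro conjI y_ic ballI)
      \<comment> \<open>\<open>y\<close> comes from an arbitrary choice; only the upper
        semicontinuity of its value function is available, and it suffices.\<close>
      show "(\<lambda>P. g (y P)) \<in> borel_measurable ?borel"
        by (rule usc_measurable_dens_topology[OF dens_sub y_usc])
      fix P assume P: "P \<in> \<Q>"
      show "Ea P \<le> EU (dens Q P) (y P)" by (rule y_ir[OF P]) (use x feasible_iff P in blast)
    qed
    have "(SUP i. h i) \<le> ?objective y"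
      unfolding objective_def
    \<comment> \<open>A value \<open>r\<close> strictly below the supremum is exceeded by some
      \<open>h N\<close>, and since \<open>h\<close> increases it stays below the objectives of all
      later mechanisms, in particular along \<open>t\<close>.\<close>
    proof (rule INF_greatest, rule dense_le)
      fix \<kappa> r assume \<kappa>: "\<kappa> \<in> K" and r: "r < (SUP i. h i)"
      have \<kappa>_prob: "prob_space \<kappa>" and \<kappa>_sets: "sets \<kappa> = sets ?borel"
        using K(2)[OF \<kappa>] by (auto simp: regular_borel_prob_def)
      interpret \<kappa>: prob_space \<kappa> by (rule \<kappa>_prob)
      have \<kappa>_space: "space \<kappa> = \<Q>" using sets_eq_imp_space_eq[OF \<kappa>_sets] dens_space by simp
      obtain N where N: "r < h N" using r by (auto simp: less_SUP_iff)
      \<comment> \<open>Reverse Fatou over the priors with a constant majorant: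
        \<open>principal_utility_le\<close> bounds the values of all attainable payoffs by the same
        number.\<close>
      have "r - ereal (\<alpha> \<kappa>) \<le> ext_integral \<kappa> (\<lambda>P. limsup (\<lambda>n. g (x (t n) P)))"
      proof (rule le_ext_integral_limsup[where b = "\<lambda>_. integral\<^sup>L P' bound"])
        show "(\<lambda>P. g (x (t n) P)) \<in> borel_measurable \<kappa>" for n
          using x[of "t n"] unfolding feasible_iff by (simp add: measurable_cong_sets[OF \<kappa>_sets refl])
        show "AE P in \<kappa>. g (x (t n) P) \<le> ereal (integral\<^sup>L P' bound)" for n
        proof (rule AE_I2)
          fix P assume "P \<in> space \<kappa>"
          then have "x (t n) P \<in> A" using ic by (simp add: incentive_compatible_def \<kappa>_space)
          then show "g (x (t n) P) \<le> ereal (integral\<^sup>L P' bound)" by (intro principal_utility_le A_nonneg)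
        qed
        have "r - ereal (\<alpha> \<kappa>) \<le> ext_integral \<kappa> (\<lambda>P. g (x (t n) P))" if "n \<ge> N" for n
        proof -
          have "N \<le> t n" using that seq_suble[OF t, of n] by linarith
          then have "r \<le> ?objective (x (t n))" using N incseqD[OF h(1)] hx by (metis less_imp_le order_trans)
          also have "\<dots> \<le> ext_integral \<kappa> (\<lambda>P. g (x (t n) P)) + ereal (\<alpha> \<kappa>)"
            unfolding objective_def by (rule INF_lower[OF \<kappa>])
          finally show ?thesis by (simp add: ereal_minus_le)
        qed
        then show "\<exists>\<^sub>F n in sequentially. r - ereal (\<alpha> \<kappa>) \<le> ext_integral \<kappa> (\<lambda>P. g (x (t n) P))"
          by (intro eventually_frequently eventually_sequentiallyI[of N]) auto
      qed (use bound_nonneg in auto)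
      also have "\<dots> \<le> ext_integral \<kappa> (\<lambda>P. g (y P))"
        using y_g by (intro ext_integral_mono_AE AE_I2) (simp add: \<kappa>_space)
      finally show "r \<le> ext_integral \<kappa> (\<lambda>P. g (y P)) + ereal (\<alpha> \<kappa>)" by (simp add: ereal_minus_le)
    qed
    then have "?objective w \<le> ?objective y" if "?feasible w" for w
      using that h(3) SUP_upper[of w "Collect ?feasible" ?objective] by simp
    then show ?thesis using y by blast
  qed
  \<comment> \<open>The agent's own endowment is the witness, dominated through the zero gain and
    rational with equality.\<close>
  moreover have "\<exists>x\<in>A. individually_rational u e\<^sub>a \<Q> x" if "(\<lambda>_. 0) \<in> X"
  proof (rule bexI)
    show "individually_rational u e\<^sub>a \<Q> e\<^sub>a" by (simp add: individually_rational_def)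
    show "e\<^sub>a \<in> A" using that e\<^sub>a by (auto simp: attainable_def Linf_space_def intro!: bexI[of _ "\<lambda>_. 0"])
  qed
  ultimately show ?thesis by blast
qed

end
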